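(* Let $(a,b,\theta)\in(0,1)^2\times[0,\pi/2)$ and let $Z=(x_1,x_2,y_1,y_2)\in\mathbb R_+^4$ be given by $$x_1=(1-b)\cos\theta,\quad x_2=b\cos\theta,\quad y_1=(1-a)\sin\theta,\quad y_2=a\sin\theta .$$ Assume that $Z$ is $F$-renormalizable and let $((m_k,n_k))_{k\ge0}$ be its $F$-convergents. If $n_k\equiv 0 \bmod 2$ for all $k\geq 0$, then any infinite forward billiard trajectory in direction $\theta$ in $T(a,b)$ is self-avoiding. In particular, the flow in direction $\theta$ in $T(a,b)$ is divergent.
   Context: Wind-tree model. For $0<a<1$, $0<b<1$, the billiard table $T(a,b)\subset\mathbb R^2$ is the plane with a rectangular obstacle of size $a\times b$ (horizontal side $a$, vertical side $b$, sides parallel to the axes) removed around each point of $\mathbb Z^2$ (each obstacle is centered at the integer point). A point particle moves in $T(a,b)$ in a straight line at unit speed and reflects elastically on the sides of the obstacles. $\phi^\theta_t(p)\in T(a,b)$ denotes the position at time $t$ of the particle that starts at $p$ with initial direction $(\cos\theta,\sin\theta)$. A forward trajectory is infinite if it is defined for all $t\ge0$ (it never hits a corner of an obstacle). It is self-avoiding if it does not intersect itself in the plane, i.e. $\phi_t^\theta(p)\ne\phi_{t'}^\theta(p)$ for all $0\le t<t'$. With $d$ the Euclidean distance, the flow in direction $\theta$ is divergent if $\liminf_{t\to\infty}d(p,\phi_t^\theta(p))=+\infty$ for Lebesgue almost every $p\in T(a,b)$. Renormalization. For a quadruple $Z=(x_1,x_2,y_1,y_2)$ of positive real numbers define $$m(Z)=\Big\lfloor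 \frac{x_1}{y_1+y_2}\Big\rfloor,\qquad n(Z)=\Big\lfloor\frac{x_2}{y_1}\Big\rfloor,\qquad F(Z)=\big(y_1,\;y_2,\;x_1-m(Z)(y_1+y_2),\;x_2-n(Z)\,y_1\big).$$ Consider the condition $$(\ast)\qquad x_1+x_2>y_1>x_2\quad\text{and}\quad y_1+y_2>x_1>y_2.$$ (If $Z$ satisfies $(\ast)$ then $F^2(Z)=Z$.) The quadruple $Z$ is called $F$-renormalizable if for all $k\ge0$ the iterate $F^k(Z)$ is a quadruple of positive real numbers (so that all iterates are defined) which does not satisfy $(\ast)$. Its $F$-convergents are the pairs $(m_k,n_k)=(m(F^k(Z)),n(F^k(Z)))$, $k\ge0$. *)

theory Defs
  imports "HOL-Analysis.Analysis"
begin

definition open_obstacle :: "real \<Rightarrow> real \<Rightarrow> int \<Rightarrow> int \<Rightarrow> (real \<times> real) set" where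
  "open_obstacle a b i j =
     {(x, y). \<bar>x - of_int i\<bar> < a / 2 \<and> \<bar>y - of_int j\<bar> < b / 2}"

(* The boundaries of the obstacles belong to the table: the particle bounces on them. *)
definition table :: "real \<Rightarrow> real \<Rightarrow> (real \<times> real) set" where
  "table a b = UNIV - (\<Union>i j. open_obstacle a b i j)"

(* The sides are taken without their end points, which are the corners. *)
definition vertical_sides :: "real \<Rightarrow> real \<Rightarrow> (real \<times> real) set" where
  "vertical_sides a b =
     {(x, y). \<exists>i j :: int. \<bar>x - of_int i\<bar> = a / 2 \<and> \<bar>y - of_int j\<bar> < b / 2}"

definition horizontal_sides :: "real \<Rightarrow> real \<Rightarrow> (real \<times> real) set" where
  "horizontal_sides a b =
     {(x, y). \<exists>i j :: int. \<bar>x - of_int i\<bar> < a / 2 \<and> \<bar>y - of_int j\<bar> = b / 2}"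

definition corners :: "real \<Rightarrow> real \<Rightarrow> (real \<times> real) set" where
  "corners a b =
     {(x, y). \<exists>i j :: int. \<bar>x - of_int i\<bar> = a / 2 \<and> \<bar>y - of_int j\<bar> = b / 2}"

definition reflect :: "real \<Rightarrow> real \<Rightarrow> real \<times> real \<Rightarrow> real \<times> real \<Rightarrow> real \<times> real" where
  "reflect a b q w =
     (if q \<in> vertical_sides a b then (- fst w, snd w)
      else if q \<in> horizontal_sides a b then (fst w, - snd w)
      else w)"

(* (\<gamma>, v) is the motion on the time interval [0, T]; v t is the velocity just after time t.
   To the right of every time the motion is uniform with velocity v t; to the left of every
   time t it is uniform, and v t is the incoming velocity, reflected if the particle is on a side.
   Initial velocity: if p is on a side and the direction \<theta> points into the obstacle, the
   particle is reflected at once. For T > 0 the disjunction on v 0 leaves no choice, since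
   from a point of a side one of the two velocities (if they differ) leaves the table. *)
definition billiard_motion ::
    "real \<Rightarrow> real \<Rightarrow> real \<Rightarrow> real \<times> real \<Rightarrow> real
     \<Rightarrow> (real \<Rightarrow> real \<times> real) \<Rightarrow> (real \<Rightarrow> real \<times> real) \<Rightarrow> bool" where
  "billiard_motion a b \<theta> p T \<gamma> v \<longleftrightarrow>
     \<gamma> 0 = p \<and>
     (v 0 = (cos \<theta>, sin \<theta>) \<or> v 0 = reflect a b p (cos \<theta>, sin \<theta>)) \<and>
     (\<forall>t\<in>{0..T}. \<gamma> t \<in> table a b - corners a b) \<and>
     (\<forall>t\<in>{0..<T}. \<exists>\<epsilon>>0. \<forall>s\<in>{t..<t + \<epsilon>} \<inter> {0..T}.
        \<gamma> s = \<gamma> t + (s - t) *\<^sub>R v t \<and> (s < T \<longrightarrow> v s = v t)) \<and>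
     (\<forall>t\<in>{0<..T}. \<exists>\<epsilon>>0. \<forall>s\<in>{t - \<epsilon><..<t} \<inter> {0..T}.
        \<gamma> t = \<gamma> s + (t - s) *\<^sub>R v s \<and> v t = reflect a b (\<gamma> t) (v s))"

definition position_at ::
    "real \<Rightarrow> real \<Rightarrow> real \<Rightarrow> real \<Rightarrow> real \<times> real \<Rightarrow> real \<times> real \<Rightarrow> bool" where
  "position_at a b \<theta> t p q \<longleftrightarrow> (\<exists>\<gamma> v. billiard_motion a b \<theta> p t \<gamma> v \<and> \<gamma> t = q)"

(* The position at time t \<ge> 0; meaningful only if the particle has not hit a corner up to time t. *)
definition flow :: "real \<Rightarrow> real \<Rightarrow> real \<Rightarrow> real \<Rightarrow> real \<times> real \<Rightarrow> real \<times> real" where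
  "flow a b \<theta> t p = (THE q. position_at a b \<theta> t p q)"

definition infinite_trajectory :: "real \<Rightarrow> real \<Rightarrow> real \<Rightarrow> real \<times> real \<Rightarrow> bool" where
  "infinite_trajectory a b \<theta> p \<longleftrightarrow> (\<forall>t\<ge>0. \<exists>q. position_at a b \<theta> t p q)"

definition self_avoiding :: "real \<Rightarrow> real \<Rightarrow> real \<Rightarrow> real \<times> real \<Rightarrow> bool" where
  "self_avoiding a b \<theta> p \<longleftrightarrow>
     (\<forall>t t'. 0 \<le> t \<and> t < t' \<longrightarrow> flow a b \<theta> t p \<noteq> flow a b \<theta> t' p)"

definition divergent_flow :: "real \<Rightarrow> real \<Rightarrow> real \<Rightarrow> bool" where
  "divergent_flow a b \<theta> \<longleftrightarrow>
     (AE p\<in>table a b in lebesgue.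
        infinite_trajectory a b \<theta> p \<and>
        Liminf at_top (\<lambda>t. ereal (dist p (flow a b \<theta> t p))) = \<infinity>)"

type_synonym quadruple = "real \<times> real \<times> real \<times> real"

fun m_conv :: "quadruple \<Rightarrow> int" where
  "m_conv (x1, x2, y1, y2) = \<lfloor>x1 / (y1 + y2)\<rfloor>"

fun n_conv :: "quadruple \<Rightarrow> int" where
  "n_conv (x1, x2, y1, y2) = \<lfloor>x2 / y1\<rfloor>"

fun F :: "quadruple \<Rightarrow> quadruple" where
  "F (x1, x2, y1, y2) =
     (y1, y2,
      x1 - of_int (m_conv (x1, x2, y1, y2)) * (y1 + y2),
      x2 - of_int (n_conv (x1, x2, y1, y2)) * y1)"

fun positive :: "quadruple \<Rightarrow> bool" where
  "positive (x1, x2, y1, y2) \<longleftrightarrow> 0 < x1 \<and> 0 < x2 \<and> 0 < y1 \<and> 0 < y2"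

fun star_condition :: "quadruple \<Rightarrow> bool" where
  "star_condition (x1, x2, y1, y2) \<longleftrightarrow>
     x1 + x2 > y1 \<and> y1 > x2 \<and> y1 + y2 > x1 \<and> x1 > y2"

definition F_renormalizable :: "quadruple \<Rightarrow> bool" where
  "F_renormalizable Z \<longleftrightarrow>
     (\<forall>k. positive ((F ^^ k) Z) \<and> \<not> star_condition ((F ^^ k) Z))"

definition F_convergent :: "quadruple \<Rightarrow> nat \<Rightarrow> int \<times> int" where
  "F_convergent Z k = (m_conv ((F ^^ k) Z), n_conv ((F ^^ k) Z))"

end

theory Submission
  imports Defs
begin

text \<open>
  The lines carrying the sides of the obstacles cut the plane into boxes indexed by pairs of integers:
  crossings (even, even), horizontal arms (odd, even), vertical arms (even, odd) and obstacles
  (odd, odd). A trajectory is coded by the word of its transitions between boxes, reflections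
  included, together with one real coordinate that is constant inside a box. Subtracting from the
  quadruple once its first reduction step, or twice its second one, amounts to removing inserted
  letters from the words: if the second convergent is even, the reflections off vertical sides are
  removed in pairs and the horizontal direction is preserved. Each letter of a renormalized word
  stands for a whole piece of the original trajectory; this piece is enclosed in a rectangle of boxes,
  and the rectangles of the original pieces are contained in the rectangle of the renormalized one.

  Along a word without reflections off vertical sides (or without reflections off horizontal sides)
  one coordinate is monotone, so that the rectangles of two different visits are disjoint. A word
  containing both kinds of reflections gets strictly shorter within three renormalization steps,
  since the convergents are not both zero after the first step. Hence a trajectory visits every box
  only once. During one visit one coordinate is strictly monotone, so the trajectory is injective and
  spends a bounded time in each box, hence leaves every bounded set. Finally, the starting points of
  trajectories that hit a corner lie on countably many lines.
\<close>

section \<open>Words of trajectories\<close>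

text \<open>Horizontal lengths are multiplied by \<open>sin \<theta>\<close> and vertical ones by
  \<open>cos \<theta>\<close>, so both coordinates grow at the same rate: the motion in a box
  becomes diagonal, one real number decides which side is reached first, and the substitutions act
  on it by translations. Equality of boxes is not preserved by renormalization, since the two visits
  may fall in the middle of blocks that begin and end elsewhere. What survives is that two
  rectangles of boxes meet, and this is what the induction carries. Three integers per axis describe
  these rectangles, because both substitutions and the exchange of the axes preserve the pattern of
  displacements. Parity enters through the signs: one inserted reflection would reverse all later
  horizontal displacements, while two of them cancel and leave \<open>Vin\<close> with horizontal
  weight 0. After one step of \<open>F\<close>, \<open>star_condition\<close> describes exactly the
  quadruples whose two convergents vanish, for which the next step would remove no letter. A nonzero
  convergent shortens only words in which \<open>Bt\<close> comes before some \<open>Rh\<close>; the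
  opposite order is caught one step later, when the axes are exchanged. The first step may have zero
  convergents, which makes three steps in all.\<close>

datatype cell = Crossing | HArm | VArm

text \<open>The letters name the transitions: into or out of a horizontal or vertical arm,
  \<open>Bt\<close> for a reflection off a horizontal side and \<open>Rh\<close> for one off a vertical side. The widths and
  heights of the boxes are measured across the direction of the flow.\<close>

datatype letter = Hin | Hout | Bt | Vin | Vout | Rh

fun target :: "letter \<Rightarrow> cell" where
  "target Hin = HArm" | "target Bt = HArm"
| "target Vin = VArm" | "target Rh = VArm"
| "target Hout = Crossing" | "target Vout = Crossing"

fun hexit :: "cell \<Rightarrow> letter" where
  "hexit Crossing = Hin" | "hexit HArm = Hout" | "hexit VArm = Rh"

fun vexit :: "cell \<Rightarrow> letter" where
  "vexit Crossing = Vin" | "vexit HArm = Bt" | "vexit VArm = Vout"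

fun width :: "quadruple \<Rightarrow> cell \<Rightarrow> real" where
  "width (x1, x2, y1, y2) k = (if k = HArm then y2 else y1)"

fun height :: "quadruple \<Rightarrow> cell \<Rightarrow> real" where
  "height (x1, x2, y1, y2) k = (if k = VArm then x2 else x1)"

text \<open>After renormalization a letter stands for a displacement by \<open>wgt\<close> original boxes. The pieces it
  abbreviates end at the box reached by the letter and reach back from it by at most \<open>extent\<close>.\<close>

type_synonym weights = "int \<times> int \<times> int"

fun wgt :: "weights \<Rightarrow> letter \<Rightarrow> int" where
  "wgt (p, g, r) Hin = p" | "wgt (p, g, r) Hout = 1 + r"
| "wgt (p, g, r) Bt = g" | "wgt (p, g, r) Vin = 0"
| "wgt (p, g, r) Vout = g" | "wgt (p, g, r) Rh = r"

fun extent :: "weights \<Rightarrow> letter \<Rightarrow> int" where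
  "extent (p, g, r) Hin = p - 1" | "extent (p, g, r) Hout = r"
| "extent (p, g, r) Bt = g" | "extent (p, g, r) Vin = r"
| "extent (p, g, r) Vout = g" | "extent (p, g, r) Rh = r"

fun valid :: "weights \<Rightarrow> bool" where
  "valid (p, g, r) \<longleftrightarrow> 1 \<le> p \<and> 0 \<le> g \<and> 0 \<le> r"

fun swapl :: "letter \<Rightarrow> letter" where
  "swapl Hin = Vin" | "swapl Hout = Vout" | "swapl Bt = Rh"
| "swapl Vin = Hin" | "swapl Vout = Hout" | "swapl Rh = Bt"

text \<open>If \<open>u\<close> and \<open>w\<close> are the distances covered since the vertical and the horizontal entry side, in the
  units of \<open>width\<close> and \<open>height\<close>, then \<open>co\<close> is the invariant \<open>u - w\<close>. The fields \<open>ex\<close>, \<open>ey\<close> are the signs of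
  the velocity and \<open>px\<close>, \<open>py\<close> is the last box of the piece.\<close>

datatype item = Item (lt: letter) (co: real) (ex: int) (ey: int) (px: int) (py: int)

text \<open>The displacement of a letter is traversed with the sign that holds after its
  reflection.\<close>

fun enter :: "weights \<Rightarrow> weights \<Rightarrow> letter \<Rightarrow> real \<Rightarrow> item \<Rightarrow> item" where
  "enter P Q l c (Item l0 c0 e d x y) =
     (let e' = (if l = Rh then - e else e); d' = (if l = Bt then - d else d)
      in Item l c e' d' (x + e' * wgt P l) (y + d' * wgt Q (swapl l)))"

text \<open>The exit is through a vertical side if the horizontal distance left is smaller than the
  vertical one; the distance that restarts at 0 gives the new \<open>co\<close>. A tie is a corner
  and has no successor.\<close>

definition move :: "quadruple \<Rightarrow> weights \<Rightarrow> weights \<Rightarrow> item \<Rightarrow> item \<Rightarrow> bool" where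
  "move Z P Q s t \<longleftrightarrow> (let k = target (lt s); w = width Z k; h = height Z k in
     w - h < co s \<and> t = enter P Q (hexit k) (co s - w) s \<or>
     co s < w - h \<and> t = enter P Q (vexit k) (co s + h) s)"

text \<open>The ranges are closed at both ends to keep them invariant under the exchange of the two axes; so a
  starting point with \<open>co s = 0\<close> may carry either kind of entering letter.\<close>

definition adm :: "quadruple \<Rightarrow> item \<Rightarrow> bool" where
  "adm Z s \<longleftrightarrow> \<bar>ex s\<bar> = 1 \<and> \<bar>ey s\<bar> = 1 \<and>
     (if lt s \<in> {Vin, Vout, Bt} then 0 \<le> co s \<and> co s \<le> width Z (target (lt s))
      else - height Z (target (lt s)) \<le> co s \<and> co s \<le> 0)"

inductive path :: "(item \<Rightarrow> item \<Rightarrow> bool) \<Rightarrow> item \<Rightarrow> letter list \<Rightarrow> item \<Rightarrow> bool" for mv where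
  path_Nil: "path mv s [] s"
| path_snoc: "path mv s ls t \<Longrightarrow> mv t u \<Longrightarrow> path mv s (ls @ [lt u]) u"

text \<open>The indices run against the velocity because a piece ends at (\<open>px\<close>,
  \<open>py\<close>). Rectangles with parallel sides intersect as soon as both pairs of projections
  do.\<close>

definition meet :: "weights \<Rightarrow> weights \<Rightarrow> item \<Rightarrow> item \<Rightarrow> bool" where
  "meet P Q s t \<longleftrightarrow>
     (\<exists>i j. 0 \<le> i \<and> i \<le> extent P (lt s) \<and> 0 \<le> j \<and> j \<le> extent P (lt t) \<and>
        px s - ex s * i = px t - ex t * j) \<and>
     (\<exists>i j. 0 \<le> i \<and> i \<le> extent Q (swapl (lt s)) \<and> 0 \<le> j \<and> j \<le> extent Q (swapl (lt t)) \<and>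
        py s - ey s * i = py t - ey t * j)"

lemma path_last: "path mv s ls t \<Longrightarrow> ls \<noteq> [] \<Longrightarrow> last ls = lt t"
  by (induction rule: path.induct) auto

text \<open>Only block heads survive, so the length is kept only if no step stays inside a block.
  Then each letter heads its block, and each letter but the last is followed at once by the next
  block, hence heads a block of length 1. The last letter is excepted because its block may still go
  on; the first block may be cut anywhere.\<close>

lemma desubstitute:
  fixes blk :: "item \<Rightarrow> item list"
  assumes cover: "\<And>s. adm Z s \<Longrightarrow> \<exists>q. adm Z' q \<and> s \<in> set (blk q)"
    and simulate: "\<And>q t i. adm Z' q \<Longrightarrow> i < length (blk q) \<Longrightarrow> mv (blk q ! i) t \<Longrightarrow>
        Suc i < length (blk q) \<and> t = blk q ! Suc i \<or>
        Suc i = length (blk q) \<and> (\<exists>q'. mv' q q' \<and> adm Z' q' \<and> t = hd (blk q'))"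
    and nonempty: "\<And>q. blk q \<noteq> []"
    and head: "\<And>q. lt (hd (blk q)) = lt q"
    and inserted: "\<And>q s. s \<in> set (tl (blk q)) \<Longrightarrow> lt s \<in> I"
    and expand: "\<And>q. lt q \<in> E \<Longrightarrow> length (blk q) \<noteq> 1"
    and path: "path mv s ls t" and adm: "adm Z s"
  shows "\<exists>q ls' q' i. adm Z' q \<and> s \<in> set (blk q) \<and> path mv' q ls' q' \<and> adm Z' q' \<and>
     i < length (blk q') \<and> t = blk q' ! i \<and> set ls \<subseteq> set ls' \<union> I \<and>
     (length ls' < length ls \<or>
      ls' = ls \<and> (ls = [] \<or> i = 0 \<and> set (butlast ls) \<inter> E = {}))"
  using path adm
proof (induction rule: path.induct)
  case (path_Nil s)
  obtain q where "adm Z' q" "s \<in> set (blk q)" using cover path_Nil by blast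
  moreover obtain i where "i < length (blk q)" "s = blk q ! i"
    using calculation by (metis in_set_conv_nth)
  ultimately show ?case using path.path_Nil by fastforce
next
  case (path_snoc s ls t u)
  then obtain q ls' q' i where IH: "adm Z' q" "s \<in> set (blk q)" "path mv' q ls' q'" "adm Z' q'"
     "i < length (blk q')" "t = blk q' ! i" "set ls \<subseteq> set ls' \<union> I"
     and alt: "length ls' < length ls \<or>
      ls' = ls \<and> (ls = [] \<or> i = 0 \<and> set (butlast ls) \<inter> E = {})" by blast
  have mv: "mv (blk q' ! i) u" using path_snoc.hyps IH by simp
  from simulate[OF IH(4,5) mv] show ?case
  proof (elim disjE conjE exE)
    assume *: "Suc i < length (blk q')" "u = blk q' ! Suc i"
    have "u \<in> set (tl (blk q'))"
      using * nonempty[of q'] by (metis Suc_less_eq length_Cons list.collapse list.sel(3) nth_Cons_Suc nth_mem)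
    then have "lt u \<in> I" by (rule inserted)
    moreover have "length ls' < length (ls @ [lt u])" using alt by auto
    ultimately show ?thesis using IH * by (intro exI[of _ q] exI[of _ ls'] exI[of _ q'] exI[of _ "Suc i"]) auto
  next
    fix r assume *: "Suc i = length (blk q')" "mv' q' r" "adm Z' r" "u = hd (blk r)"
    have lu: "lt u = lt r" using * head by simp
    have p: "path mv' q (ls' @ [lt r]) r" using IH * path.path_snoc by blast
    have u: "u = blk r ! 0" "0 < length (blk r)" using * nonempty[of r] by (auto simp: hd_conv_nth)
    have "length (ls' @ [lt r]) < length (ls @ [lt u]) \<or>
      ls' @ [lt r] = ls @ [lt u] \<and> set (butlast (ls @ [lt u])) \<inter> E = {}"
    proof (cases "length ls' < length ls")
      case False
      with alt have a: "ls' = ls" "ls = [] \<or> i = 0 \<and> set (butlast ls) \<inter> E = {}" by auto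
      \<comment> \<open>With no letter lost so far, \<open>t\<close> is the head of the block of
        \<open>q'\<close> and also its end, so the letter that used to be the last is not in
        \<open>E\<close> either.\<close>
      have "set ls \<inter> E = {}"
      proof (cases "ls = []")
        case False
        with a have i: "i = 0" "set (butlast ls) \<inter> E = {}" by auto
        then have "lt q' \<notin> E" using expand * by fastforce
        moreover have "t = hd (blk q')" using IH i nonempty[of q'] by (simp add: hd_conv_nth)
        then have "last ls = lt q'" using path_last[OF path_snoc.hyps(1) False] head by simp
        moreover have "set ls = insert (last ls) (set (butlast ls))"
          using False by (metis append_butlast_last_id list.simps(15) rotate1.simps(2) set_rotate1)
        ultimately show ?thesis using i by auto
      qed auto
      then show ?thesis using a lu by simp
    qed simp
    then show ?thesis using IH * p u lu
      by (intro exI[of _ q] exI[of _ "ls' @ [lt r]"] exI[of _ r] exI[of _ 0]) auto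
  qed
qed

section \<open>The two substitutions as blocks of items\<close>

text \<open>The substitution undone by replacing \<open>x1\<close> by \<open>x1 - (y1 + y2)\<close>: each passage through a corridor
  gains a turn around the period, inserted right after its first letter.\<close>

fun block_corridor :: "quadruple \<Rightarrow> weights \<Rightarrow> weights \<Rightarrow> item \<Rightarrow> item list" where
  "block_corridor (x1, x2, y1, y2) (p, g, r) (p', g', r') (Item l c e d x y) =
    (case l of
      Vout \<Rightarrow> [Item Vout c e d (x - e * (p + 1 + r)) (y - d * g'),
               Item Hin (c - y1) e d (x - e * (1 + r)) (y - d * g'),
               Item Hout (c - y1 - y2) e d x y]
    | Bt \<Rightarrow> [Item Bt c e d (x - e * (p + 1 + r)) (y - d * g'),
             Item Hout (c - y2) e d (x - e * p) y,
             Item Hin (c - y1 - y2) e d x y]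
    | Hin \<Rightarrow> [Item Hin (c - y1 - y2) e d x y]
    | Hout \<Rightarrow> [Item Hout (c - y1 - y2) e d x y]
    | _ \<Rightarrow> [Item l c e d x y])"

text \<open>The substitution undone by replacing \<open>x2\<close> by \<open>x2 - 2 * y1\<close>: the two inserted reflections cancel.\<close>

fun block_arm :: "quadruple \<Rightarrow> weights \<Rightarrow> weights \<Rightarrow> item \<Rightarrow> item list" where
  "block_arm (x1, x2, y1, y2) (p, g, r) (p', g', r') (Item l c e d x y) =
    (case l of
      Vin \<Rightarrow> [Item Vin c e d x (y - d * (2 * g')),
              Item Rh (c - y1) (- e) d (x - e * r) (y - d * g'),
              Item Rh (c - 2 * y1) e d x y]
    | Rh \<Rightarrow> [Item Rh (c - 2 * y1) e d x y]
    | _ \<Rightarrow> [Item l c e d x y])"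

fun swapi :: "item \<Rightarrow> item" where
  "swapi (Item l c e d x y) = Item (swapl l) (- c) d e y x"

text \<open>In the units of \<open>co\<close> a full period of a corridor advances both coordinates
  by \<open>y1 + y2\<close>. A trajectory that enters through a horizontal side or bounces off one
  (\<open>Vout\<close>, \<open>Bt\<close>) makes one full turn before reaching this height; the
  reduced corridor is what lies beyond. Hence the split at \<open>c + y1 + y2 = 0\<close>: on one
  side an item is a block by itself, on the other it is inside the turn, and \<open>c\<close> tells
  with which letter the turn began.\<close>

lemma cover_corridor:
  assumes Z: "Z = (x1, x2, y1, y2)" and pos: "0 < x2" "0 < y1" "0 < y2" "y1 + y2 < x1" and s: "adm Z s"
  shows "\<exists>q. adm (x1 - (y1 + y2), x2, y1, y2) q \<and> s \<in> set (block_corridor Z (p, g, r) (p', g', r') q)"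
proof -
  obtain l c e d x y where S: "s = Item l c e d x y" by (cases s)
  let ?P = "\<lambda>q. adm (x1 - (y1 + y2), x2, y1, y2) q \<and> s \<in> set (block_corridor Z (p, g, r) (p', g', r') q)"
  show ?thesis
  proof (cases l)
    case Hin
    consider "c + y1 + y2 \<le> 0" | "0 < c + y1 + y2" "c < -y1" | "-y1 \<le> c" by linarith
    then show ?thesis
    proof cases
      case 1
      then show ?thesis using s S Hin Z pos by (intro exI[of _ "Item Hin (c + y1 + y2) e d x y"]) (auto simp: adm_def)
    next
      case 2
      then show ?thesis using s S Hin Z pos by (intro exI[of _ "Item Bt (c + y1 + y2) e d x y"]) (auto simp: adm_def)
    next
      case 3
      then show ?thesis using s S Hin Z pos
        by (intro exI[of _ "Item Vout (c + y1) e d (x + e * (1 + r)) (y + d * g')"]) (auto simp: adm_def)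
    qed
  next
    case Hout
    consider "c + y1 + y2 \<le> 0" | "0 < c + y1 + y2" "c < -y2" | "-y2 \<le> c" by linarith
    then show ?thesis
    proof cases
      case 1
      then show ?thesis using s S Hout Z pos by (intro exI[of _ "Item Hout (c + y1 + y2) e d x y"]) (auto simp: adm_def)
    next
      case 2
      then show ?thesis using s S Hout Z pos by (intro exI[of _ "Item Vout (c + y1 + y2) e d x y"]) (auto simp: adm_def)
    next
      case 3
      then show ?thesis using s S Hout Z pos
        by (intro exI[of _ "Item Bt (c + y2) e d (x + e * p) y"]) (auto simp: adm_def)
    qed
  next
    case Bt
    then show ?thesis using s S Z pos
      by (intro exI[of _ "Item Bt c e d (x + e * (p + 1 + r)) (y + d * g')"]) (auto simp: adm_def)
  next
    case Vout
    then show ?thesis using s S Z pos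
      by (intro exI[of _ "Item Vout c e d (x + e * (p + 1 + r)) (y + d * g')"]) (auto simp: adm_def)
  next
    case Vin
    then show ?thesis using s S Z pos by (intro exI[of _ s]) (auto simp: adm_def)
  next
    case Rh
    then show ?thesis using s S Z pos by (intro exI[of _ s]) (auto simp: adm_def)
  qed
qed


lemma move_cases:
  assumes "move Z P Q s t"
  obtains (h) "width Z (target (lt s)) - height Z (target (lt s)) < co s"
      "t = enter P Q (hexit (target (lt s))) (co s - width Z (target (lt s))) s"
    | (v) "co s < width Z (target (lt s)) - height Z (target (lt s))"
      "t = enter P Q (vexit (target (lt s))) (co s + height Z (target (lt s))) s"
  using assms unfolding move_def Let_def by blast

lemma move_h:
  "width Z (target (lt s)) - height Z (target (lt s)) < co s \<Longrightarrow>
   move Z P Q s (enter P Q (hexit (target (lt s))) (co s - width Z (target (lt s))) s)"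
  unfolding move_def Let_def by blast

lemma move_v:
  "co s < width Z (target (lt s)) - height Z (target (lt s)) \<Longrightarrow>
   move Z P Q s (enter P Q (vexit (target (lt s))) (co s + height Z (target (lt s))) s)"
  unfolding move_def Let_def by blast

lemma adm_move:
  assumes "adm Z s" "move Z P Q s t" "positive Z"
  shows "adm Z t"
proof -
  obtain x1 x2 y1 y2 where Z: "Z = (x1, x2, y1, y2)" by (cases Z)
  obtain l c e d x y where S: "s = Item l c e d x y" by (cases s)
  have e: "\<bar>e\<bar> = 1" "\<bar>d\<bar> = 1" using assms S by (auto simp: adm_def)
  from assms(2) show ?thesis
  proof (cases rule: move_cases)
    case h
    then show ?thesis using assms(1,3) Z S by (cases l) (auto simp: adm_def Let_def)
  next
    case v
    then show ?thesis using assms(1,3) Z S by (cases l) (auto simp: adm_def Let_def)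
  qed
qed

text \<open>At the end of a block, outside vertical arms, the original \<open>co\<close> is smaller
  and the original height is larger than the reduced one by the same amount \<open>y1 + y2\<close>.
  So the exit conditions coincide, and the coordinate after the exit is that of the head of the next
  block.\<close>

lemma simulate_last_corridor:
  assumes Z: "Z = (x1, x2, y1, y2)" and Z': "Z' = (x1 - (y1 + y2), x2, y1, y2)" and Z'0: "positive Z'"
    and q: "adm Z' q" and Q: "q = Item l c e d x y" and l': "target l' = target l"
    and mv: "move Z (p, g, r) (p', g', r') (Item l' (if target l = VArm then c else c - y1 - y2) e d x y) t"
  shows "\<exists>q'. move Z' (p, g + (p + 1 + r), r) (p', g', r' + g') q q' \<and>
              adm Z' q' \<and> t = hd (block_corridor Z (p, g, r) (p', g', r') q')"
proof -
  let ?P = "(p, g + (p + 1 + r), r)" and ?Q = "(p', g', r' + g')"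
  from mv have "\<exists>q'. move Z' ?P ?Q q q' \<and> t = hd (block_corridor Z (p, g, r) (p', g', r') q')"
  proof (cases rule: move_cases)
    case h
    have "width Z' (target (lt q)) - height Z' (target (lt q)) < co q"
      using h l' Q Z Z' by (cases l) auto
    then have "move Z' ?P ?Q q (enter ?P ?Q (hexit (target (lt q))) (co q - width Z' (target (lt q))) q)"
      by (rule move_h)
    moreover have "t = hd (block_corridor Z (p, g, r) (p', g', r')
        (enter ?P ?Q (hexit (target (lt q))) (co q - width Z' (target (lt q))) q))"
      using h l' Q Z Z' by (cases l) (auto simp: Let_def)
    ultimately show ?thesis by blast
  next
    case v
    have "co q < width Z' (target (lt q)) - height Z' (target (lt q))"
      using v l' Q Z Z' by (cases l) auto
    then have "move Z' ?P ?Q q (enter ?P ?Q (vexit (target (lt q))) (co q + height Z' (target (lt q))) q)"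
      by (rule move_v)
    moreover have "t = hd (block_corridor Z (p, g, r) (p', g', r')
        (enter ?P ?Q (vexit (target (lt q))) (co q + height Z' (target (lt q))) q))"
      using v l' Q Z Z' by (cases l) (auto simp: Let_def algebra_simps)
    ultimately show ?thesis by blast
  qed
  then show ?thesis using adm_move[OF q] Z'0 by blast
qed

lemma simulate_corridor:
  assumes Z: "Z = (x1, x2, y1, y2)" and Z': "Z' = (x1 - (y1 + y2), x2, y1, y2)"
    and pos: "0 < x2" "0 < y1" "0 < y2" "y1 + y2 < x1"
    and q: "adm Z' q"
    and i: "i < length (block_corridor Z (p, g, r) (p', g', r') q)"
    and mv: "move Z (p, g, r) (p', g', r') (block_corridor Z (p, g, r) (p', g', r') q ! i) t"
  shows "Suc i < length (block_corridor Z (p, g, r) (p', g', r') q) \<and> t = block_corridor Z (p, g, r) (p', g', r') q ! Suc i \<or>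
        Suc i = length (block_corridor Z (p, g, r) (p', g', r') q) \<and>
        (\<exists>q'. move Z' (p, g + (p + 1 + r), r) (p', g', r' + g') q q' \<and>
              adm Z' q' \<and> t = hd (block_corridor Z (p, g, r) (p', g', r') q'))"
proof -
  obtain l c e d x y where Q: "q = Item l c e d x y" by (cases q)
  have Z'0: "positive Z'" using Z' pos by simp
  note last = simulate_last_corridor[OF Z Z' Z'0 q Q, of _ p g r p' g' r' t]
  show ?thesis
  proof (cases "l = Vout \<or> l = Bt")
    case False
    then have "i = 0" using i Q Z by (cases l) auto
    moreover have "length (block_corridor Z (p, g, r) (p', g', r') q) = 1" using False Q Z by (cases l) auto
    moreover have "block_corridor Z (p, g, r) (p', g', r') q ! 0
       = Item l (if target l = VArm then c else c - y1 - y2) e d x y"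
      using False Q Z by (cases l) auto
    ultimately show ?thesis using last[of l] mv by simp
  next
    case True
    then have 3: "length (block_corridor Z (p, g, r) (p', g', r') q) = 3" and l: "target l \<noteq> VArm"
      using Q Z by auto
    have c: "0 \<le> c" "c \<le> width Z (target l)" using q True Q Z Z' by (auto simp: adm_def)
    from i 3 consider "i = 0" | "i = 1" | "i = 2" by linarith
    then show ?thesis
    proof cases
      assume i: "i = 0"
      \<comment> \<open>Here and at the next item the exit is through a vertical side, because
        \<open>0 \<le> c\<close> and the corridor is higher than a full period
        \<open>y1 + y2\<close>.\<close>
      from mv have "t = block_corridor Z (p, g, r) (p', g', r') q ! 1"
        using True c pos Q Z unfolding i
        by (cases rule: move_cases) (auto simp: Let_def algebra_simps)
      then show ?thesis using 3 i by simp
    next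
      assume i: "i = 1"
      from mv have "t = block_corridor Z (p, g, r) (p', g', r') q ! 2"
        using True c pos Q Z unfolding i
        by (cases rule: move_cases) (auto simp: Let_def algebra_simps)
      then show ?thesis using 3 i by (simp add: numeral_2_eq_2)
    next
      assume i: "i = 2"
      from True have "block_corridor Z (p, g, r) (p', g', r') q ! 2 =
        Item (if l = Vout then Hout else Hin) (if target l = VArm then c else c - y1 - y2) e d x y"
        using Q Z by auto
      then show ?thesis using last[of "if l = Vout then Hout else Hin"] mv True 3 i by auto
    qed
  qed
qed

section \<open>Containment of the rectangles of pieces\<close>

definition nested :: "weights \<Rightarrow> weights \<Rightarrow> weights \<Rightarrow> weights \<Rightarrow> item \<Rightarrow> item \<Rightarrow> bool" where
  "nested P Q P' Q' s q \<longleftrightarrow>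
     (\<forall>i. 0 \<le> i \<and> i \<le> extent P (lt s) \<longrightarrow>
        (\<exists>j. 0 \<le> j \<and> j \<le> extent P' (lt q) \<and> px s - ex s * i = px q - ex q * j)) \<and>
     (\<forall>i. 0 \<le> i \<and> i \<le> extent Q (swapl (lt s)) \<longrightarrow>
        (\<exists>j. 0 \<le> j \<and> j \<le> extent Q' (swapl (lt q)) \<and> py s - ey s * i = py q - ey q * j))"

lemma meet_nested:
  "meet P Q s t \<Longrightarrow> nested P Q P' Q' s q \<Longrightarrow> nested P Q P' Q' t q' \<Longrightarrow> meet P' Q' q q'"
  unfolding meet_def nested_def by metis

lemma offset_le:
  "0 \<le> k + i \<Longrightarrow> k + i \<le> n \<Longrightarrow> \<exists>j\<ge>0. j \<le> n \<and> - (e * k) - e * i = - (e * (j::int))"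
  by (intro exI[of _ "k + i"]) (simp add: algebra_simps)

lemma offset_less:
  "0 \<le> k + i \<Longrightarrow> k + i < n \<Longrightarrow> \<exists>j\<ge>0. j < n \<and> - (e * k) - e * i = - (e * (j::int))"
  by (intro exI[of _ "k + i"]) (simp add: algebra_simps)

text \<open>For the middle item of a \<open>Vin\<close> block, which moves with the opposite sign:
  its range is counted from the other end.\<close>

lemma offset_reverse:
  "0 \<le> i \<Longrightarrow> i \<le> n \<Longrightarrow> \<exists>j\<ge>0. j \<le> n \<and> e * i - e * n = - (e * (j::int))"
  by (intro exI[of _ "n - i"]) (simp add: algebra_simps)

text \<open>The new weights are displacements of whole blocks: the inserted \<open>Hin\<close> and
  \<open>Hout\<close> add \<open>p\<close> and \<open>1 + r\<close> horizontally, 0 and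
  \<open>g'\<close> vertically. The first item of a long block lies farthest back, and its offset
  plus its old extent is exactly the new extent.\<close>

lemma nested_corridor:
  assumes "valid (p, g, r)" "valid (p', g', r')"
    and s: "s \<in> set (block_corridor Z (p, g, r) (p', g', r') q)"
  shows "nested (p, g, r) (p', g', r') (p, g + (p + 1 + r), r) (p', g', r' + g') s q"
proof -
  obtain x1 x2 y1 y2 where Z: "Z = (x1, x2, y1, y2)" by (cases Z)
  obtain l c e d x y where Q: "q = Item l c e d x y" by (cases q)
  show ?thesis using assms
    by (cases l) (auto simp: nested_def Z Q intro!: offset_le offset_less)
qed

text \<open>Vertically all three letters advance, which gives \<open>p' + 2 * g'\<close>;
  \<open>1 \<le> p'\<close> leaves room for the extents of the reflections. Horizontally the detour
  stays within \<open>r\<close> behind its end, which is why \<open>extent\<close> gives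
  \<open>Vin\<close> the value \<open>r\<close> although its weight is 0.\<close>

lemma nested_arm:
  assumes "valid (p, g, r)" "valid (p', g', r')"
    and s: "s \<in> set (block_arm Z (p, g, r) (p', g', r') q)"
  shows "nested (p, g, r) (p', g', r') (p, g, r) (p' + 2 * g', g', r') s q"
proof -
  obtain x1 x2 y1 y2 where Z: "Z = (x1, x2, y1, y2)" by (cases Z)
  obtain l c e d x y where Q: "q = Item l c e d x y" by (cases q)
  show ?thesis using assms
    by (cases l) (auto simp: nested_def Z Q intro!: offset_le offset_less offset_reverse)
qed

section \<open>The arm substitution\<close>

lemma cover_arm:
  assumes Z: "Z = (x1, x2, y1, y2)" and pos: "0 < x1" "0 < y1" "0 < y2" "2 * y1 < x2" and s: "adm Z s"
  shows "\<exists>q. adm (x1, x2 - 2 * y1, y1, y2) q \<and> s \<in> set (block_arm Z (p, g, r) (p', g', r') q)"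
proof -
  obtain l c e d x y where S: "s = Item l c e d x y" by (cases s)
  show ?thesis
  proof (cases l)
    case Rh
    consider "c + 2 * y1 \<le> 0" | "0 < c + 2 * y1" "c < -y1" | "-y1 \<le> c" by linarith
    then show ?thesis
    proof cases
      case 1
      then show ?thesis using s S Rh Z pos by (intro exI[of _ "Item Rh (c + 2 * y1) e d x y"]) (auto simp: adm_def)
    next
      case 2
      then show ?thesis using s S Rh Z pos by (intro exI[of _ "Item Vin (c + 2 * y1) e d x y"]) (auto simp: adm_def)
    next
      \<comment> \<open>The item has been reflected once since it entered the arm, so its block has
        the opposite sign and ends \<open>r\<close> boxes farther in the direction
        \<open>- e\<close>.\<close>
      case 3
      then show ?thesis using s S Rh Z pos
        by (intro exI[of _ "Item Vin (c + y1) (- e) d (x - e * r) (y + d * g')"]) (auto simp: adm_def)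
    qed
  next
    case Vin
    then show ?thesis using s S Z pos
      by (intro exI[of _ "Item Vin c e d x (y + d * (2 * g'))"]) (auto simp: adm_def)
  next
    case Hin
    then show ?thesis using s S Z pos by (intro exI[of _ s]) (auto simp: adm_def)
  next
    case Hout
    then show ?thesis using s S Z pos by (intro exI[of _ s]) (auto simp: adm_def)
  next
    case Bt
    then show ?thesis using s S Z pos by (intro exI[of _ s]) (auto simp: adm_def)
  next
    case Vout
    then show ?thesis using s S Z pos by (intro exI[of _ s]) (auto simp: adm_def)
  qed
qed

lemma simulate_last_arm:
  assumes Z: "Z = (x1, x2, y1, y2)" and Z': "Z' = (x1, x2 - 2 * y1, y1, y2)" and Z'0: "positive Z'"
    and q: "adm Z' q" and Q: "q = Item l c e d x y" and l': "target l' = target l"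
    and mv: "move Z (p, g, r) (p', g', r') (Item l' (if target l = VArm then c - 2 * y1 else c) e d x y) t"
  shows "\<exists>q'. move Z' (p, g, r) (p' + 2 * g', g', r') q q' \<and>
              adm Z' q' \<and> t = hd (block_arm Z (p, g, r) (p', g', r') q')"
proof -
  let ?P = "(p, g, r)" and ?Q = "(p' + 2 * g', g', r')"
  from mv have "\<exists>q'. move Z' ?P ?Q q q' \<and> t = hd (block_arm Z (p, g, r) (p', g', r') q')"
  proof (cases rule: move_cases)
    case h
    have "width Z' (target (lt q)) - height Z' (target (lt q)) < co q"
      using h l' Q Z Z' by (cases l) auto
    then have "move Z' ?P ?Q q (enter ?P ?Q (hexit (target (lt q))) (co q - width Z' (target (lt q))) q)"
      by (rule move_h)
    moreover have "t = hd (block_arm Z (p, g, r) (p', g', r')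
        (enter ?P ?Q (hexit (target (lt q))) (co q - width Z' (target (lt q))) q))"
      using h l' Q Z Z' by (cases l) (auto simp: Let_def algebra_simps)
    ultimately show ?thesis by blast
  next
    case v
    have "co q < width Z' (target (lt q)) - height Z' (target (lt q))"
      using v l' Q Z Z' by (cases l) auto
    then have "move Z' ?P ?Q q (enter ?P ?Q (vexit (target (lt q))) (co q + height Z' (target (lt q))) q)"
      by (rule move_v)
    moreover have "t = hd (block_arm Z (p, g, r) (p', g', r')
        (enter ?P ?Q (vexit (target (lt q))) (co q + height Z' (target (lt q))) q))"
      using v l' Q Z Z' by (cases l) (auto simp: Let_def algebra_simps)
    ultimately show ?thesis by blast
  qed
  then show ?thesis using adm_move[OF q] Z'0 by blast
qed

lemma simulate_arm:
  assumes Z: "Z = (x1, x2, y1, y2)" and Z': "Z' = (x1, x2 - 2 * y1, y1, y2)"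
    and pos: "0 < x1" "0 < y1" "0 < y2" "2 * y1 < x2"
    and q: "adm Z' q"
    and i: "i < length (block_arm Z (p, g, r) (p', g', r') q)"
    and mv: "move Z (p, g, r) (p', g', r') (block_arm Z (p, g, r) (p', g', r') q ! i) t"
  shows "Suc i < length (block_arm Z (p, g, r) (p', g', r') q) \<and> t = block_arm Z (p, g, r) (p', g', r') q ! Suc i \<or>
        Suc i = length (block_arm Z (p, g, r) (p', g', r') q) \<and>
        (\<exists>q'. move Z' (p, g, r) (p' + 2 * g', g', r') q q' \<and>
              adm Z' q' \<and> t = hd (block_arm Z (p, g, r) (p', g', r') q'))"
proof -
  obtain l c e d x y where Q: "q = Item l c e d x y" by (cases q)
  have Z'0: "positive Z'" using Z' pos by simp
  note last = simulate_last_arm[OF Z Z' Z'0 q Q, of _ p g r p' g' r' t]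
  show ?thesis
  proof (cases "l = Vin")
    case False
    then have "i = 0" using i Q Z by (cases l) auto
    moreover have "length (block_arm Z (p, g, r) (p', g', r') q) = 1" using False Q Z by (cases l) auto
    moreover have "block_arm Z (p, g, r) (p', g', r') q ! 0
       = Item l (if target l = VArm then c - 2 * y1 else c) e d x y"
      using False Q Z by (cases l) auto
    ultimately show ?thesis using last[of l] mv by simp
  next
    case True
    then have 3: "length (block_arm Z (p, g, r) (p', g', r') q) = 3"
      using Q Z by auto
    have c: "0 \<le> c" "c \<le> width Z (target l)" using q True Q Z Z' by (auto simp: adm_def)
    from i 3 consider "i = 0" | "i = 1" | "i = 2" by linarith
    then show ?thesis
    proof cases
      assume i: "i = 0"
      from mv have "t = block_arm Z (p, g, r) (p', g', r') q ! 1"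
        using True c pos Q Z unfolding i
        by (cases rule: move_cases) (auto simp: Let_def algebra_simps)
      then show ?thesis using 3 i by simp
    next
      assume i: "i = 1"
      from mv have "t = block_arm Z (p, g, r) (p', g', r') q ! 2"
        using True c pos Q Z unfolding i
        by (cases rule: move_cases) (auto simp: Let_def algebra_simps)
      then show ?thesis using 3 i by (simp add: numeral_2_eq_2)
    next
      assume i: "i = 2"
      from True have "block_arm Z (p, g, r) (p', g', r') q ! 2 = Item Rh (c - 2 * y1) e d x y"
        using Q Z by auto
      then show ?thesis using last[of Rh] mv True 3 i by auto
    qed
  qed
qed

section \<open>Symmetry and monotonicity\<close>

lemma swapl_swapl [simp]: "swapl (swapl l) = l"
  by (cases l) auto

lemma mem_swapl: "l \<in> swapl ` A \<longleftrightarrow> swapl l \<in> A"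
  by (metis image_iff swapl_swapl)

fun swapq :: "quadruple \<Rightarrow> quadruple" where
  "swapq (x1, x2, y1, y2) = (y1, y2, x1, x2)"

lemma adm_swap: "adm Z s \<Longrightarrow> adm (swapq Z) (swapi s)"
  by (cases Z; cases s; cases "lt s") (auto simp: adm_def)

lemma lt_swapi [simp]: "lt (swapi s) = swapl (lt s)"
  by (cases s) auto

lemma move_swap:
  assumes "move Z P Q s t"
  shows "move (swapq Z) Q P (swapi s) (swapi t)"
proof -
  obtain x1 x2 y1 y2 where Z: "Z = (x1, x2, y1, y2)" by (cases Z)
  obtain l c e d x y where S: "s = Item l c e d x y" by (cases s)
  from assms show ?thesis
  proof (cases rule: move_cases)
    case h
    then show ?thesis using Z S unfolding move_def by (cases l) (auto simp: Let_def)
  next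
    case v
    then show ?thesis using Z S unfolding move_def by (cases l) (auto simp: Let_def)
  qed
qed

lemma path_swap:
  "path (move Z P Q) s ls t \<Longrightarrow> path (move (swapq Z) Q P) (swapi s) (map swapl ls) (swapi t)"
proof (induction rule: path.induct)
  case (path_snoc s ls t u)
  then show ?case using path.path_snoc[OF path_snoc.IH move_swap[OF path_snoc.hyps(2)]] by simp
qed (simp add: path.path_Nil)

lemma meet_swap: "meet P Q s t \<Longrightarrow> meet Q P (swapi s) (swapi t)"
  by (cases s; cases t) (auto simp: meet_def)

text \<open>A word is bad if it codes two different visits whose rectangles intersect.\<close>

definition bad :: "quadruple \<Rightarrow> weights \<Rightarrow> weights \<Rightarrow> letter list \<Rightarrow> bool" where
  "bad Z P Q ls \<longleftrightarrow> valid P \<and> valid Q \<and> (\<exists>l\<in>set ls. l \<in> {Hin, Hout, Vin, Vout}) \<and>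
     (\<exists>s t. adm Z s \<and> path (move Z P Q) s ls t \<and> meet P Q s t)"

lemma bad_swap:
  assumes "bad Z P Q ls"
  shows "bad (swapq Z) Q P (map swapl ls)"
proof -
  obtain l s t where *: "valid P" "valid Q" "l \<in> set ls" "l \<in> {Hin, Hout, Vin, Vout}"
    "adm Z s" "path (move Z P Q) s ls t" "meet P Q s t"
    using assms unfolding bad_def by blast
  have "swapl l \<in> set (map swapl ls)" "swapl l \<in> {Hin, Hout, Vin, Vout}" using * by auto
  with *(1,2) show ?thesis
    unfolding bad_def using adm_swap[OF *(5)] path_swap[OF *(6)] meet_swap[OF *(7)] by blast
qed

lemma move_enter:
  assumes "move Z P Q s t"
  obtains l' c' where "l' \<in> {hexit (target (lt s)), vexit (target (lt s))}" "t = enter P Q l' c' s"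
  using assms by (rule move_cases) blast+

text \<open>\<open>Hin\<close> and \<open>Hout\<close> advance by one more than they reach back, so
  the rectangle of \<open>t\<close> lies strictly beyond the column of \<open>s\<close>.
  \<open>Vin\<close> reaches back by \<open>r\<close> without advancing; the last clause keeps the
  reserve \<open>r + 1\<close> provided by the preceding \<open>Hout\<close>.\<close>

lemma drift:
  assumes "path (move Z P Q) s ls t" "valid P" "P = (p, g, r)" "Rh \<notin> set ls" "ex s = e" "\<bar>e\<bar> = 1"
  shows "ex t = e \<and> 0 \<le> e * (px t - px s) \<and> (set ls \<inter> {Hin, Hout} \<noteq> {} \<longrightarrow>
     1 \<le> e * (px t - px s) - extent P (lt t) \<and>
     (target (lt t) \<noteq> HArm \<longrightarrow> r + 1 \<le> e * (px t - px s)))"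
  using assms
proof (induction rule: path.induct)
  case (path_snoc s ls t u)
  obtain l c e1 d x y where T: "t = Item l c e1 d x y" by (cases t)
  have IH: "e1 = e" "0 \<le> e * (x - px s)" "set ls \<inter> {Hin, Hout} \<noteq> {} \<longrightarrow>
     1 \<le> e * (x - px s) - extent P l \<and>
     (target l \<noteq> HArm \<longrightarrow> r + 1 \<le> e * (x - px s))"
    using path_snoc T by auto
  have ee: "e * e = 1" using path_snoc.prems by (simp add: abs_if split: if_splits)
  obtain l' c' where l': "l' \<in> {hexit (target l), vexit (target l)}" and U: "u = enter P Q l' c' t"
    using move_enter[OF path_snoc.hyps(2)] T by auto
  have nR: "l' \<noteq> Rh" using U path_snoc.prems T by (auto simp: Let_def)
  have u: "lt u = l'" "ex u = e" "px u = x + e * wgt P l'" using U T nR IH by (auto simp: Let_def)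
  have d: "e * (px u - px s) = e * (x - px s) + wgt P l'"
    unfolding u using ee by (simp add: algebra_simps flip: mult.assoc)
  have "0 \<le> extent P l" using path_snoc.prems by (cases l) auto
  then show ?case using l' nR IH path_snoc.prems(1-3) u(1,2) d T
    by (cases l) (auto; linarith)+
qed auto

lemma no_Rh_no_H:
  assumes "path (move Z P Q) s ls t" "adm Z s" "valid P" "meet P Q s t" "Rh \<notin> set ls"
  shows "set ls \<inter> {Hin, Hout} = {}"
proof (rule ccontr)
  assume h: "set ls \<inter> {Hin, Hout} \<noteq> {}"
  obtain p g r where P: "P = (p, g, r)" by (cases P)
  have e: "\<bar>ex s\<bar> = 1" using assms by (simp add: adm_def)
  from drift[OF assms(1,3) P assms(5) refl e] h
  have d: "ex t = ex s" "1 \<le> ex s * (px t - px s) - extent P (lt t)" by auto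
  obtain i j where ij: "0 \<le> i" "j \<le> extent P (lt t)" "px s - ex s * i = px t - ex t * j"
    using assms(4) unfolding meet_def by blast
  have "px t - px s = ex s * (j - i)" using ij d by (simp add: algebra_simps)
  moreover have "ex s * ex s = 1" using e by (simp add: abs_if split: if_splits)
  ultimately have "ex s * (px t - px s) = j - i" by (metis mult.assoc mult_1)
  then show False using d ij by linarith
qed

text \<open>Horizontal arms are entered and left only by \<open>Hin\<close> and \<open>Hout\<close>,
  and \<open>Bt\<close> occurs only inside them.\<close>

lemma no_H_all_or_no_Bt:
  assumes "path (move Z P Q) s ls t" "set ls \<inter> {Hin, Hout} = {}"
  shows "if target (lt s) = HArm then target (lt t) = HArm \<and> set ls \<subseteq> {Bt}
         else target (lt t) \<noteq> HArm \<and> Bt \<notin> set ls"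
  using assms
proof (induction rule: path.induct)
  case (path_snoc s ls t u)
  obtain l c e1 d x y where T: "t = Item l c e1 d x y" by (cases t)
  obtain l' c' where l': "l' \<in> {hexit (target l), vexit (target l)}" and U: "u = enter P Q l' c' t"
    using move_enter[OF path_snoc.hyps(2)] T by auto
  have u: "lt u = l'" using U T by (auto simp: Let_def)
  show ?case using path_snoc l' T unfolding u by (cases l) (auto split: if_splits)
qed auto

text \<open>The horizontal coordinate rules out \<open>Hin\<close> and \<open>Hout\<close>. A word
  that then stays outside horizontal arms has no \<open>Bt\<close>, so its mirror image has no
  \<open>Rh\<close> and the same argument applies to the vertical coordinate.\<close>

lemma no_Rh_imp_inner:
  assumes path: "path (move Z P Q) s ls t" and "adm Z s" "valid P" "valid Q" "meet P Q s t" "Rh \<notin> set ls"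
  shows "set ls \<inter> {Hin, Hout, Vin, Vout} = {}"
proof -
  have H: "set ls \<inter> {Hin, Hout} = {}" using no_Rh_no_H assms by blast
  show ?thesis
  proof (cases "target (lt s) = HArm")
    case True
    then show ?thesis using no_H_all_or_no_Bt[OF path H] by auto
  next
    case False
    then have "Bt \<notin> set ls" using no_H_all_or_no_Bt[OF path H] by auto
    then have "Rh \<notin> set (map swapl ls)" by (simp add: mem_swapl)
    then have "set (map swapl ls) \<inter> {Hin, Hout} = {}"
      using no_Rh_no_H[OF path_swap[OF path] adm_swap[OF assms(2)] assms(4) meet_swap[OF assms(5)]] by simp
    then have "Hin \<notin> swapl ` set ls" "Hout \<notin> swapl ` set ls" by auto
    then have "set ls \<inter> {Vin, Vout} = {}" by (simp add: mem_swapl)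
    with H show ?thesis by auto
  qed
qed

lemma no_Bt_imp_inner:
  assumes path: "path (move Z P Q) s ls t" and "adm Z s" "valid P" "valid Q" "meet P Q s t" "Bt \<notin> set ls"
  shows "set ls \<inter> {Hin, Hout, Vin, Vout} = {}"
proof -
  have "Rh \<notin> set (map swapl ls)" using assms(6) by (simp add: mem_swapl)
  then have "set (map swapl ls) \<inter> {Hin, Hout, Vin, Vout} = {}"
    using no_Rh_imp_inner[OF path_swap[OF path] adm_swap[OF assms(2)] assms(4,3) meet_swap[OF assms(5)]] by simp
  then have "Hin \<notin> swapl ` set ls" "Hout \<notin> swapl ` set ls" "Vin \<notin> swapl ` set ls" "Vout \<notin> swapl ` set ls"
    by auto
  then show ?thesis by (simp add: mem_swapl)
qed

lemma bad_both: "bad Z P Q ls \<Longrightarrow> Rh \<in> set ls \<and> Bt \<in> set ls"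
  unfolding bad_def using no_Rh_imp_inner no_Bt_imp_inner by blast


section \<open>Renormalization\<close>

lemma reduce_corridor:
  assumes bad: "bad (x1, x2, y1, y2) P Q ls"
    and pos: "0 < x2" "0 < y1" "0 < y2" "y1 + y2 < x1"
  shows "\<exists>P' Q' ls'. bad (x1 - (y1 + y2), x2, y1, y2) P' Q' ls' \<and>
    (length ls' < length ls \<or> ls' = ls \<and> set (butlast ls) \<inter> {Vout, Bt} = {})"
proof -
  obtain p g r p' g' r' where P: "P = (p, g, r)" "Q = (p', g', r')" by (cases P; cases Q)
  let ?Z = "(x1, x2, y1, y2)" and ?Z' = "(x1 - (y1 + y2), x2, y1, y2)"
  let ?P = "(p, g + (p + 1 + r), r)" and ?Q = "(p', g', r' + g')"
  let ?blk = "block_corridor ?Z P Q"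
  obtain s t where v: "valid P" "valid Q" and s: "adm ?Z s" "path (move ?Z P Q) s ls t" "meet P Q s t"
    using bad unfolding bad_def by blast
  have "\<exists>q ls' q' i. adm ?Z' q \<and> s \<in> set (?blk q) \<and> path (move ?Z' ?P ?Q) q ls' q' \<and> adm ?Z' q' \<and>
     i < length (?blk q') \<and> t = ?blk q' ! i \<and> set ls \<subseteq> set ls' \<union> {Hin, Hout} \<and>
     (length ls' < length ls \<or>
      ls' = ls \<and> (ls = [] \<or> i = 0 \<and> set (butlast ls) \<inter> {Vout, Bt} = {}))"
  proof (rule desubstitute[OF _ _ _ _ _ _ s(2,1)])
    show "\<exists>q. adm ?Z' q \<and> s \<in> set (?blk q)" if "adm ?Z s" for s
      using cover_corridor[OF refl pos that] unfolding P .
    show "Suc i < length (?blk q) \<and> t = ?blk q ! Suc i \<or>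
        Suc i = length (?blk q) \<and> (\<exists>q'. move ?Z' ?P ?Q q q' \<and> adm ?Z' q' \<and> t = hd (?blk q'))"
      if "adm ?Z' q" "i < length (?blk q)" "move ?Z P Q (?blk q ! i) t" for q t i
      using simulate_corridor[OF refl refl pos that(1)] that(2,3) unfolding P by blast
    show "?blk q \<noteq> []" for q unfolding P by (cases q; cases "lt q") auto
    show "lt (hd (?blk q)) = lt q" for q unfolding P by (cases q; cases "lt q") auto
    show "lt s \<in> {Hin, Hout}" if "s \<in> set (tl (?blk q))" for q s
      using that unfolding P by (cases q; cases "lt q") auto
    show "length (?blk q) \<noteq> 1" if "lt q \<in> {Vout, Bt}" for q
      using that unfolding P by (cases q) auto
  qed
  then obtain q ls' q' i where *: "adm ?Z' q" "s \<in> set (?blk q)" "path (move ?Z' ?P ?Q) q ls' q'"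
     "t \<in> set (?blk q')" "set ls \<subseteq> set ls' \<union> {Hin, Hout}"
     and len: "length ls' < length ls \<or> ls' = ls \<and> (ls = [] \<or> set (butlast ls) \<inter> {Vout, Bt} = {})"
    by (metis nth_mem)
  have "meet ?P ?Q q q'"
    using meet_nested[OF s(3)] nested_corridor[OF v[unfolded P]] * unfolding P by blast
  \<comment> \<open>All such letters of \<open>ls\<close> might be inserted ones. But
    \<open>ls\<close> contains both \<open>Rh\<close> and \<open>Bt\<close>, which are never erased,
    and these cannot both occur in \<open>ls'\<close> without a passage through \<open>Hin\<close>
    or \<open>Hout\<close>.\<close>
  moreover have "\<exists>l\<in>set ls'. l \<in> {Hin, Hout, Vin, Vout}"
  proof (rule ccontr)
    assume "\<not> ?thesis"
    then have sub: "set ls' \<subseteq> {Bt, Rh}"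
      by (metis (full_types) insert_iff letter.exhaust subsetI)
    then have "set ls' \<inter> {Hin, Hout} = {}" by auto
    from no_H_all_or_no_Bt[OF *(3) this] have "set ls' \<subseteq> {Bt} \<or> Bt \<notin> set ls'"
      by (auto split: if_splits)
    then have "Rh \<notin> set ls \<or> Bt \<notin> set ls" using * by auto
    then show False using bad_both[OF bad] by blast
  qed
  ultimately have "bad ?Z' ?P ?Q ls'" unfolding bad_def using * v P by auto
  then show ?thesis using len by (intro exI[of _ ?P] exI[of _ ?Q] exI[of _ ls']) auto
qed

lemma reduce_arm:
  assumes bad: "bad (x1, x2, y1, y2) P Q ls"
    and pos: "0 < x1" "0 < y1" "0 < y2" "2 * y1 < x2"
  shows "\<exists>P' Q' ls'. bad (x1, x2 - 2 * y1, y1, y2) P' Q' ls' \<and>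
    (length ls' < length ls \<or> ls' = ls \<and> set (butlast ls) \<inter> {Vin} = {})"
proof -
  obtain p g r p' g' r' where P: "P = (p, g, r)" "Q = (p', g', r')" by (cases P; cases Q)
  let ?Z = "(x1, x2, y1, y2)" and ?Z' = "(x1, x2 - 2 * y1, y1, y2)"
  let ?P = "(p, g, r)" and ?Q = "(p' + 2 * g', g', r')"
  let ?blk = "block_arm ?Z P Q"
  obtain s t where v: "valid P" "valid Q" and s: "adm ?Z s" "path (move ?Z P Q) s ls t" "meet P Q s t"
    using bad unfolding bad_def by blast
  have "\<exists>q ls' q' i. adm ?Z' q \<and> s \<in> set (?blk q) \<and> path (move ?Z' ?P ?Q) q ls' q' \<and> adm ?Z' q' \<and>
     i < length (?blk q') \<and> t = ?blk q' ! i \<and> set ls \<subseteq> set ls' \<union> {Rh} \<and>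
     (length ls' < length ls \<or>
      ls' = ls \<and> (ls = [] \<or> i = 0 \<and> set (butlast ls) \<inter> {Vin} = {}))"
  proof (rule desubstitute[OF _ _ _ _ _ _ s(2,1)])
    show "\<exists>q. adm ?Z' q \<and> s \<in> set (?blk q)" if "adm ?Z s" for s
      using cover_arm[OF refl pos that] unfolding P .
    show "Suc i < length (?blk q) \<and> t = ?blk q ! Suc i \<or>
        Suc i = length (?blk q) \<and> (\<exists>q'. move ?Z' ?P ?Q q q' \<and> adm ?Z' q' \<and> t = hd (?blk q'))"
      if "adm ?Z' q" "i < length (?blk q)" "move ?Z P Q (?blk q ! i) t" for q t i
      using simulate_arm[OF refl refl pos that(1)] that(2,3) unfolding P by blast
    show "?blk q \<noteq> []" for q unfolding P by (cases q; cases "lt q") auto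
    show "lt (hd (?blk q)) = lt q" for q unfolding P by (cases q; cases "lt q") auto
    show "lt s \<in> {Rh}" if "s \<in> set (tl (?blk q))" for q s
      using that unfolding P by (cases q; cases "lt q") auto
    show "length (?blk q) \<noteq> 1" if "lt q \<in> {Vin}" for q
      using that unfolding P by (cases q) auto
  qed
  then obtain q ls' q' i where *: "adm ?Z' q" "s \<in> set (?blk q)" "path (move ?Z' ?P ?Q) q ls' q'"
     "t \<in> set (?blk q')" "set ls \<subseteq> set ls' \<union> {Rh}"
     and len: "length ls' < length ls \<or> ls' = ls \<and> (ls = [] \<or> set (butlast ls) \<inter> {Vin} = {})"
    by (metis nth_mem)
  have "meet ?P ?Q q q'"
    using meet_nested[OF s(3)] nested_arm[OF v[unfolded P]] * unfolding P by blast
  \<comment> \<open>Only \<open>Rh\<close> is erased, so the letter found in \<open>ls\<close>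
    survives.\<close>
  moreover have "\<exists>l\<in>set ls'. l \<in> {Hin, Hout, Vin, Vout}"
    using bad *(5) unfolding bad_def by auto
  moreover have "valid ?P" "valid ?Q" using v P by auto
  ultimately have "bad ?Z' ?P ?Q ls'" unfolding bad_def using *(1,3) by blast
  then show ?thesis using len by (intro exI[of _ ?P] exI[of _ ?Q] exI[of _ ls']) auto
qed

text \<open>Only the first of the \<open>m\<close> steps has to report on the letters: a word that
  is unchanged at the end was unchanged by that step.\<close>

lemma reduce_corridor_power:
  assumes "bad (x1, x2, y1, y2) P Q ls"
    and "0 < x2" "0 < y1" "0 < y2" "0 < x1 - real m * (y1 + y2)"
  shows "\<exists>P' Q' ls'. bad (x1 - real m * (y1 + y2), x2, y1, y2) P' Q' ls' \<and>
    (length ls' < length ls \<or> ls' = ls \<and> (0 < m \<longrightarrow> set (butlast ls) \<inter> {Vout, Bt} = {}))"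
  using assms
proof (induction m arbitrary: x1 P Q ls)
  case 0
  then show ?case by (intro exI[of _ P] exI[of _ Q] exI[of _ ls]) simp
next
  case (Suc m)
  have gt: "0 < x1 - (y1 + y2) - real m * (y1 + y2)" using Suc.prems by (simp add: algebra_simps)
  moreover have "0 \<le> real m * (y1 + y2)" using Suc.prems by simp
  ultimately have "y1 + y2 < x1" by linarith
  from reduce_corridor[OF Suc.prems(1-4) this] obtain P' Q' ls' where
    1: "bad (x1 - (y1 + y2), x2, y1, y2) P' Q' ls'"
       "length ls' < length ls \<or> ls' = ls \<and> set (butlast ls) \<inter> {Vout, Bt} = {}" by blast
  have eq: "x1 - (y1 + y2) - real m * (y1 + y2) = x1 - real (Suc m) * (y1 + y2)"
    by (simp add: algebra_simps)
  from Suc.IH[OF 1(1) Suc.prems(2-4) gt] obtain P'' Q'' ls'' where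
    "bad (x1 - real (Suc m) * (y1 + y2), x2, y1, y2) P'' Q'' ls''"
    "length ls'' < length ls' \<or> ls'' = ls'" unfolding eq by blast
  with 1(2) show ?case by (intro exI[of _ P''] exI[of _ Q''] exI[of _ ls'']) auto
qed

lemma reduce_arm_power:
  assumes "bad (x1, x2, y1, y2) P Q ls"
    and "0 < x1" "0 < y1" "0 < y2" "0 < x2 - real m * (2 * y1)"
  shows "\<exists>P' Q' ls'. bad (x1, x2 - real m * (2 * y1), y1, y2) P' Q' ls' \<and>
    (length ls' < length ls \<or> ls' = ls \<and> (0 < m \<longrightarrow> set (butlast ls) \<inter> {Vin} = {}))"
  using assms
proof (induction m arbitrary: x2 P Q ls)
  case 0
  then show ?case by (intro exI[of _ P] exI[of _ Q] exI[of _ ls]) simp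
next
  case (Suc m)
  have gt: "0 < x2 - 2 * y1 - real m * (2 * y1)" using Suc.prems by (simp add: algebra_simps)
  moreover have "0 \<le> real m * (2 * y1)" using Suc.prems by simp
  ultimately have "2 * y1 < x2" by linarith
  from reduce_arm[OF Suc.prems(1-4) this] obtain P' Q' ls' where
    1: "bad (x1, x2 - 2 * y1, y1, y2) P' Q' ls'"
       "length ls' < length ls \<or> ls' = ls \<and> set (butlast ls) \<inter> {Vin} = {}" by blast
  have eq: "x2 - 2 * y1 - real m * (2 * y1) = x2 - real (Suc m) * (2 * y1)"
    by (simp add: algebra_simps)
  from Suc.IH[OF 1(1) Suc.prems(2-4) gt] obtain P'' Q'' ls'' where
    "bad (x1, x2 - real (Suc m) * (2 * y1), y1, y2) P'' Q'' ls''"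
    "length ls'' < length ls' \<or> ls'' = ls'" unfolding eq by blast
  with 1(2) show ?case by (intro exI[of _ P''] exI[of _ Q''] exI[of _ ls'']) auto
qed

section \<open>Order of the two kinds of reflection\<close>

definition precedes :: "'a \<Rightarrow> 'a \<Rightarrow> 'a list \<Rightarrow> bool" where
  "precedes a b ls \<longleftrightarrow> (\<exists>us vs. ls = us @ vs \<and> a \<in> set us \<and> b \<in> set vs)"

lemma precedes_total:
  assumes "a \<in> set ls" "b \<in> set ls" "a \<noteq> b"
  shows "precedes a b ls \<or> precedes b a ls"
proof -
  obtain us vs where ls: "ls = us @ a # vs" using assms(1) by (meson split_list)
  then have "ls = (us @ [a]) @ vs" by simp
  moreover have "b \<in> set us \<or> b \<in> set vs" using ls assms by auto
  ultimately show ?thesis unfolding precedes_def using ls by (metis in_set_conv_decomp list.set_intros(1))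
qed

lemma precedes_map: "precedes a b ls \<Longrightarrow> precedes (f a) (f b) (map f ls)"
  unfolding precedes_def by (metis image_eqI list.set_map map_append)

lemma precedes_butlast: "precedes a b ls \<Longrightarrow> a \<in> set (butlast ls)"
  unfolding precedes_def by (auto simp: butlast_append)

text \<open>\<open>Bt\<close> happens in a horizontal arm and \<open>Rh\<close> in a vertical one,
  which is entered only by \<open>Vin\<close>. The first conjunct carries the induction; the
  \<open>Vin\<close> is not the last letter because the \<open>Rh\<close> follows it.\<close>

lemma path_Vin_between:
  assumes "path (move Z P Q) s ls t"
  shows "(Bt \<in> set ls \<and> target (lt t) = VArm \<longrightarrow> Vin \<in> set ls) \<and>
    (precedes Bt Rh ls \<longrightarrow> Vin \<in> set (butlast ls))"
  using assms
proof (induction rule: path.induct)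
  case path_Nil
  then show ?case by (auto simp: precedes_def)
next
  case (path_snoc s ls t u)
  obtain l c e1 d x y where T: "t = Item l c e1 d x y" by (cases t)
  obtain l' c' where l': "l' \<in> {hexit (target l), vexit (target l)}" and U: "u = enter P Q l' c' t"
    using move_enter[OF path_snoc.hyps(2)] T by auto
  have u: "lt u = l'" using U T by (auto simp: Let_def)
  have A: "Vin \<in> set (ls @ [l'])" if "Bt \<in> set (ls @ [l'])" "target l' = VArm"
    using path_snoc l' T that by (cases l) auto
  have B: "Vin \<in> set ls" if "precedes Bt Rh (ls @ [l'])"
  proof -
    from that obtain us vs where uv: "ls @ [l'] = us @ vs" "Bt \<in> set us" "Rh \<in> set vs"
      unfolding precedes_def by blast
    then have "vs \<noteq> []" by auto
    then obtain ws where ws: "vs = ws @ [l']" "ls = us @ ws"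
      using uv(1) by (cases vs rule: rev_cases) auto
    show ?thesis
    proof (cases "Rh \<in> set ws")
      case True
      then have "precedes Bt Rh ls" using ws uv unfolding precedes_def by blast
      then have "Vin \<in> set (butlast ls)" using path_snoc by blast
      then show ?thesis by (rule in_set_butlastD)
    next
      case False
      then have "l' = Rh" using ws uv by auto
      then have "target (lt t) = VArm" using l' T by (cases l) auto
      moreover have "Bt \<in> set ls" using ws uv by auto
      ultimately show ?thesis using path_snoc by blast
    qed
  qed
  show ?case using A B unfolding u by simp
qed

text \<open>\<open>F\<close> consists of \<open>m_conv\<close> corridor steps, half of
  \<open>n_conv\<close> arm steps and an exchange of the axes. If some step is made and the word
  keeps its length, \<open>Bt\<close> or \<open>Vin\<close> is missing before the last letter,
  whereas an \<open>Rh\<close> after a \<open>Bt\<close> requires both there.\<close>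

lemma bad_F:
  assumes bad: "bad Z P Q ls" and pos: "positive Z" "positive (F Z)" and even: "even (n_conv Z)"
  shows "\<exists>P' Q' ls'. bad (F Z) P' Q' ls' \<and>
     (length ls' < length ls \<or>
      ls' = map swapl ls \<and> (m_conv Z \<noteq> 0 \<or> n_conv Z \<noteq> 0 \<longrightarrow> \<not> precedes Bt Rh ls))"
proof -
  obtain x1 x2 y1 y2 where Z: "Z = (x1, x2, y1, y2)" by (cases Z)
  have pos': "0 < x1" "0 < x2" "0 < y1" "0 < y2" using pos Z by auto
  have m0: "0 \<le> m_conv Z" and n0: "0 \<le> n_conv Z" using pos' Z by auto
  define m where "m = nat (m_conv Z)"
  obtain k where k: "n_conv Z = 2 * k" using even by blast
  define n where "n = nat k"
  have m: "real_of_int (m_conv Z) = real m" and n: "real_of_int (n_conv Z) = 2 * real n"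
    using m0 n0 k by (auto simp: m_def n_def)
  have F: "F Z = swapq (x1 - real m * (y1 + y2), x2 - real n * (2 * y1), y1, y2)"
    using m n unfolding Z by simp
  have px: "0 < x1 - real m * (y1 + y2)" "0 < x2 - real n * (2 * y1)" using pos(2) unfolding F by auto
  obtain P1 Q1 l1 where 1: "bad (x1 - real m * (y1 + y2), x2, y1, y2) P1 Q1 l1"
    "length l1 < length ls \<or> l1 = ls \<and> (0 < m \<longrightarrow> set (butlast ls) \<inter> {Vout, Bt} = {})"
    using reduce_corridor_power[OF bad[unfolded Z] pos'(2-4) px(1)] by blast
  obtain P2 Q2 l2 where 2: "bad (x1 - real m * (y1 + y2), x2 - real n * (2 * y1), y1, y2) P2 Q2 l2"
    "length l2 < length l1 \<or> l2 = l1 \<and> (0 < n \<longrightarrow> set (butlast l1) \<inter> {Vin} = {})"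
    using reduce_arm_power[OF 1(1) px(1) pos'(3,4) px(2)] by blast
  have "bad (F Z) Q2 P2 (map swapl l2)" unfolding F by (rule bad_swap[OF 2(1)])
  moreover have "length (map swapl l2) < length ls \<or>
      map swapl l2 = map swapl ls \<and> (m_conv Z \<noteq> 0 \<or> n_conv Z \<noteq> 0 \<longrightarrow> \<not> precedes Bt Rh ls)"
  proof (cases "length l2 < length ls")
    case False
    then have l: "l1 = ls" "l2 = ls" and E: "0 < m \<longrightarrow> set (butlast ls) \<inter> {Vout, Bt} = {}"
      "0 < n \<longrightarrow> set (butlast ls) \<inter> {Vin} = {}" using 1(2) 2(2) by auto
    have "\<not> precedes Bt Rh ls" if "m_conv Z \<noteq> 0 \<or> n_conv Z \<noteq> 0"
    proof
      assume pr: "precedes Bt Rh ls"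
      obtain s t where "path (move Z P Q) s ls t" using bad unfolding bad_def by blast
      then have "Vin \<in> set (butlast ls)" "Bt \<in> set (butlast ls)"
        using path_Vin_between pr precedes_butlast[OF pr] by blast+
      then have "m = 0" "n = 0" using E by auto
      then show False using that m n by auto
    qed
    then show ?thesis using l by simp
  qed simp
  ultimately show ?thesis by blast
qed

text \<open>After a step the last two entries are remainders; this gives two of the inequalities of
  \<open>star_condition\<close>. Two vanishing convergents would give the other two.\<close>

lemma conv_nonzero:
  assumes "positive Z" "positive (F Z)" "\<not> star_condition (F Z)"
  shows "m_conv (F Z) \<noteq> 0 \<or> n_conv (F Z) \<noteq> 0"
proof (rule ccontr)
  assume "\<not> ?thesis"
  then have z: "m_conv (F Z) = 0" "n_conv (F Z) = 0" by auto
  obtain x1 x2 y1 y2 where Z: "Z = (x1, x2, y1, y2)" by (cases Z)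
  define a where "a = x1 - \<lfloor>x1 / (y1 + y2)\<rfloor> * (y1 + y2)"
  define b where "b = x2 - \<lfloor>x2 / y1\<rfloor> * y1"
  have FZ: "F Z = (y1, y2, a, b)" unfolding Z a_def b_def by simp
  have pos: "0 < y1" "0 < y2" "0 < a" "0 < b" using assms(2) unfolding FZ by auto
  have "x1 / (y1 + y2) < \<lfloor>x1 / (y1 + y2)\<rfloor> + 1" "x2 / y1 < \<lfloor>x2 / y1\<rfloor> + 1" by linarith+
  then have ab: "a < y1 + y2" "b < y1" using pos unfolding a_def b_def by (auto simp: field_simps)
  have "y1 / (a + b) < 1" "y2 / a < 1" using z unfolding FZ by (auto simp: floor_eq_iff)
  then have "y1 < a + b" "y2 < a" using pos by (auto simp: field_simps)
  then show False using assms(3) ab unfolding FZ by auto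
qed

text \<open>A shortest bad word is only mirrored by each step. The second step has a nonzero
  convergent and forbids \<open>Bt\<close> before \<open>Rh\<close> in the mirrored word; the third
  forbids the same in the word mirrored back, that is, \<open>Rh\<close> before \<open>Bt\<close> in
  the mirrored one. As both letters occur, one of the two orders must be present.\<close>

lemma no_bad:
  assumes "F_renormalizable Z" "\<And>k. even (n_conv ((F ^^ k) Z))"
  shows "\<not> bad Z P Q ls"
  using assms
proof (induction "length ls" arbitrary: Z P Q ls rule: less_induct)
  case less
  have ren: "positive ((F ^^ k) Z)" "\<not> star_condition ((F ^^ k) Z)" for k
    using less.prems(1) unfolding F_renormalizable_def by auto
  have iter: "F_renormalizable ((F ^^ k) Z)" "even (n_conv ((F ^^ j) ((F ^^ k) Z)))" for j k
    using less.prems unfolding F_renormalizable_def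
    by (auto simp: funpow_add[symmetric, unfolded comp_def fun_eq_iff, rule_format])
  show ?case
  proof
    assume bad0: "bad Z P Q ls"
    have step: "\<exists>P' Q'. bad ((F ^^ Suc k) Z) P' Q' (map swapl l) \<and> (0 < k \<longrightarrow> \<not> precedes Bt Rh l)"
      if b: "bad ((F ^^ k) Z) P' Q' l" and len: "length l \<le> length ls" for k P' Q' l
    proof -
      have p: "positive ((F ^^ k) Z)" "positive (F ((F ^^ k) Z))" using ren(1)[of k] ren(1)[of "Suc k"] by auto
      have e: "even (n_conv ((F ^^ k) Z))" using less.prems by blast
      obtain P'' Q'' l' where *: "bad (F ((F ^^ k) Z)) P'' Q'' l'"
        "length l' < length l \<or> l' = map swapl l \<and>
          (m_conv ((F ^^ k) Z) \<noteq> 0 \<or> n_conv ((F ^^ k) Z) \<noteq> 0 \<longrightarrow> \<not> precedes Bt Rh l)"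
        using bad_F[OF b p e] by blast
      have "\<not> length l' < length l"
      proof
        assume "length l' < length l"
        then have "length l' < length ls" using len by simp
        then show False using less.hyps[OF _ iter(1)[of "Suc k"] iter(2)] * by auto
      qed
      moreover have "m_conv ((F ^^ k) Z) \<noteq> 0 \<or> n_conv ((F ^^ k) Z) \<noteq> 0" if k: "0 < k"
      proof -
        obtain j where j: "k = Suc j" using k by (cases k) auto
        show ?thesis using conv_nonzero[of "(F ^^ j) Z"] ren(1)[of j] ren[of "Suc j"] unfolding j by simp
      qed
      ultimately have l': "l' = map swapl l" "0 < k \<longrightarrow> \<not> precedes Bt Rh l" using *(2) by auto
      have "bad ((F ^^ Suc k) Z) P'' Q'' (map swapl l)" using *(1) l'(1) by simp
      then show ?thesis using l'(2) by blast
    qed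
    have "bad ((F ^^ 0) Z) P Q ls" using bad0 by simp
    from step[OF this order_refl] obtain P1 Q1 where 1: "bad ((F ^^ Suc 0) Z) P1 Q1 (map swapl ls)"
      by blast
    obtain P2 Q2 where 2: "bad ((F ^^ 2) Z) P2 Q2 (map swapl (map swapl ls))"
        "\<not> precedes Bt Rh (map swapl ls)"
      using step[OF 1] by (auto simp: numeral_2_eq_2)
    have "\<not> precedes Bt Rh (map swapl (map swapl ls))"
      using step[OF 2(1)] by auto
    then have "\<not> precedes Rh Bt (map swapl ls)" using precedes_map[of Rh Bt "map swapl ls" swapl] by auto
    moreover have "Rh \<in> set (map swapl ls)" "Bt \<in> set (map swapl ls)" using bad_both[OF 1] by auto
    ultimately show False using 2(2) precedes_total[of Rh "map swapl ls" Bt] by simp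
  qed
qed

text \<open>For the weights \<open>(1, 0, 0)\<close> all extents are 0, so equal boxes meet. The
  words left over are those that bounce inside a single arm.\<close>

lemma unique_visit:
  assumes ren: "F_renormalizable Z" "\<And>k. even (n_conv ((F ^^ k) Z))"
    and s: "adm Z s" and path: "path (move Z (1, 0, 0) (1, 0, 0)) s ls t"
    and eq: "px s = px t" "py s = py t"
  shows "set ls \<subseteq> {Bt} \<or> set ls \<subseteq> {Rh}"
proof -
  have "0 \<le> extent (1, 0, 0) l" for l by (cases l) auto
  then have "meet (1, 0, 0) (1, 0, 0) s t"
    unfolding meet_def using eq by (metis mult_zero_right order_refl)
  then have "\<not> (\<exists>l\<in>set ls. l \<in> {Hin, Hout, Vin, Vout})"
    using no_bad[OF ren, of "(1, 0, 0)" "(1, 0, 0)" ls] s path unfolding bad_def valid.simps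
    by (metis order_refl zero_less_one_class.zero_le_one)
  then have sub: "set ls \<subseteq> {Bt, Rh}"
    by (metis (full_types) insert_iff letter.exhaust subsetI)
  then have "set ls \<inter> {Hin, Hout} = {}" by auto
  from no_H_all_or_no_Bt[OF path this] sub show ?thesis
    by (auto split: if_splits)
qed

section \<open>The grid of boxes\<close>

text \<open>The lines \<open>x = i + a / 2\<close> and \<open>x = i + 1 - a / 2\<close> get the indices \<open>2 * i\<close> and \<open>2 * i + 1\<close>.\<close>

definition edge :: "real \<Rightarrow> int \<Rightarrow> real" where
  "edge a k = of_int (k div 2) + (if even k then a / 2 else 1 - a / 2)"

lemma edge_Suc: "edge a (k + 1) = edge a k + (if even k then 1 - a else a)"
proof (cases "even k")
  case True
  then obtain i where "k = 2 * i" by blast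
  then show ?thesis by (simp add: edge_def)
next
  case False
  then obtain i where "k = 2 * i + 1" by (elim oddE)
  then show ?thesis by (simp add: edge_def)
qed

lemma edge_less:
  assumes "0 < a" "a < 1" "k < k'"
  shows "edge a k < edge a k'"
  using assms(3)
proof (induction k' rule: int_gr_induct)
  case base
  then show ?case using assms edge_Suc[of a k] by auto
next
  case (step i)
  then show ?case using assms edge_Suc[of a i] by (auto split: if_splits)
qed

lemma edge_less_iff: "0 < a \<Longrightarrow> a < 1 \<Longrightarrow> edge a k < edge a k' \<longleftrightarrow> k < k'"
  using edge_less[of a k k'] edge_less[of a k' k] by (metis less_asym' linorder_neqE_linordered_idom)

lemma edge_le_iff: "0 < a \<Longrightarrow> a < 1 \<Longrightarrow> edge a k \<le> edge a k' \<longleftrightarrow> k \<le> k'"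
  using edge_less_iff[of a k' k] by (simp add: not_less flip: not_le)

lemma edge_double: "edge a (2 * i) = of_int i + a / 2"
  by (simp add: edge_def)

lemma edge_double_Suc: "edge a (2 * i + 1) = of_int i + 1 - a / 2"
  by (simp add: edge_def)

lemma edge_cover:
  assumes "0 < a" "a < 1"
  obtains k where "edge a k \<le> x" "x < edge a (k + 1)"
proof -
  define i where "i = \<lfloor>x - a / 2\<rfloor>"
  have i: "of_int i \<le> x - a / 2" "x - a / 2 < of_int i + 1" unfolding i_def by linarith+
  have e: "edge a (2 * i) = of_int i + a / 2" "edge a (2 * i + 1) = of_int i + 1 - a / 2"
     "edge a (2 * i + 1 + 1) = of_int i + 1 + a / 2"
    by (auto simp: edge_def)
  show ?thesis
  proof (cases "x < edge a (2 * i + 1)")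
    case True
    then show ?thesis using that[of "2 * i"] i e by auto
  next
    case False
    then show ?thesis using that[of "2 * i + 1"] i e by auto
  qed
qed

lemma abs_eq_edge: "(\<exists>i::int. \<bar>x - of_int i\<bar> = a / 2) \<longleftrightarrow> (\<exists>k. x = edge a k)" if "0 < a"
proof
  assume "\<exists>i::int. \<bar>x - of_int i\<bar> = a / 2"
  then obtain i :: int where "\<bar>x - of_int i\<bar> = a / 2" by blast
  then have "x = of_int i + a / 2 \<or> x = of_int i - a / 2" by linarith
  moreover have "edge a (2 * i) = of_int i + a / 2" "edge a (2 * (i - 1) + 1) = of_int i - a / 2"
    using edge_double[of a i] edge_double_Suc[of a "i - 1"] by simp_all
  ultimately show "\<exists>k. x = edge a k" by metis
next
  assume "\<exists>k. x = edge a k"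
  then obtain k where x: "x = edge a k" by blast
  show "\<exists>i::int. \<bar>x - of_int i\<bar> = a / 2"
  proof (cases "even k")
    case True
    then show ?thesis using that by (intro exI[of _ "k div 2"]) (simp add: x edge_def)
  next
    case False
    then show ?thesis using that by (intro exI[of _ "k div 2 + 1"]) (simp add: x edge_def)
  qed
qed

text \<open>The obstacle around \<open>i\<close> lies between the lines with indices
  \<open>2 * i - 1\<close> and \<open>2 * i\<close>, so odd indices mark obstacles.\<close>

lemma abs_less_edge:
  "(\<exists>i::int. \<bar>x - of_int i\<bar> < a / 2) \<longleftrightarrow> (\<exists>k. odd k \<and> edge a k < x \<and> x < edge a (k + 1))"
proof
  assume "\<exists>i::int. \<bar>x - of_int i\<bar> < a / 2"
  then obtain i :: int where "\<bar>x - of_int i\<bar> < a / 2" by blast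
  then have "of_int i - a / 2 < x" "x < of_int i + a / 2" by linarith+
  moreover have "edge a (2 * (i - 1) + 1) = of_int i - a / 2" "edge a (2 * (i - 1) + 1 + 1) = of_int i + a / 2"
    using edge_double_Suc[of a "i - 1"] edge_Suc[of a "2 * (i - 1) + 1"] by simp_all
  ultimately show "\<exists>k. odd k \<and> edge a k < x \<and> x < edge a (k + 1)"
    by (intro exI[of _ "2 * (i - 1) + 1"]) simp
next
  assume "\<exists>k. odd k \<and> edge a k < x \<and> x < edge a (k + 1)"
  then obtain k where k: "odd k" "edge a k < x" "x < edge a (k + 1)" by blast
  have "edge a k = of_int (k div 2 + 1) - a / 2" "edge a (k + 1) = of_int (k div 2 + 1) + a / 2"
    using k(1) edge_Suc[of a k] by (simp_all add: edge_def)
  then have "\<bar>x - of_int (k div 2 + 1)\<bar> < a / 2" using k by linarith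
  then show "\<exists>i::int. \<bar>x - of_int i\<bar> < a / 2" by blast
qed

lemma vertical_sides_edge:
  "0 < a \<Longrightarrow> (x, y) \<in> vertical_sides a b \<longleftrightarrow>
     (\<exists>k l. odd l \<and> x = edge a k \<and> edge b l < y \<and> y < edge b (l + 1))"
  using abs_eq_edge[of a x] abs_less_edge[of y b] unfolding vertical_sides_def by auto

lemma horizontal_sides_edge:
  "0 < b \<Longrightarrow> (x, y) \<in> horizontal_sides a b \<longleftrightarrow>
     (\<exists>k l. odd k \<and> edge a k < x \<and> x < edge a (k + 1) \<and> y = edge b l)"
  using abs_eq_edge[of b y] abs_less_edge[of x a] unfolding horizontal_sides_def by auto

lemma corners_edge:
  "0 < a \<Longrightarrow> 0 < b \<Longrightarrow> (x, y) \<in> corners a b \<longleftrightarrow> (\<exists>k l. x = edge a k \<and> y = edge b l)"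
  using abs_eq_edge[of b y] abs_eq_edge[of a x] unfolding corners_def by auto

lemma table_edge:
  "(x, y) \<in> table a b \<longleftrightarrow>
     \<not> (\<exists>k l. odd k \<and> odd l \<and> edge a k < x \<and> x < edge a (k + 1) \<and> edge b l < y \<and> y < edge b (l + 1))"
proof -
  have "(x, y) \<in> table a b \<longleftrightarrow>
      \<not> ((\<exists>i::int. \<bar>x - of_int i\<bar> < a / 2) \<and> (\<exists>j::int. \<bar>y - of_int j\<bar> < b / 2))"
    unfolding table_def open_obstacle_def by auto
  then show ?thesis unfolding abs_less_edge by auto
qed

section \<open>Billiard motions\<close>

lemma motion_restrict:
  assumes m: "billiard_motion a b \<theta> p T \<gamma> v" and T': "0 \<le> T'" "T' \<le> T"
  shows "billiard_motion a b \<theta> p T' \<gamma> v"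
proof -
  have 1: "\<gamma> 0 = p" "v 0 = (cos \<theta>, sin \<theta>) \<or> v 0 = reflect a b p (cos \<theta>, sin \<theta>)"
      "\<forall>t\<in>{0..T}. \<gamma> t \<in> table a b - corners a b"
    and 2: "\<And>t. t \<in> {0..<T} \<Longrightarrow> \<exists>\<epsilon>>0. \<forall>s\<in>{t..<t + \<epsilon>} \<inter> {0..T}.
        \<gamma> s = \<gamma> t + (s - t) *\<^sub>R v t \<and> (s < T \<longrightarrow> v s = v t)"
    and 3: "\<And>t. t \<in> {0<..T} \<Longrightarrow> \<exists>\<epsilon>>0. \<forall>s\<in>{t - \<epsilon><..<t} \<inter> {0..T}.
        \<gamma> t = \<gamma> s + (t - s) *\<^sub>R v s \<and> v t = reflect a b (\<gamma> t) (v s)"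
    using m unfolding billiard_motion_def by blast+
  have "\<exists>\<epsilon>>0. \<forall>s\<in>{t..<t + \<epsilon>} \<inter> {0..T'}.
        \<gamma> s = \<gamma> t + (s - t) *\<^sub>R v t \<and> (s < T' \<longrightarrow> v s = v t)" if t: "t \<in> {0..<T'}" for t
  proof -
    have "t \<in> {0..<T}" using t T' by auto
    from 2[OF this] obtain \<epsilon> where "\<epsilon> > 0" and e: "\<And>s. s\<in>{t..<t + \<epsilon>} \<inter> {0..T} \<Longrightarrow>
        \<gamma> s = \<gamma> t + (s - t) *\<^sub>R v t \<and> (s < T \<longrightarrow> v s = v t)"
      by blast
    have "\<gamma> s = \<gamma> t + (s - t) *\<^sub>R v t \<and> (s < T' \<longrightarrow> v s = v t)" if "s\<in>{t..<t + \<epsilon>} \<inter> {0..T'}" for s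
      using e[of s] that T' by auto
    then show ?thesis using \<open>\<epsilon> > 0\<close> by blast
  qed
  moreover have "\<exists>\<epsilon>>0. \<forall>s\<in>{t - \<epsilon><..<t} \<inter> {0..T'}.
        \<gamma> t = \<gamma> s + (t - s) *\<^sub>R v s \<and> v t = reflect a b (\<gamma> t) (v s)" if t: "t \<in> {0<..T'}" for t
  proof -
    have "t \<in> {0<..T}" using t T' by auto
    from 3[OF this] obtain \<epsilon> where "\<epsilon> > 0" and e: "\<And>s. s\<in>{t - \<epsilon><..<t} \<inter> {0..T} \<Longrightarrow>
        \<gamma> t = \<gamma> s + (t - s) *\<^sub>R v s \<and> v t = reflect a b (\<gamma> t) (v s)"
      by blast
    have "\<gamma> t = \<gamma> s + (t - s) *\<^sub>R v s \<and> v t = reflect a b (\<gamma> t) (v s)" if "s\<in>{t - \<epsilon><..<t} \<inter> {0..T'}" for s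
      using e[of s] that T' by auto
    then show ?thesis using \<open>\<epsilon> > 0\<close> by blast
  qed
  ultimately show ?thesis unfolding billiard_motion_def using 1 T' by simp
qed

lemma motion_forward:
  assumes "billiard_motion a b \<theta> p T \<gamma> v" "0 \<le> t" "t < T"
  obtains \<epsilon> where "\<epsilon> > 0" "t + \<epsilon> \<le> T"
    "\<And>s. t \<le> s \<Longrightarrow> s < t + \<epsilon> \<Longrightarrow> \<gamma> s = \<gamma> t + (s - t) *\<^sub>R v t \<and> v s = v t"
proof -
  have "\<exists>\<epsilon>>0. \<forall>s\<in>{t..<t + \<epsilon>} \<inter> {0..T}.
        \<gamma> s = \<gamma> t + (s - t) *\<^sub>R v t \<and> (s < T \<longrightarrow> v s = v t)"
    using assms unfolding billiard_motion_def by simp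
  then obtain \<epsilon> where e: "\<epsilon> > 0" "\<And>s. s\<in>{t..<t + \<epsilon>} \<inter> {0..T} \<Longrightarrow>
        \<gamma> s = \<gamma> t + (s - t) *\<^sub>R v t \<and> (s < T \<longrightarrow> v s = v t)" by blast
  have *: "\<gamma> s = \<gamma> t + (s - t) *\<^sub>R v t \<and> v s = v t" if "t \<le> s" "s < t + min \<epsilon> (T - t)" for s
  proof -
    have "s < t + \<epsilon>" "s < T" using that(2) by linarith+
    then show ?thesis using e(2)[of s] that(1) assms by auto
  qed
  have "0 < min \<epsilon> (T - t)" "t + min \<epsilon> (T - t) \<le> T" using e(1) assms by linarith+
  then show ?thesis using * by (rule that)
qed

lemma motion_backward:
  assumes "billiard_motion a b \<theta> p T \<gamma> v" "0 < t" "t \<le> T"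
  obtains \<epsilon> where "\<epsilon> > 0" "\<epsilon> \<le> t"
    "\<And>s. t - \<epsilon> < s \<Longrightarrow> s < t \<Longrightarrow> \<gamma> t = \<gamma> s + (t - s) *\<^sub>R v s \<and> v t = reflect a b (\<gamma> t) (v s)"
proof -
  have "\<exists>\<epsilon>>0. \<forall>s\<in>{t - \<epsilon><..<t} \<inter> {0..T}.
        \<gamma> t = \<gamma> s + (t - s) *\<^sub>R v s \<and> v t = reflect a b (\<gamma> t) (v s)"
    using assms unfolding billiard_motion_def by simp
  then obtain \<epsilon> where e: "\<epsilon> > 0" "\<And>s. s\<in>{t - \<epsilon><..<t} \<inter> {0..T} \<Longrightarrow>
        \<gamma> t = \<gamma> s + (t - s) *\<^sub>R v s \<and> v t = reflect a b (\<gamma> t) (v s)" by blast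
  have *: "\<gamma> t = \<gamma> s + (t - s) *\<^sub>R v s \<and> v t = reflect a b (\<gamma> t) (v s)" if "t - min \<epsilon> t < s" "s < t" for s
  proof -
    have "t - \<epsilon> < s" "0 < s" using that(1) by linarith+
    then show ?thesis using e(2)[of s] that(2) assms by auto
  qed
  have "0 < min \<epsilon> t" "min \<epsilon> t \<le> t" using e(1) assms by linarith+
  then show ?thesis using * by (rule that)
qed

text \<open>At the infimum of the times of disagreement, the condition to the left determines the
  motion from earlier times, and the condition to the right carries the agreement beyond it.\<close>

lemma motion_unique:
  assumes m: "billiard_motion a b \<theta> p T \<gamma> v" and m': "billiard_motion a b \<theta> p T \<gamma>' v'"
    and v0: "v 0 = v' 0" and t: "0 \<le> t" "t \<le> T"
  shows "\<gamma> t = \<gamma>' t \<and> v t = v' t"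
proof (rule ccontr)
  let ?agree = "\<lambda>t. \<gamma> t = \<gamma>' t \<and> v t = v' t"
  assume "\<not> ?agree t"
  define D where "D = {t. 0 \<le> t \<and> t \<le> T \<and> \<not> ?agree t}"
  have tD: "t \<in> D" using \<open>\<not> ?agree t\<close> t by (simp add: D_def)
  have bdd: "bdd_below D" unfolding D_def by (rule bdd_belowI[of _ 0]) auto
  define \<tau> where "\<tau> = Inf D"
  have \<tau>: "0 \<le> \<tau>" "\<tau> \<le> T"
    unfolding \<tau>_def using tD t cInf_lower[OF tD bdd] by (auto intro!: cInf_greatest simp: D_def)
  have before: "?agree s" if "0 \<le> s" "s < \<tau>" for s
  proof (rule ccontr)
    assume "\<not> ?agree s"
    then have "s \<in> D" using that \<tau> by (simp add: D_def)
    then have "\<tau> \<le> s" unfolding \<tau>_def using bdd by (rule cInf_lower)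
    then show False using that by simp
  qed
  have at: "?agree \<tau>"
  proof (cases "\<tau> = 0")
    case True
    then show ?thesis using v0 m m' unfolding billiard_motion_def by simp
  next
    case False
    then have "0 < \<tau>" using \<tau> by simp
    obtain e where e: "e > 0" "e \<le> \<tau>" "\<And>s. \<tau> - e < s \<Longrightarrow> s < \<tau> \<Longrightarrow>
        \<gamma> \<tau> = \<gamma> s + (\<tau> - s) *\<^sub>R v s \<and> v \<tau> = reflect a b (\<gamma> \<tau>) (v s)"
      using motion_backward[OF m \<open>0 < \<tau>\<close> \<tau>(2)] by metis
    obtain e' where e': "e' > 0" "e' \<le> \<tau>" "\<And>s. \<tau> - e' < s \<Longrightarrow> s < \<tau> \<Longrightarrow>
        \<gamma>' \<tau> = \<gamma>' s + (\<tau> - s) *\<^sub>R v' s \<and> v' \<tau> = reflect a b (\<gamma>' \<tau>) (v' s)"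
      using motion_backward[OF m' \<open>0 < \<tau>\<close> \<tau>(2)] by metis
    define s where "s = \<tau> - min e e' / 2"
    have s: "\<tau> - e < s" "\<tau> - e' < s" "s < \<tau>" "0 \<le> s" using e e' by (auto simp: s_def min_def)
    show ?thesis using e(3)[OF s(1,3)] e'(3)[OF s(2,3)] before[OF s(4,3)] by simp
  qed
  show False
  proof (cases "\<tau> < T")
    case False
    then have "\<tau> = T" using \<tau> by simp
    moreover have "\<tau> \<le> t" unfolding \<tau>_def using tD bdd by (rule cInf_lower)
    ultimately have "t = \<tau>" using t by simp
    then show False using at \<open>\<not> ?agree t\<close> by simp
  next
    case True
    obtain e where e: "e > 0" "\<tau> + e \<le> T"
      "\<And>s. \<tau> \<le> s \<Longrightarrow> s < \<tau> + e \<Longrightarrow> \<gamma> s = \<gamma> \<tau> + (s - \<tau>) *\<^sub>R v \<tau> \<and> v s = v \<tau>"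
      using motion_forward[OF m \<tau>(1) True] by metis
    obtain e' where e': "e' > 0" "\<tau> + e' \<le> T"
      "\<And>s. \<tau> \<le> s \<Longrightarrow> s < \<tau> + e' \<Longrightarrow> \<gamma>' s = \<gamma>' \<tau> + (s - \<tau>) *\<^sub>R v' \<tau> \<and> v' s = v' \<tau>"
      using motion_forward[OF m' \<tau>(1) True] by metis
    have "\<tau> + min e e' \<le> s" if "s \<in> D" for s
    proof (rule ccontr)
      assume less: "\<not> ?thesis"
      have "\<tau> \<le> s" unfolding \<tau>_def using that bdd by (rule cInf_lower)
      then have "?agree s" using e(3)[of s] e'(3)[of s] less at by auto
      then show False using that by (simp add: D_def)
    qed
    then have "\<tau> + min e e' \<le> \<tau>" unfolding \<tau>_def using tD by (intro cInf_greatest) auto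
    then show False using e e' by simp
  qed
qed

text \<open>The velocity at the final time is already the reflected one, so the next segment can be
  attached with \<open>v T\<close> as it stands.\<close>

lemma motion_extend:
  assumes m: "billiard_motion a b \<theta> p T \<gamma> v" and T: "0 \<le> T" "0 < \<eta>"
    and inside: "\<And>s. 0 < s \<Longrightarrow> s < \<eta> \<Longrightarrow>
       \<gamma> T + s *\<^sub>R v T \<in> table a b - corners a b - vertical_sides a b - horizontal_sides a b"
    and final: "\<gamma> T + \<eta> *\<^sub>R v T \<in> table a b - corners a b"
    and \<gamma>': "\<gamma>' = (\<lambda>t. if t \<le> T then \<gamma> t else \<gamma> T + (t - T) *\<^sub>R v T)"
    and v': "v' = (\<lambda>t. if t \<le> T then v t else if t < T + \<eta> then v T
                     else reflect a b (\<gamma> T + \<eta> *\<^sub>R v T) (v T))"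
  shows "billiard_motion a b \<theta> p (T + \<eta>) \<gamma>' v'"
proof -
  have G: "\<gamma>' s = \<gamma> T + (s - T) *\<^sub>R v T" if "T \<le> s" for s
    using that unfolding \<gamma>' by auto
  have V: "v' s = v T" if "T \<le> s" "s < T + \<eta>" for s
    using that unfolding v' by auto
  have 1: "\<gamma>' 0 = p" "v' 0 = (cos \<theta>, sin \<theta>) \<or> v' 0 = reflect a b p (cos \<theta>, sin \<theta>)"
    using m T unfolding billiard_motion_def \<gamma>' v' by auto
  have 2: "\<gamma>' t \<in> table a b - corners a b" if t: "t \<in> {0..T + \<eta>}" for t
  proof -
    consider "t \<le> T" | "T < t" "t < T + \<eta>" | "t = T + \<eta>" using t by fastforce
    then show ?thesis
    proof cases
      case 1
      then show ?thesis using t m unfolding billiard_motion_def \<gamma>' by simp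
    next
      case 2
      then show ?thesis using inside[of "t - T"] unfolding \<gamma>' by simp
    next
      case 3
      then show ?thesis using final T unfolding \<gamma>' by simp
    qed
  qed
  have 3: "\<exists>\<epsilon>>0. \<forall>s\<in>{t..<t + \<epsilon>} \<inter> {0..T + \<eta>}.
        \<gamma>' s = \<gamma>' t + (s - t) *\<^sub>R v' t \<and> (s < T + \<eta> \<longrightarrow> v' s = v' t)" if t: "t \<in> {0..<T + \<eta>}" for t
  proof (cases "t < T")
    case True
    obtain e where e: "e > 0" "t + e \<le> T"
      "\<And>s. t \<le> s \<Longrightarrow> s < t + e \<Longrightarrow> \<gamma> s = \<gamma> t + (s - t) *\<^sub>R v t \<and> v s = v t"
      using motion_forward[OF m _ True] t by (metis atLeastLessThan_iff)
    have "\<gamma>' s = \<gamma>' t + (s - t) *\<^sub>R v' t \<and> (s < T + \<eta> \<longrightarrow> v' s = v' t)"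
      if "s\<in>{t..<t + e} \<inter> {0..T + \<eta>}" for s
      using that e(2) e(3)[of s] True unfolding \<gamma>' v' by auto
    then show ?thesis using e(1) by blast
  next
    case False
    have "\<gamma>' s = \<gamma>' t + (s - t) *\<^sub>R v' t \<and> (s < T + \<eta> \<longrightarrow> v' s = v' t)"
      if "s\<in>{t..<t + (T + \<eta> - t)} \<inter> {0..T + \<eta>}" for s
    proof -
      have le: "T \<le> s" "T \<le> t" "t < T + \<eta>" using that False t by auto
      have *: "\<gamma>' s = \<gamma> T + (s - T) *\<^sub>R v T" "\<gamma>' t = \<gamma> T + (t - T) *\<^sub>R v T" "v' t = v T"
          "s < T + \<eta> \<longrightarrow> v' s = v T"
        using G[OF le(1)] G[OF le(2)] V[OF le(2,3)] V[OF le(1)] by blast+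
      show ?thesis using *(4) unfolding *(1-3) by (simp add: algebra_simps)
    qed
    then have "\<forall>s\<in>{t..<t + (T + \<eta> - t)} \<inter> {0..T + \<eta>}.
        \<gamma>' s = \<gamma>' t + (s - t) *\<^sub>R v' t \<and> (s < T + \<eta> \<longrightarrow> v' s = v' t)" by blast
    moreover have "0 < T + \<eta> - t" using t by simp
    ultimately show ?thesis by blast
  qed
  have 4: "\<exists>\<epsilon>>0. \<forall>s\<in>{t - \<epsilon><..<t} \<inter> {0..T + \<eta>}.
        \<gamma>' t = \<gamma>' s + (t - s) *\<^sub>R v' s \<and> v' t = reflect a b (\<gamma>' t) (v' s)" if t: "t \<in> {0<..T + \<eta>}" for t
  proof (cases "t \<le> T")
    case True
    obtain e where e: "e > 0" "e \<le> t"
      "\<And>s. t - e < s \<Longrightarrow> s < t \<Longrightarrow> \<gamma> t = \<gamma> s + (t - s) *\<^sub>R v s \<and> v t = reflect a b (\<gamma> t) (v s)"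
      using motion_backward[OF m _ True] t by (metis greaterThanAtMost_iff)
    have "\<gamma>' t = \<gamma>' s + (t - s) *\<^sub>R v' s \<and> v' t = reflect a b (\<gamma>' t) (v' s)"
      if "s\<in>{t - e<..<t} \<inter> {0..T + \<eta>}" for s
      using that e(3)[of s] True unfolding \<gamma>' v' by auto
    then show ?thesis using e(1) by blast
  next
    case False
    have "\<gamma>' t = \<gamma>' s + (t - s) *\<^sub>R v' s" "v' s = v T" if "s\<in>{t - (t - T)<..<t} \<inter> {0..T + \<eta>}" for s
    proof -
      have le: "T \<le> s" "T \<le> t" "s < T + \<eta>" using that False t by auto
      have *: "\<gamma>' s = \<gamma> T + (s - T) *\<^sub>R v T" "\<gamma>' t = \<gamma> T + (t - T) *\<^sub>R v T" "v' s = v T"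
        using G[OF le(1)] G[OF le(2)] V[OF le(1,3)] by blast+
      show "\<gamma>' t = \<gamma>' s + (t - s) *\<^sub>R v' s" unfolding * by (simp add: algebra_simps)
      show "v' s = v T" by (rule *)
    qed
    moreover have "v' t = reflect a b (\<gamma>' t) (v T)"
    proof (cases "t = T + \<eta>")
      case True
      then show ?thesis using False unfolding \<gamma>' v' by simp
    next
      case neq: False
      have "\<gamma>' t \<notin> vertical_sides a b" "\<gamma>' t \<notin> horizontal_sides a b"
        using inside[of "t - T"] False neq t unfolding \<gamma>' by auto
      then show ?thesis using False neq t unfolding reflect_def v' by auto
    qed
    ultimately have "\<forall>s\<in>{t - (t - T)<..<t} \<inter> {0..T + \<eta>}.
        \<gamma>' t = \<gamma>' s + (t - s) *\<^sub>R v' s \<and> v' t = reflect a b (\<gamma>' t) (v' s)" by metis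
    moreover have "0 < t - T" using False by simp
    ultimately show ?thesis by blast
  qed
  show ?thesis unfolding billiard_motion_def using 1 2 3 4 by blast
qed

lemma motion_const:
  assumes "p \<in> table a b - corners a b" "w = (cos \<theta>, sin \<theta>) \<or> w = reflect a b p (cos \<theta>, sin \<theta>)"
  shows "billiard_motion a b \<theta> p 0 (\<lambda>_. p) (\<lambda>_. w)"
  using assms unfolding billiard_motion_def by auto

section \<open>The sequence of visited boxes\<close>

definition len :: "real \<Rightarrow> int \<Rightarrow> real" where
  "len a k = edge a (k + 1) - edge a k"

definition ent :: "real \<Rightarrow> int \<Rightarrow> int \<Rightarrow> real" where
  "ent a k e = edge a (if e = 1 then k else k + 1)"

definition ext :: "real \<Rightarrow> int \<Rightarrow> int \<Rightarrow> real" where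
  "ext a k e = edge a (if e = 1 then k + 1 else k)"

text \<open>Half-open in the direction of motion: a point on a grid line belongs to the box about to
  be crossed, so the distance to the exit is always positive.\<close>

definition in_span :: "real \<Rightarrow> int \<Rightarrow> int \<Rightarrow> real \<Rightarrow> bool" where
  "in_span a k e x \<longleftrightarrow> 0 \<le> e * (x - ent a k e) \<and> 0 < e * (ext a k e - x)"

datatype bstate = BS (col: int) (row: int) (hdir: int) (vdir: int) (xc: real) (yc: real)

lemma len_eq: "len a k = (if even k then 1 - a else a)"
  unfolding len_def edge_Suc by simp

lemma unit_cases: "\<bar>e::int\<bar> = 1 \<Longrightarrow> e = 1 \<or> e = -1"
  by (simp add: abs_if split: if_splits)

lemma ext_ent: "\<bar>e\<bar> = 1 \<Longrightarrow> e * (ext a k e - ent a k e) = len a k"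
  using unit_cases[of e] by (auto simp: ext_def ent_def len_def)

lemma ent_reflect: "\<bar>e\<bar> = 1 \<Longrightarrow> ent a k (- e) = ext a k e"
  using unit_cases[of e] by (auto simp: ext_def ent_def)

lemma ent_cross: "\<bar>e\<bar> = 1 \<Longrightarrow> ent a (k + e) e = ext a k e"
  using unit_cases[of e] by (auto simp: ext_def ent_def)

locale wind_tree =
  fixes a b \<theta> :: real
  assumes a: "0 < a" "a < 1" and b: "0 < b" "b < 1"
    and cos: "0 < cos \<theta>" and sin: "0 < sin \<theta>"
begin

lemma len_pos: "0 < len a k" "0 < len b k"
  using a b by (auto simp: len_eq)

lemma in_span_new:
  assumes "\<bar>e\<bar> = 1"
  shows "in_span a k e (ent a k e)" "in_span b k e (ent b k e)"
  using assms ext_ent[OF assms, of _ k] len_pos[of k] unfolding in_span_def by auto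

definition tH :: "bstate \<Rightarrow> real" where
  "tH S = hdir S * (ext a (col S) (hdir S) - xc S) / cos \<theta>"

definition tV :: "bstate \<Rightarrow> real" where
  "tV S = vdir S * (ext b (row S) (vdir S) - yc S) / sin \<theta>"

definition dt :: "bstate \<Rightarrow> real" where
  "dt S = min (tH S) (tV S)"

text \<open>A free box in an odd row has obstacles as its two neighbours in that row, and likewise
  for columns; so the parity of the other index decides between reflection and passage.\<close>

definition nxt :: "bstate \<Rightarrow> bstate" where
  "nxt S = (let k = col S; l = row S; e = hdir S; d = vdir S in
     if tH S < tV S
     then (if odd l then BS k l (- e) d else BS (k + e) l e d) (ext a k e) (yc S + d * sin \<theta> * tH S)
     else (if odd k then BS k l e (- d) else BS k (l + d) e d) (xc S + e * cos \<theta> * tV S) (ext b l d))"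

definition inv :: "bstate \<Rightarrow> bool" where
  "inv S \<longleftrightarrow> (even (col S) \<or> even (row S)) \<and> \<bar>hdir S\<bar> = 1 \<and> \<bar>vdir S\<bar> = 1 \<and>
     in_span a (col S) (hdir S) (xc S) \<and> in_span b (row S) (vdir S) (yc S)"

definition pos :: "bstate \<Rightarrow> real \<times> real" where
  "pos S = (xc S, yc S)"

definition vel :: "bstate \<Rightarrow> real \<times> real" where
  "vel S = (hdir S * cos \<theta>, vdir S * sin \<theta>)"

lemma dt_pos: "inv S \<Longrightarrow> 0 < dt S"
  using cos sin unfolding inv_def in_span_def dt_def tH_def tV_def by simp

lemma in_span_advance:
  assumes "in_span c k e x" "\<bar>e\<bar> = 1" "0 \<le> s" "s < e * (ext c k e - x)"
  shows "in_span c k e (x + e * s)"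
  using assms unit_cases[of e] unfolding in_span_def by auto

lemma inv_nxt:
  assumes S: "inv S" and ns: "tH S \<noteq> tV S"
  shows "inv (nxt S)"
proof -
  obtain k l e d x y where BS: "S = BS k l e d x y" by (cases S)
  have i: "even k \<or> even l" "\<bar>e\<bar> = 1" "\<bar>d\<bar> = 1" "in_span a k e x" "in_span b l d y"
    using S unfolding inv_def BS by auto
  have t: "0 < tH S" "0 < tV S" using dt_pos[OF S] unfolding dt_def by auto
  show ?thesis
  proof (cases "tH S < tV S")
    case True
    have "sin \<theta> * tH S < d * (ext b l d - y)"
      using True sin unfolding tV_def BS by (simp add: field_simps)
    then have y: "in_span b l d (y + d * (sin \<theta> * tH S))"
      using in_span_advance[OF i(5,3)] t sin by simp
    have "in_span a k (- e) (ext a k e)" "in_span a (k + e) e (ext a k e)"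
      using in_span_new(1)[of "- e" k] in_span_new(1)[of e "k + e"] ent_reflect[of e a k] ent_cross[of e a k] i by auto
    then show ?thesis using i y True unfolding nxt_def inv_def BS by (auto simp: Let_def mult.assoc)
  next
    case False
    with ns have "tV S < tH S" by simp
    then have "cos \<theta> * tV S < e * (ext a k e - x)"
      using cos unfolding tH_def BS by (simp add: field_simps)
    then have x: "in_span a k e (x + e * (cos \<theta> * tV S))"
      using in_span_advance[OF i(4,2)] t cos by simp
    have "in_span b l (- d) (ext b l d)" "in_span b (l + d) d (ext b l d)"
      using in_span_new(2)[of "- d" l] in_span_new(2)[of d "l + d"] ent_reflect[of d b l] ent_cross[of d b l] i by auto
    then show ?thesis using i x False unfolding nxt_def inv_def BS by (auto simp: Let_def mult.assoc)
  qed
qed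

lemma nxt_pos:
  "tH S \<noteq> tV S \<Longrightarrow> inv S \<Longrightarrow> pos (nxt S) = pos S + dt S *\<^sub>R vel S"
proof -
  assume ns: "tH S \<noteq> tV S" and S: "inv S"
  obtain k l e d x y where BS: "S = BS k l e d x y" by (cases S)
  have "e = 1 \<or> e = -1" "d = 1 \<or> d = -1" using S unit_cases unfolding inv_def BS by auto
  then show ?thesis
    using cos sin ns unfolding nxt_def pos_def vel_def dt_def BS
    by (auto simp: Let_def tH_def tV_def min_def field_simps)
qed

lemma edge_between: "edge c k < x \<Longrightarrow> x < edge c (k + 1) \<Longrightarrow> 0 < c \<Longrightarrow> c < 1 \<Longrightarrow> x \<noteq> edge c j"
  using edge_less_iff[of c k j] edge_less_iff[of c j "k + 1"] by auto

lemma edge_box_unique: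
  assumes "edge c k \<le> x" "x < edge c (k + 1)" "edge c j \<le> x" "x < edge c (j + 1)" "0 < c" "c < 1"
  shows "j = k"
proof -
  have "edge c k < edge c (j + 1)" "edge c j < edge c (k + 1)" using assms by linarith+
  then show ?thesis using edge_less_iff assms by simp
qed

lemma interior_point:
  assumes "edge a k < x" "x < edge a (k + 1)" "edge b l < y" "y < edge b (l + 1)" "even k \<or> even l"
  shows "(x, y) \<in> table a b - corners a b - vertical_sides a b - horizontal_sides a b"
proof -
  have "(x, y) \<in> table a b"
    unfolding table_edge using edge_box_unique[of a k x] edge_box_unique[of b l y] assms a b
    by (metis less_imp_le)
  then show ?thesis
    using edge_between[OF assms(1,2) a] edge_between[OF assms(3,4) b] a b
    by (auto simp: corners_edge vertical_sides_edge horizontal_sides_edge)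
qed

lemma vertical_point:
  assumes "edge b l < y" "y < edge b (l + 1)"
  shows "(edge a k, y) \<in> table a b - corners a b - horizontal_sides a b"
    "(edge a k, y) \<in> vertical_sides a b \<longleftrightarrow> odd l"
proof -
  show "(edge a k, y) \<in> table a b - corners a b - horizontal_sides a b"
    using edge_between[OF assms b] edge_between[of a _ "edge a k" k] a b
    by (auto simp: table_edge corners_edge horizontal_sides_edge)
  show "(edge a k, y) \<in> vertical_sides a b \<longleftrightarrow> odd l"
    using assms edge_box_unique[of b l y] a b unfolding vertical_sides_edge[OF a(1)]
    by (metis less_imp_le)
qed

lemma horizontal_point:
  assumes "edge a k < x" "x < edge a (k + 1)"
  shows "(x, edge b l) \<in> table a b - corners a b - vertical_sides a b"
    "(x, edge b l) \<in> horizontal_sides a b \<longleftrightarrow> odd k"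
proof -
  show "(x, edge b l) \<in> table a b - corners a b - vertical_sides a b"
    using edge_between[OF assms a] edge_between[of b _ "edge b l" l] a b
    by (auto simp: table_edge corners_edge vertical_sides_edge)
  show "(x, edge b l) \<in> horizontal_sides a b \<longleftrightarrow> odd k"
    using assms edge_box_unique[of a k x] a b unfolding horizontal_sides_edge[OF b(1)]
    by (metis less_imp_le)
qed

lemma strictly_in_span:
  assumes "in_span c k e x" "\<bar>e\<bar> = 1" "0 < s" "s < e * (ext c k e - x)"
  shows "edge c k < x + e * s" "x + e * s < edge c (k + 1)"
  using assms unit_cases[of e] unfolding in_span_def ext_def ent_def by auto

lemma inside:
  assumes S: "inv S" and s: "0 < s" "s < dt S"
  shows "pos S + s *\<^sub>R vel S \<in> table a b - corners a b - vertical_sides a b - horizontal_sides a b"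
proof -
  obtain k l e d x y where BS: "S = BS k l e d x y" by (cases S)
  have i: "even k \<or> even l" "\<bar>e\<bar> = 1" "\<bar>d\<bar> = 1" "in_span a k e x" "in_span b l d y"
    using S unfolding inv_def BS by auto
  have "s < tH S" "s < tV S" using s unfolding dt_def by auto
  then have "cos \<theta> * s < e * (ext a k e - x)" "sin \<theta> * s < d * (ext b l d - y)"
    using cos sin unfolding tH_def tV_def BS by (simp_all add: field_simps)
  moreover have "0 < cos \<theta> * s" "0 < sin \<theta> * s" using s cos sin by auto
  ultimately have "(x + e * (cos \<theta> * s), y + d * (sin \<theta> * s))
      \<in> table a b - corners a b - vertical_sides a b - horizontal_sides a b"
    using interior_point strictly_in_span i by blast
  then show ?thesis unfolding pos_def vel_def BS by (simp add: algebra_simps)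
qed

lemma at_event:
  assumes S: "inv S" and ns: "tH S \<noteq> tV S"
  shows "pos (nxt S) \<in> table a b - corners a b" "reflect a b (pos (nxt S)) (vel S) = vel (nxt S)"
proof -
  obtain k l e d x y where BS: "S = BS k l e d x y" by (cases S)
  have i: "even k \<or> even l" "\<bar>e\<bar> = 1" "\<bar>d\<bar> = 1" "in_span a k e x" "in_span b l d y"
    using S unfolding inv_def BS by auto
  have t: "0 < tH S" "0 < tV S" using dt_pos[OF S] unfolding dt_def by auto
  have "pos (nxt S) \<in> table a b - corners a b \<and> reflect a b (pos (nxt S)) (vel S) = vel (nxt S)"
  proof (cases "tH S < tV S")
    case True
    have "sin \<theta> * tH S < d * (ext b l d - y)"
      using True sin unfolding tV_def BS by (simp add: field_simps)
    moreover have "0 < sin \<theta> * tH S" using t sin by simp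
    ultimately have y: "edge b l < y + d * (sin \<theta> * tH S)" "y + d * (sin \<theta> * tH S) < edge b (l + 1)"
      using strictly_in_span i by blast+
    have p: "pos (nxt S) = (edge a (if e = 1 then k + 1 else k), y + d * (sin \<theta> * tH S))"
      using True unfolding nxt_def pos_def BS by (auto simp: Let_def ext_def mult.assoc)
    have v: "vel (nxt S) = (if odd l then (- fst (vel S), snd (vel S)) else vel S)"
      using True unfolding nxt_def vel_def BS by (auto simp: Let_def)
    show ?thesis unfolding p v reflect_def using vertical_point[OF y] by simp
  next
    case False
    with ns have "tV S < tH S" by simp
    then have "cos \<theta> * tV S < e * (ext a k e - x)"
      using cos unfolding tH_def BS by (simp add: field_simps)
    moreover have "0 < cos \<theta> * tV S" using t cos by simp
    ultimately have x: "edge a k < x + e * (cos \<theta> * tV S)" "x + e * (cos \<theta> * tV S) < edge a (k + 1)"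
      using strictly_in_span i by blast+
    have p: "pos (nxt S) = (x + e * (cos \<theta> * tV S), edge b (if d = 1 then l + 1 else l))"
      using False unfolding nxt_def pos_def BS by (auto simp: Let_def ext_def mult.assoc)
    have v: "vel (nxt S) = (if odd k then (fst (vel S), - snd (vel S)) else vel S)"
      using False unfolding nxt_def vel_def BS by (auto simp: Let_def)
    show ?thesis unfolding p v reflect_def using horizontal_point[OF x] by simp
  qed
  then show "pos (nxt S) \<in> table a b - corners a b" "reflect a b (pos (nxt S)) (vel S) = vel (nxt S)"
    by auto
qed

lemma singular_corner:
  assumes S: "inv S" and "tH S = tV S"
  shows "pos S + dt S *\<^sub>R vel S \<in> corners a b"
proof -
  obtain k l e d x y where BS: "S = BS k l e d x y" by (cases S)
  have i: "e = 1 \<or> e = -1" "d = 1 \<or> d = -1" using S unit_cases unfolding inv_def BS by auto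
  have "pos S + dt S *\<^sub>R vel S = (x + e * cos \<theta> * tH S, y + d * sin \<theta> * tV S)"
    using assms(2) unfolding pos_def vel_def dt_def BS by simp
  also have "\<dots> = (ext a k e, ext b l d)"
    using i cos sin unfolding tH_def tV_def BS by (auto simp: field_simps)
  finally show ?thesis using a b by (auto simp: corners_edge ext_def)
qed

section \<open>Motions along the sequence of boxes\<close>

definition initial :: "real \<times> real \<Rightarrow> bstate \<Rightarrow> bool" where
  "initial p S \<longleftrightarrow> inv S \<and> pos S = p \<and>
     (vel S = (cos \<theta>, sin \<theta>) \<or> vel S = reflect a b p (cos \<theta>, sin \<theta>))"

text \<open>A point whose half-open box is an obstacle lies on the left or the lower side of it. The
  direction points into the obstacle, so the state is the neighbouring box with one sign
  reversed.\<close>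

lemma initial_exists:
  assumes p: "p \<in> table a b - corners a b"
  shows "\<exists>S. initial p S"
proof -
  obtain x y where P: "p = (x, y)" by (cases p)
  obtain k where k: "edge a k \<le> x" "x < edge a (k + 1)" using edge_cover[OF a] by blast
  obtain l where l: "edge b l \<le> y" "y < edge b (l + 1)" using edge_cover[OF b] by blast
  have wx: "in_span a k 1 x" and wy: "in_span b l 1 y" using k l by (auto simp: in_span_def ent_def ext_def)
  consider "even k \<or> even l" | "odd k" "odd l" by blast
  then show ?thesis
  proof cases
    case 1
    then have "initial p (BS k l 1 1 x y)"
      using wx wy unfolding initial_def inv_def pos_def vel_def P by simp
    then show ?thesis by blast
  next
    case 2
    have "x = edge a k \<or> y = edge b l"
    proof (rule ccontr)
      assume "\<not> ?thesis"
      then have "edge a k < x" "edge b l < y" using k l by auto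
      then show False using p 2 k l unfolding P Diff_iff table_edge by blast
    qed
    moreover have "\<not> (x = edge a k \<and> y = edge b l)" using p a b unfolding P by (auto simp: corners_edge)
    ultimately consider "x = edge a k" "edge b l < y" | "y = edge b l" "edge a k < x" using k l by fastforce
    then show ?thesis
    proof cases
      case 1
      have "in_span a (k - 1) (- 1) x"
        using in_span_new(1)[of "- 1" "k - 1"] 1 by (simp add: ent_def)
      moreover have "reflect a b p (cos \<theta>, sin \<theta>) = (- cos \<theta>, sin \<theta>)"
        using vertical_point(2)[OF 1(2) l(2)] 1 2 unfolding P reflect_def by simp
      ultimately have "initial p (BS (k - 1) l (- 1) 1 x y)"
        using wy 2 unfolding initial_def inv_def pos_def vel_def P by simp
      then show ?thesis by blast
    next
      case c: 2
      have "in_span b (l - 1) (- 1) y"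
        using in_span_new(2)[of "- 1" "l - 1"] c by (simp add: ent_def)
      moreover have "reflect a b p (cos \<theta>, sin \<theta>) = (cos \<theta>, - sin \<theta>)"
        using horizontal_point[OF c(2) k(2)] c 2 unfolding P reflect_def by simp
      ultimately have "initial p (BS k (l - 1) 1 (- 1) x y)"
        using wx 2 unfolding initial_def inv_def pos_def vel_def P by simp
      then show ?thesis by blast
    qed
  qed
qed

definition st :: "bstate \<Rightarrow> nat \<Rightarrow> bstate" where
  "st S n = (nxt ^^ n) S"

definition tm :: "bstate \<Rightarrow> nat \<Rightarrow> real" where
  "tm S n = (\<Sum>k<n. dt (st S k))"

definition regular :: "bstate \<Rightarrow> bool" where
  "regular S \<longleftrightarrow> tH S \<noteq> tV S"

lemma st_0 [simp]: "st S 0 = S" and st_Suc: "st S (Suc n) = nxt (st S n)"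
  by (simp_all add: st_def)

lemma tm_0 [simp]: "tm S 0 = 0" and tm_Suc: "tm S (Suc n) = tm S n + dt (st S n)"
  by (simp_all add: tm_def)

lemma inv_st: "inv S \<Longrightarrow> (\<And>k. k < n \<Longrightarrow> regular (st S k)) \<Longrightarrow> inv (st S n)"
  by (induction n) (auto simp: st_Suc regular_def intro: inv_nxt)

lemma tm_mono:
  assumes "inv S" "\<And>k. k < n \<Longrightarrow> regular (st S k)" "i \<le> j" "j \<le> n"
  shows "tm S i \<le> tm S j"
  using assms(3,4)
proof (induction j rule: dec_induct)
  case (step j)
  then have "0 < dt (st S j)" using inv_st[OF assms(1), of j] assms(2) by (intro dt_pos) auto
  then show ?case using step by (simp add: tm_Suc)
qed simp

lemma sequence_motion:
  assumes p: "p \<in> table a b - corners a b" and S: "initial p S"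
    and r: "\<And>k. k < n \<Longrightarrow> regular (st S k)"
  shows "\<exists>\<gamma> v. billiard_motion a b \<theta> p (tm S n) \<gamma> v \<and> \<gamma> (tm S n) = pos (st S n) \<and>
     v (tm S n) = vel (st S n) \<and> v 0 = vel S \<and>
     (\<forall>k<n. \<forall>t. tm S k \<le> t \<and> t \<le> tm S (Suc k) \<longrightarrow>
        \<gamma> t = pos (st S k) + (t - tm S k) *\<^sub>R vel (st S k))"
  using r
proof (induction n)
  case 0
  have "billiard_motion a b \<theta> p 0 (\<lambda>_. p) (\<lambda>_. vel S)"
    using motion_const[OF p] S unfolding initial_def by blast
  moreover have "pos S = p" using S unfolding initial_def by simp
  ultimately show ?case by (intro exI[of _ "\<lambda>_. p"] exI[of _ "\<lambda>_. vel S"]) simp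
next
  case (Suc n)
  have inv0: "inv S" using S unfolding initial_def by simp
  let ?T = "tm S n" and ?S = "st S n"
  have i: "inv ?S" using inv_st[OF inv0] Suc.prems by simp
  have reg: "tH ?S \<noteq> tV ?S" using Suc.prems[of n] unfolding regular_def by simp
  have T: "0 \<le> ?T" using tm_mono[OF inv0, of n 0 n] Suc.prems by simp
  obtain \<gamma> v where m: "billiard_motion a b \<theta> p ?T \<gamma> v" and g: "\<gamma> ?T = pos ?S" "v ?T = vel ?S"
     "v 0 = vel S" and seg: "\<And>k t. k < n \<Longrightarrow> tm S k \<le> t \<Longrightarrow> t \<le> tm S (Suc k) \<Longrightarrow>
        \<gamma> t = pos (st S k) + (t - tm S k) *\<^sub>R vel (st S k)"
    using Suc.IH Suc.prems by (metis less_SucI)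
  define \<gamma>' where "\<gamma>' = (\<lambda>t. if t \<le> ?T then \<gamma> t else \<gamma> ?T + (t - ?T) *\<^sub>R v ?T)"
  define v' where "v' = (\<lambda>t. if t \<le> ?T then v t else if t < ?T + dt ?S then v ?T
                     else reflect a b (\<gamma> ?T + dt ?S *\<^sub>R v ?T) (v ?T))"
  have d: "0 < dt ?S" by (rule dt_pos[OF i])
  have fin: "\<gamma> ?T + dt ?S *\<^sub>R v ?T = pos (nxt ?S)" unfolding g nxt_pos[OF reg i] ..
  have "billiard_motion a b \<theta> p (?T + dt ?S) \<gamma>' v'"
    using motion_extend[OF m T d _ _ \<gamma>'_def v'_def] inside[OF i] at_event(1)[OF i reg] fin g by simp
  moreover have "\<gamma>' (?T + dt ?S) = pos (nxt ?S)" unfolding \<gamma>'_def using d fin by simp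
  moreover have "v' (?T + dt ?S) = vel (nxt ?S)"
    unfolding v'_def fin using d at_event(2)[OF i reg] g by simp
  moreover have "v' 0 = vel S" using T g unfolding v'_def by simp
  moreover have "\<gamma>' t = pos (st S k) + (t - tm S k) *\<^sub>R vel (st S k)"
    if "k < Suc n" "tm S k \<le> t" "t \<le> tm S (Suc k)" for k t
  proof (cases "k = n")
    case True
    then show ?thesis using that g unfolding \<gamma>'_def by auto
  next
    case False
    then have k: "k < n" using that by simp
    then have "tm S (Suc k) \<le> ?T" using tm_mono[OF inv0, of n "Suc k" n] Suc.prems by simp
    then show ?thesis using seg[OF k that(2,3)] that unfolding \<gamma>'_def by simp
  qed
  ultimately show ?case unfolding tm_Suc st_Suc by blast
qed

text \<open>Lines with even index carry right sides of obstacles and odd ones left sides; the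
  half-open convention of \<open>in_span\<close> makes the motion point away from the
  obstacle.\<close>

lemma vertical_direction:
  assumes S: "inv S" and p: "pos S = (edge a j, y)" and y: "edge b l < y" "y < edge b (l + 1)" and "odd l"
  shows "hdir S = (if even j then 1 else - 1)"
proof -
  obtain k l' e d x y' where BS: "S = BS k l' e d x y'" by (cases S)
  have i: "even k \<or> even l'" "e = 1 \<or> e = -1" "d = 1 \<or> d = -1" "in_span a k e (edge a j)" "in_span b l' d y"
    using S p unit_cases unfolding inv_def BS pos_def by auto
  have "edge b l' < edge b (l + 1)" "edge b l < edge b (l' + 1)"
    using i(3,5) y unfolding in_span_def ent_def ext_def by auto
  then have "l' = l" using edge_less_iff[OF b] by simp
  then have "even k" using i assms by auto
  show ?thesis
  proof (cases "e = 1")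
    case True
    then have "k \<le> j" "j < k + 1" using i(4) edge_le_iff[OF a] edge_less_iff[OF a]
      unfolding in_span_def ent_def ext_def by auto
    then show ?thesis using True \<open>even k\<close> BS by auto
  next
    case False
    then have "k < j" "j \<le> k + 1" using i(2,4) edge_le_iff[OF a] edge_less_iff[OF a]
      unfolding in_span_def ent_def ext_def by auto
    then have "j = k + 1" by simp
    then show ?thesis using False i(2) \<open>even k\<close> BS by auto
  qed
qed

lemma horizontal_direction:
  assumes S: "inv S" and p: "pos S = (x, edge b j)" and x: "edge a k < x" "x < edge a (k + 1)" and "odd k"
  shows "vdir S = (if even j then 1 else - 1)"
proof -
  obtain k' l e d x' y where BS: "S = BS k' l e d x' y" by (cases S)
  have i: "even k' \<or> even l" "e = 1 \<or> e = -1" "d = 1 \<or> d = -1" "in_span a k' e x" "in_span b l d (edge b j)"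
    using S p unit_cases unfolding inv_def BS pos_def by auto
  have "edge a k' < edge a (k + 1)" "edge a k < edge a (k' + 1)"
    using i(2,4) x unfolding in_span_def ent_def ext_def by auto
  then have "k' = k" using edge_less_iff[OF a] by simp
  then have "even l" using i assms by auto
  show ?thesis
  proof (cases "d = 1")
    case True
    then have "l \<le> j" "j < l + 1" using i(5) edge_le_iff[OF b] edge_less_iff[OF b]
      unfolding in_span_def ent_def ext_def by auto
    then show ?thesis using True \<open>even l\<close> BS by auto
  next
    case False
    then have "l < j" "j \<le> l + 1" using i(3,5) edge_le_iff[OF b] edge_less_iff[OF b]
      unfolding in_span_def ent_def ext_def by auto
    then have "j = l + 1" by simp
    then show ?thesis using False i(3) \<open>even l\<close> BS by auto
  qed
qed

text \<open>A motion cannot start into an obstacle; this removes the ambiguity of the initial velocity.\<close>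

lemma motion_leaves:
  assumes m: "billiard_motion a b \<theta> (x, y) T \<gamma> v" and T: "0 < T" and v: "v 0 = (u, w)"
    and "odd k" "odd l"
    and x: "edge a k < x \<or> edge a k = x \<and> 0 < u" "x < edge a (k + 1) \<or> edge a (k + 1) = x \<and> u < 0"
    and y: "edge b l < y \<or> edge b l = y \<and> 0 < w" "y < edge b (l + 1) \<or> edge b (l + 1) = y \<and> w < 0"
  shows False
proof -
  have low: "\<forall>\<^sub>F s in at_right 0. c < z + s * q" if "c < z \<or> c = z \<and> 0 < q" for c z q :: real
  proof (cases "c < z")
    case True
    have "((\<lambda>s. z + s * q) \<longlongrightarrow> z + 0 * q) (at_right 0)" by (intro tendsto_intros)
    then show ?thesis using order_tendstoD(1)[of _ "z + 0 * q" _ c] True by simp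
  next
    case False
    with that have *: "c = z" "0 < q" by auto
    show ?thesis using eventually_at_right_less[of "0::real"] by eventually_elim (use * in simp)
  qed
  have up: "\<forall>\<^sub>F s in at_right 0. z + s * q < c" if "z < c \<or> c = z \<and> q < 0" for c z q :: real
  proof -
    have "\<forall>\<^sub>F s in at_right 0. - c < - z + s * - q" using low[of "- c" "- z" "- q"] that by auto
    then show ?thesis by eventually_elim simp
  qed
  obtain \<epsilon> where e: "\<epsilon> > 0" "\<epsilon> \<le> T"
    "\<And>s. 0 \<le> s \<Longrightarrow> s < 0 + \<epsilon> \<Longrightarrow> \<gamma> s = \<gamma> 0 + (s - 0) *\<^sub>R v 0 \<and> v s = v 0"
    using motion_forward[OF m order_refl T] by (metis add_0)
  have "\<forall>\<^sub>F s in at_right 0. 0 < s \<and> s < \<epsilon>"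
    using eventually_at_right_less[of "0::real"] e(1) by (auto simp: eventually_at_right_field)
  moreover note low[OF x(1)] up[OF x(2)] low[OF y(1)] up[OF y(2)]
  ultimately have "\<forall>\<^sub>F s in at_right (0::real). False"
  proof eventually_elim
    case (elim s)
    have "\<gamma> 0 = (x, y)" using m unfolding billiard_motion_def by simp
    then have "\<gamma> s = (x + s * u, y + s * w)" using e(3)[of s] elim v by simp
    moreover have "\<gamma> s \<in> table a b" using m elim e(2) unfolding billiard_motion_def by simp
    ultimately show False using elim \<open>odd k\<close> \<open>odd l\<close> by (auto simp: table_edge)
  qed
  then show False by simp
qed

lemma initial_velocity:
  assumes S: "initial p S" and m: "billiard_motion a b \<theta> p T \<gamma> v" and T: "0 < T"
  shows "v 0 = vel S"
proof -
  obtain x y where P: "p = (x, y)" by (cases p)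
  have i: "inv S" "pos S = (x, y)" and vS: "vel S = (cos \<theta>, sin \<theta>) \<or> vel S = reflect a b p (cos \<theta>, sin \<theta>)"
    using S unfolding initial_def P by auto
  have v0: "v 0 = (cos \<theta>, sin \<theta>) \<or> v 0 = reflect a b p (cos \<theta>, sin \<theta>)"
    using m unfolding billiard_motion_def by simp
  show ?thesis
  proof (cases "p \<in> vertical_sides a b")
    case True
    then obtain j l where jl: "odd l" "x = edge a j" "edge b l < y" "y < edge b (l + 1)"
      unfolding P vertical_sides_edge[OF a(1)] by blast
    have h: "hdir S = (if even j then 1 else - 1)" using vertical_direction[OF i(1)] i(2) jl by simp
    have vs: "vel S = (cos \<theta>, sin \<theta>) \<or> vel S = (- cos \<theta>, sin \<theta>)"
       "v 0 = (cos \<theta>, sin \<theta>) \<or> v 0 = (- cos \<theta>, sin \<theta>)"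
      using vS v0 True unfolding reflect_def by auto
    have S': "vel S = (if even j then cos \<theta> else - cos \<theta>, sin \<theta>)"
      using vs(1) h cos unfolding vel_def by auto
    have "v 0 \<noteq> (if even j then - cos \<theta> else cos \<theta>, sin \<theta>)"
    proof
      assume v: "v 0 = (if even j then - cos \<theta> else cos \<theta>, sin \<theta>)"
      \<comment> \<open>The obstacle at the line \<open>j\<close> occupies the odd one of the
        columns \<open>j - 1\<close> and \<open>j\<close>.\<close>
      have "edge a (j - 1) < edge a j" "edge a j < edge a (j + 1)" using edge_less[OF a] by auto
      then show False
        by (intro motion_leaves[OF m[unfolded P] T v, of "if even j then j - 1 else j" l])
          (use jl cos in auto)
    qed
    then show ?thesis using vs(2) S' by (auto split: if_splits)
  next
    case nv: False
    show ?thesis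
    proof (cases "p \<in> horizontal_sides a b")
      case True
      then obtain k j where jl: "odd k" "edge a k < x" "x < edge a (k + 1)" "y = edge b j"
        unfolding P horizontal_sides_edge[OF b(1)] by blast
      have h: "vdir S = (if even j then 1 else - 1)" using horizontal_direction[OF i(1)] i(2) jl by simp
      have vs: "vel S = (cos \<theta>, sin \<theta>) \<or> vel S = (cos \<theta>, - sin \<theta>)"
         "v 0 = (cos \<theta>, sin \<theta>) \<or> v 0 = (cos \<theta>, - sin \<theta>)"
        using vS v0 True nv unfolding reflect_def by auto
      have S': "vel S = (cos \<theta>, if even j then sin \<theta> else - sin \<theta>)"
        using vs(1) h sin unfolding vel_def by auto
      have "v 0 \<noteq> (cos \<theta>, if even j then - sin \<theta> else sin \<theta>)"
      proof
        assume v: "v 0 = (cos \<theta>, if even j then - sin \<theta> else sin \<theta>)"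
        have "edge b (j - 1) < edge b j" "edge b j < edge b (j + 1)" using edge_less[OF b] by auto
        then show False
          by (intro motion_leaves[OF m[unfolded P] T v, of k "if even j then j - 1 else j"])
            (use jl sin in auto)
      qed
      then show ?thesis using vs(2) S' by (auto split: if_splits)
    next
      case False
      then show ?thesis using vS v0 nv unfolding reflect_def by auto
    qed
  qed
qed

text \<open>Every event resets one of the two terms to \<open>0\<close> after it has reached a full side length; hence the
  events do not accumulate.\<close>

definition prog :: "bstate \<Rightarrow> real" where
  "prog S = hdir S * (xc S - ent a (col S) (hdir S)) + vdir S * (yc S - ent b (row S) (vdir S))"

definition gap :: real where
  "gap = min (min a (1 - a)) (min b (1 - b))"

lemma prog_nxt:
  assumes S: "inv S" and "regular S"
  shows "prog (nxt S) + gap \<le> prog S + (cos \<theta> + sin \<theta>) * dt S"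
proof -
  obtain k l e d x y where BS: "S = BS k l e d x y" by (cases S)
  have i: "\<bar>e\<bar> = 1" "\<bar>d\<bar> = 1" using S unfolding inv_def BS by auto
  then have ed: "e = 1 \<or> e = -1" "d = 1 \<or> d = -1" using unit_cases by auto
  have g: "gap \<le> len a k" "gap \<le> len b l" using a b unfolding gap_def len_eq by auto
  show ?thesis
  proof (cases "tH S < tV S")
    case True
    have "cos \<theta> * tH S = e * (ext a k e - x)" using cos unfolding tH_def BS by simp
    then show ?thesis
      using True ed g(1) ext_ent[of e a k] ent_reflect[of e a k] ent_cross[of e a k] i
      unfolding prog_def nxt_def dt_def BS by (auto simp: Let_def algebra_simps)
  next
    case False
    have "sin \<theta> * tV S = d * (ext b l d - y)" using sin unfolding tV_def BS by simp
    then show ?thesis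
      using False ed g(2) ext_ent[of d b l] ent_reflect[of d b l] ent_cross[of d b l] i
      unfolding prog_def nxt_def dt_def BS by (auto simp: Let_def algebra_simps min_def)
  qed
qed

text \<open>Each event costs \<open>gap\<close> of progress, which only elapsed time can supply; as
  \<open>prog\<close> stays nonnegative, the time of the \<open>n\<close>-th event grows at least
  linearly.\<close>

lemma tm_unbounded:
  assumes "inv S" "\<And>k. regular (st S k)"
  shows "\<exists>n. T < tm S n"
proof -
  have inv: "inv (st S n)" for n using inv_st assms by blast
  have "prog (st S n) + n * gap \<le> prog S + (cos \<theta> + sin \<theta>) * tm S n" for n
  proof (induction n)
    case (Suc n)
    then show ?case using prog_nxt[OF inv assms(2), of n] by (simp add: st_Suc tm_Suc algebra_simps)
  qed simp
  moreover have "0 \<le> prog (st S n)" for n using inv[of n] unfolding inv_def in_span_def prog_def by simp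
  ultimately have *: "n * gap \<le> prog S + (cos \<theta> + sin \<theta>) * tm S n" for n :: nat
    by (meson add_increasing2 add_le_cancel_right dual_order.trans le_add_same_cancel2)
  have gap: "0 < gap" using a b unfolding gap_def by simp
  obtain n :: nat where "prog S + (cos \<theta> + sin \<theta>) * T < n * gap"
    using reals_Archimedean3[OF gap] by blast
  then have "(cos \<theta> + sin \<theta>) * T < (cos \<theta> + sin \<theta>) * tm S n" using *[of n] by linarith
  then have "T < tm S n" using cos sin by (simp add: mult_less_cancel_left_pos)
  then show ?thesis by blast
qed

lemma tm_interval:
  assumes "inv S" "\<And>k. regular (st S k)" "0 \<le> t"
  shows "\<exists>n. tm S n \<le> t \<and> t < tm S (Suc n)"
proof -
  obtain N where "t < tm S N" using tm_unbounded assms by blast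
  define n where "n = (LEAST n. t < tm S n)"
  have n: "t < tm S n" unfolding n_def by (rule LeastI) fact
  have "n \<noteq> 0"
  proof
    assume "n = 0"
    then show False using n assms(3) by simp
  qed
  then obtain m where m: "n = Suc m" by (cases n) auto
  have "\<not> t < tm S m" using not_less_Least[of m "\<lambda>n. t < tm S n"] m unfolding n_def by simp
  then show ?thesis using n m by (intro exI[of _ m]) auto
qed

section \<open>The flow along the sequence of boxes\<close>

lemma position_unique:
  assumes S: "initial p S" and m: "billiard_motion a b \<theta> p T \<gamma> v" "v 0 = vel S" "0 \<le> T"
    and q: "position_at a b \<theta> t p q" and t: "0 \<le> t" "t \<le> T"
  shows "q = \<gamma> t"
proof -
  obtain \<gamma>' v' where m': "billiard_motion a b \<theta> p t \<gamma>' v'" "\<gamma>' t = q"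
    using q unfolding position_at_def by blast
  show ?thesis
  proof (cases "t = 0")
    case True
    then show ?thesis using m(1) m' unfolding billiard_motion_def by auto
  next
    case False
    then have "v' 0 = vel S" using initial_velocity[OF S m'(1)] t by simp
    then show ?thesis using motion_unique[OF m'(1) motion_restrict[OF m(1) t]] m m' t by simp
  qed
qed

text \<open>The time intervals are closed so that an event time can also be counted to the visit
  that it ends.\<close>

lemma flow_formula:
  assumes p: "p \<in> table a b - corners a b" and S: "initial p S" and r: "\<And>k. regular (st S k)"
  shows "infinite_trajectory a b \<theta> p"
    and "tm S k \<le> t \<Longrightarrow> t \<le> tm S (Suc k) \<Longrightarrow> flow a b \<theta> t p = pos (st S k) + (t - tm S k) *\<^sub>R vel (st S k)"
proof -
  have inv: "inv S" using S unfolding initial_def by simp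
  have nonneg: "0 \<le> tm S n" for n using tm_mono[OF inv r, of 0 n n] by simp
  show "infinite_trajectory a b \<theta> p" unfolding infinite_trajectory_def
  proof (intro allI impI)
    fix t :: real assume t: "0 \<le> t"
    obtain n where n: "t < tm S n" using tm_unbounded[OF inv r] by blast
    from sequence_motion[OF p S r] obtain \<gamma> v where "billiard_motion a b \<theta> p (tm S n) \<gamma> v" by metis
    then have "billiard_motion a b \<theta> p t \<gamma> v" by (rule motion_restrict) (use t n in auto)
    then show "\<exists>q. position_at a b \<theta> t p q" unfolding position_at_def by blast
  qed
  assume t: "tm S k \<le> t" "t \<le> tm S (Suc k)"
  have t0: "0 \<le> t" using t nonneg[of k] by simp
  obtain \<gamma> v where m: "billiard_motion a b \<theta> p (tm S (Suc k)) \<gamma> v" "v 0 = vel S"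
      and seg: "\<forall>i<Suc k. \<forall>t. tm S i \<le> t \<and> t \<le> tm S (Suc i) \<longrightarrow>
        \<gamma> t = pos (st S i) + (t - tm S i) *\<^sub>R vel (st S i)"
    using sequence_motion[OF p S r, of "Suc k"] by blast
  have g: "\<gamma> t = pos (st S k) + (t - tm S k) *\<^sub>R vel (st S k)"
    using seg[rule_format, of k t] t by simp
  have "flow a b \<theta> t p = \<gamma> t" unfolding flow_def
  proof (rule the_equality)
    show "position_at a b \<theta> t p (\<gamma> t)"
      unfolding position_at_def using motion_restrict[OF m(1) t0 t(2)] by blast
    show "q = \<gamma> t" if "position_at a b \<theta> t p q" for q
      by (rule position_unique[OF S m nonneg that t0 t(2)])
  qed
  then show "flow a b \<theta> t p = pos (st S k) + (t - tm S k) *\<^sub>R vel (st S k)" using g by simp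
qed

text \<open>The first tie of exit times would be a corner. Before it, uniqueness identifies every
  motion with the constructed one; at it, the condition to the left forces the motion into the
  corner.\<close>

lemma infinite_regular:
  assumes inf: "infinite_trajectory a b \<theta> p" and S: "initial p S"
  shows "p \<in> table a b - corners a b" "regular (st S k)"
proof -
  have motion: "\<exists>\<gamma> v. billiard_motion a b \<theta> p T \<gamma> v" if "0 \<le> T" for T
    using inf that unfolding infinite_trajectory_def position_at_def by blast
  show p: "p \<in> table a b - corners a b" using motion[of 0] unfolding billiard_motion_def by auto
  have inv0: "inv S" using S unfolding initial_def by simp
  show "regular (st S k)"
  proof (induction k rule: less_induct)
    case (less n)
    show ?case
    proof (rule ccontr)
      assume sing: "\<not> regular (st S n)"
      let ?S = "st S n" and ?t = "tm S n"
      have i: "inv ?S" using inv_st[OF inv0] less by blast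
      have d: "0 < dt ?S" by (rule dt_pos[OF i])
      have T: "0 \<le> ?t" using tm_mono[OF inv0 less, of n 0 n] by simp
      obtain \<gamma> v where m: "billiard_motion a b \<theta> p ?t \<gamma> v" and g: "\<gamma> ?t = pos ?S" "v ?t = vel ?S"
         "v 0 = vel S" using sequence_motion[OF p S less] by blast
      obtain G V where M: "billiard_motion a b \<theta> p (?t + dt ?S) G V" using motion[of "?t + dt ?S"] T d by auto
      have V0: "V 0 = vel S" using initial_velocity[OF S M] T d by simp
      have GV: "G (?t + s) = pos ?S + s *\<^sub>R vel ?S \<and> V (?t + s) = vel ?S" if s: "0 < s" "s < dt ?S" for s
      proof -
        define \<gamma>' where "\<gamma>' = (\<lambda>t. if t \<le> ?t then \<gamma> t else \<gamma> ?t + (t - ?t) *\<^sub>R v ?t)"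
        define v' where "v' = (\<lambda>t. if t \<le> ?t then v t else if t < ?t + s then v ?t
                         else reflect a b (\<gamma> ?t + s *\<^sub>R v ?t) (v ?t))"
        have "billiard_motion a b \<theta> p (?t + s) \<gamma>' v'"
          using motion_extend[OF m T s(1) _ _ \<gamma>'_def v'_def] inside[OF i] s g by simp
        moreover have "billiard_motion a b \<theta> p (?t + s) G V" using motion_restrict[OF M] T s by simp
        moreover have "V 0 = v' 0" unfolding v'_def using V0 g T by simp
        ultimately have "G (?t + s) = \<gamma>' (?t + s) \<and> V (?t + s) = v' (?t + s)"
          using motion_unique[of a b \<theta> p "?t + s" G V \<gamma>' v' "?t + s"] T s by simp
        moreover have "v' (?t + s) = vel ?S"
          unfolding v'_def using inside[OF i s] s g by (simp add: reflect_def)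
        ultimately show ?thesis using s g unfolding \<gamma>'_def by simp
      qed
      obtain e where e: "e > 0" "e \<le> ?t + dt ?S"
        "\<And>s. ?t + dt ?S - e < s \<Longrightarrow> s < ?t + dt ?S \<Longrightarrow>
            G (?t + dt ?S) = G s + (?t + dt ?S - s) *\<^sub>R V s \<and> V (?t + dt ?S) = reflect a b (G (?t + dt ?S)) (V s)"
        using motion_backward[OF M _ order_refl] T d by (metis add_nonneg_pos)
      define s where "s = dt ?S - min e (dt ?S) / 2"
      have s: "0 < s" "s < dt ?S" "?t + dt ?S - e < ?t + s" using e d unfolding s_def by (auto simp: min_def)
      have "G (?t + dt ?S) = G (?t + s) + (dt ?S - s) *\<^sub>R V (?t + s)"
        using e(3)[of "?t + s"] s by (simp add: algebra_simps)
      also have "\<dots> = pos ?S + dt ?S *\<^sub>R vel ?S" using GV[OF s(1,2)] by (simp add: algebra_simps)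
      finally have "G (?t + dt ?S) \<in> corners a b"
        using singular_corner[OF i] sing unfolding regular_def by simp
      moreover have "G (?t + dt ?S) \<notin> corners a b"
        using M T d unfolding billiard_motion_def by auto
      ultimately show False by blast
    qed
  qed
qed

end

section \<open>Coding of trajectories\<close>

context wind_tree
begin

definition quad :: quadruple where
  "quad = ((1 - b) * cos \<theta>, b * cos \<theta>, (1 - a) * sin \<theta>, a * sin \<theta>)"

definition kind :: "int \<Rightarrow> int \<Rightarrow> cell" where
  "kind k l = (if odd k then HArm else if odd l then VArm else Crossing)"

definition lag :: "bstate \<Rightarrow> real" where
  "lag S = sin \<theta> * (hdir S * (xc S - ent a (col S) (hdir S)))
         - cos \<theta> * (vdir S * (yc S - ent b (row S) (vdir S)))"

text \<open>The last letter can be read off the sign of \<open>lag\<close>: after an event at a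
  vertical side the horizontal distance is 0 and \<open>lag\<close> is negative, after one at a
  horizontal side the vertical distance is 0 and \<open>lag\<close> is positive. For a starting
  state this supplies a fictitious letter.\<close>

definition item :: "bstate \<Rightarrow> item" where
  "item S = Item (if 0 \<le> lag S
       then (case kind (col S) (row S) of Crossing \<Rightarrow> Vout | HArm \<Rightarrow> Bt | VArm \<Rightarrow> Vin)
       else (case kind (col S) (row S) of Crossing \<Rightarrow> Hout | HArm \<Rightarrow> Hin | VArm \<Rightarrow> Rh))
     (lag S) (hdir S) (vdir S) (col S) (row S)"

lemma target_item: "target (lt (item S)) = kind (col S) (row S)"
  unfolding item_def by (auto split: cell.split)

lemma width_kind: "even k \<or> even l \<Longrightarrow> width quad (kind k l) = sin \<theta> * len a k"
  by (auto simp: quad_def kind_def len_eq)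

lemma height_kind: "even k \<or> even l \<Longrightarrow> height quad (kind k l) = cos \<theta> * len b l"
  by (auto simp: quad_def kind_def len_eq)

lemma cos_tH: "cos \<theta> * tH S = hdir S * (ext a (col S) (hdir S) - xc S)"
  using cos unfolding tH_def by simp

lemma sin_tV: "sin \<theta> * tV S = vdir S * (ext b (row S) (vdir S) - yc S)"
  using sin unfolding tV_def by simp

lemma adm_item:
  assumes S: "inv S"
  shows "adm quad (item S)"
proof -
  obtain k l e d x y where BS: "S = BS k l e d x y" by (cases S)
  have i: "even k \<or> even l" "\<bar>e\<bar> = 1" "\<bar>d\<bar> = 1" "in_span a k e x" "in_span b l d y"
    using S unfolding inv_def BS by auto
  have u: "0 \<le> e * (x - ent a k e)" "e * (x - ent a k e) \<le> len a k"
    using i(4) ext_ent[OF i(2), of a k] unfolding in_span_def by (auto simp: algebra_simps)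
  have w: "0 \<le> d * (y - ent b l d)" "d * (y - ent b l d) \<le> len b l"
    using i(5) ext_ent[OF i(3), of b l] unfolding in_span_def by (auto simp: algebra_simps)
  have "0 \<le> sin \<theta> * (e * (x - ent a k e))" "sin \<theta> * (e * (x - ent a k e)) \<le> sin \<theta> * len a k"
    "0 \<le> cos \<theta> * (d * (y - ent b l d))" "cos \<theta> * (d * (y - ent b l d)) \<le> cos \<theta> * len b l"
    using u w sin cos by (auto intro: mult_left_mono)
  then have "lag S \<le> sin \<theta> * len a k" "- (cos \<theta> * len b l) \<le> lag S" unfolding lag_def BS by auto
  moreover have "ex (item S) = e" "ey (item S) = d" "co (item S) = lag S" unfolding item_def BS by auto
  moreover have "lt (item S) \<in> {Vin, Vout, Bt} \<longleftrightarrow> 0 \<le> lag S"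
    unfolding item_def by (auto split: cell.split)
  ultimately show ?thesis unfolding adm_def target_item using i width_kind[OF i(1)] height_kind[OF i(1)]
    by (auto simp: BS)
qed

lemma move_item:
  assumes S: "inv S" and "regular S"
  shows "move quad (1, 0, 0) (1, 0, 0) (item S) (item (nxt S))"
proof -
  obtain k l e d x y where BS: "S = BS k l e d x y" by (cases S)
  have i: "even k \<or> even l" "\<bar>e\<bar> = 1" "\<bar>d\<bar> = 1" "in_span a k e x" "in_span b l d y"
    using S unfolding inv_def BS by auto
  have ed: "e = 1 \<or> e = -1" "d = 1 \<or> d = -1" using i unit_cases by auto
  let ?u = "e * (x - ent a k e)" and ?w = "d * (y - ent b l d)"
  have t: "0 < tH S" "0 < tV S" using dt_pos[OF S] unfolding dt_def by auto
  have wh: "width quad (kind k l) = sin \<theta> * len a k" "height quad (kind k l) = cos \<theta> * len b l"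
    using width_kind[OF i(1)] height_kind[OF i(1)] by auto
  have tH: "cos \<theta> * tH S = len a k - ?u"
    using cos_tH[of S] ext_ent[OF i(2), of a k] unfolding BS by (simp add: algebra_simps)
  have tV: "sin \<theta> * tV S = len b l - ?w"
    using sin_tV[of S] ext_ent[OF i(3), of b l] unfolding BS by (simp add: algebra_simps)
  have lag: "lag S = sin \<theta> * ?u - cos \<theta> * ?w" unfolding lag_def BS by simp
  \<comment> \<open>Turns the comparison of the two exit times into the inequality that defines
    \<open>move\<close>.\<close>
  have gapeq: "lag S - (sin \<theta> * len a k - cos \<theta> * len b l) = cos \<theta> * sin \<theta> * (tV S - tH S)"
  proof -
    have "cos \<theta> * sin \<theta> * (tV S - tH S) = cos \<theta> * (sin \<theta> * tV S) - sin \<theta> * (cos \<theta> * tH S)"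
      by (simp add: algebra_simps)
    then show ?thesis unfolding tH tV lag by (simp add: algebra_simps)
  qed
  have cs: "0 < cos \<theta> * sin \<theta>" using cos sin by simp
  have proj: "co (item S) = lag S" "target (lt (item S)) = kind k l"
    unfolding target_item by (simp_all add: item_def BS)
  show ?thesis
  proof (cases "tH S < tV S")
    case True
    then have less: "sin \<theta> * len a k - cos \<theta> * len b l < lag S" using gapeq cs by (metis diff_gt_0_iff_gt mult_pos_pos)
    have "lag (nxt S) = - cos \<theta> * (?w + sin \<theta> * tH S)"
      using True ed i(2) ent_reflect[of e a k] ent_cross[of e a k]
      unfolding lag_def nxt_def BS by (auto simp: Let_def algebra_simps)
    then have lag': "lag (nxt S) = - (cos \<theta> * ?w) - sin \<theta> * (cos \<theta> * tH S)" by (simp add: algebra_simps)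
    have "0 \<le> ?w" using i(5) unfolding in_span_def by simp
    then have "0 \<le> cos \<theta> * ?w" "0 < sin \<theta> * (cos \<theta> * tH S)" using cos sin t(1) by auto
    then have neg: "lag (nxt S) < 0" unfolding lag' by linarith
    have lagd: "lag (nxt S) = lag S - sin \<theta> * len a k" unfolding lag' tH lag by (simp add: algebra_simps)
    have "item (nxt S) = enter (1, 0, 0) (1, 0, 0) (hexit (kind k l)) (lag S - width quad (kind k l)) (item S)"
      using True neg ed i(1) unfolding wh lagd[symmetric]
      by (auto simp: item_def nxt_def BS Let_def kind_def)
    then show ?thesis
      using move_h[of quad "item S" "(1, 0, 0)" "(1, 0, 0)"] less by (simp only: proj wh)
  next
    case False
    then have tlt: "tV S < tH S" using assms(2) unfolding regular_def by simp
    then have "0 < cos \<theta> * sin \<theta> * (tH S - tV S)" using cs by simp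
    then have less: "lag S < sin \<theta> * len a k - cos \<theta> * len b l" using gapeq by (simp add: algebra_simps)
    have "lag (nxt S) = sin \<theta> * (?u + cos \<theta> * tV S)"
      using False ed i(3) ent_reflect[of d b l] ent_cross[of d b l]
      unfolding lag_def nxt_def BS by (auto simp: Let_def algebra_simps)
    then have lag': "lag (nxt S) = sin \<theta> * ?u + cos \<theta> * (sin \<theta> * tV S)" by (simp add: algebra_simps)
    have "0 \<le> ?u" using i(4) unfolding in_span_def by simp
    then have "0 \<le> sin \<theta> * ?u" "0 < cos \<theta> * (sin \<theta> * tV S)" using cos sin t(2) by auto
    then have pos: "0 \<le> lag (nxt S)" unfolding lag' by linarith
    have lagd: "lag (nxt S) = lag S + cos \<theta> * len b l" unfolding lag' tV lag by (simp add: algebra_simps)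
    have "item (nxt S) = enter (1, 0, 0) (1, 0, 0) (vexit (kind k l)) (lag S + height quad (kind k l)) (item S)"
      using False pos ed i(1) unfolding wh lagd[symmetric]
      by (auto simp: item_def nxt_def BS Let_def kind_def)
    then show ?thesis
      using move_v[of "item S" quad "(1, 0, 0)" "(1, 0, 0)"] less by (simp only: proj wh)
  qed
qed

lemma path_item:
  assumes S: "inv S" and r: "\<And>k. regular (st S k)" and ij: "i \<le> j"
  shows "\<exists>ls. path (move quad (1, 0, 0) (1, 0, 0)) (item (st S i)) ls (item (st S j)) \<and>
    (Rh \<notin> set ls \<longrightarrow> hdir (st S j) = hdir (st S i) \<and>
       xc (st S j) - xc (st S i) = hdir (st S i) * cos \<theta> * (tm S j - tm S i)) \<and>
    (Bt \<notin> set ls \<longrightarrow> vdir (st S j) = vdir (st S i) \<and>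
       yc (st S j) - yc (st S i) = vdir (st S i) * sin \<theta> * (tm S j - tm S i))"
  using ij
proof (induction j rule: dec_induct)
  case base
  show ?case by (intro exI[of _ "[]"]) (auto intro: path.path_Nil)
next
  case (step j)
  let ?S = "st S j"
  have inv: "inv ?S" using inv_st[OF S] r by blast
  obtain ls where IH: "path (move quad (1, 0, 0) (1, 0, 0)) (item (st S i)) ls (item ?S)"
    "Rh \<notin> set ls \<longrightarrow> hdir ?S = hdir (st S i) \<and>
       xc ?S - xc (st S i) = hdir (st S i) * cos \<theta> * (tm S j - tm S i)"
    "Bt \<notin> set ls \<longrightarrow> vdir ?S = vdir (st S i) \<and>
       yc ?S - yc (st S i) = vdir (st S i) * sin \<theta> * (tm S j - tm S i)" using step.IH by blast
  have mv: "move quad (1, 0, 0) (1, 0, 0) (item ?S) (item (nxt ?S))" by (rule move_item[OF inv r])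
  have p: "path (move quad (1, 0, 0) (1, 0, 0)) (item (st S i)) (ls @ [lt (item (nxt ?S))]) (item (nxt ?S))"
    by (rule path.path_snoc[OF IH(1) mv])
  have "xc (nxt ?S) = xc ?S + dt ?S * (hdir ?S * cos \<theta>)" "yc (nxt ?S) = yc ?S + dt ?S * (vdir ?S * sin \<theta>)"
    using nxt_pos[OF r[unfolded regular_def] inv] unfolding pos_def vel_def by auto
  note step_pos = this
  have dirs: "lt (item (nxt ?S)) \<noteq> Rh \<Longrightarrow> hdir (nxt ?S) = hdir ?S"
    "lt (item (nxt ?S)) \<noteq> Bt \<Longrightarrow> vdir (nxt ?S) = vdir ?S"
  proof -
    obtain l' c' where e: "item (nxt ?S) = enter (1, 0, 0) (1, 0, 0) l' c' (item ?S)"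
      using move_enter[OF mv] by metis
    obtain l0 c0 where it: "item ?S = Item l0 c0 (hdir ?S) (vdir ?S) (col ?S) (row ?S)"
      by (simp add: item_def)
    have *: "lt (item (nxt ?S)) = l'" "ex (item (nxt ?S)) = (if l' = Rh then - hdir ?S else hdir ?S)"
      "ey (item (nxt ?S)) = (if l' = Bt then - vdir ?S else vdir ?S)"
      unfolding e it by (simp_all add: Let_def)
    have "ex (item (nxt ?S)) = hdir (nxt ?S)" "ey (item (nxt ?S)) = vdir (nxt ?S)" by (simp_all add: item_def)
    then show "lt (item (nxt ?S)) \<noteq> Rh \<Longrightarrow> hdir (nxt ?S) = hdir ?S"
      "lt (item (nxt ?S)) \<noteq> Bt \<Longrightarrow> vdir (nxt ?S) = vdir ?S" using * by auto
  qed
  have "hdir (nxt ?S) = hdir (st S i) \<and>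
       xc (nxt ?S) - xc (st S i) = hdir (st S i) * cos \<theta> * (tm S (Suc j) - tm S i)"
    if n: "Rh \<notin> set (ls @ [lt (item (nxt ?S))])"
  proof -
    have h: "hdir ?S = hdir (st S i)" "xc ?S - xc (st S i) = hdir (st S i) * cos \<theta> * (tm S j - tm S i)"
      "hdir (nxt ?S) = hdir ?S" using n IH(2) dirs(1) by auto
    have "xc (nxt ?S) - xc (st S i) = dt ?S * (hdir (st S i) * cos \<theta>) + (xc ?S - xc (st S i))"
      unfolding step_pos(1) h(1) by simp
    then show ?thesis unfolding h(2) tm_Suc using h by (simp add: algebra_simps)
  qed
  moreover have "vdir (nxt ?S) = vdir (st S i) \<and>
       yc (nxt ?S) - yc (st S i) = vdir (st S i) * sin \<theta> * (tm S (Suc j) - tm S i)"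
    if n: "Bt \<notin> set (ls @ [lt (item (nxt ?S))])"
  proof -
    have h: "vdir ?S = vdir (st S i)" "yc ?S - yc (st S i) = vdir (st S i) * sin \<theta> * (tm S j - tm S i)"
      "vdir (nxt ?S) = vdir ?S" using n IH(3) dirs(2) by auto
    have "yc (nxt ?S) - yc (st S i) = dt ?S * (vdir (st S i) * sin \<theta>) + (yc ?S - yc (st S i))"
      unfolding step_pos(2) h(1) by simp
    then show ?thesis unfolding h(2) tm_Suc using h by (simp add: algebra_simps)
  qed
  ultimately show ?case unfolding st_Suc using p by blast
qed

end

locale renormalizable_wind_tree = wind_tree +
  assumes ren: "F_renormalizable quad" and even_n: "\<And>k. even (n_conv ((F ^^ k) quad))"
begin

lemma same_box:
  assumes S: "inv S" and r: "\<And>k. regular (st S k)" and ij: "i \<le> j"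
    and eq: "col (st S i) = col (st S j)" "row (st S i) = row (st S j)"
  shows "hdir (st S j) = hdir (st S i) \<and>
       xc (st S j) - xc (st S i) = hdir (st S i) * cos \<theta> * (tm S j - tm S i) \<or>
     vdir (st S j) = vdir (st S i) \<and>
       yc (st S j) - yc (st S i) = vdir (st S i) * sin \<theta> * (tm S j - tm S i)"
proof -
  obtain ls where ls: "path (move quad (1, 0, 0) (1, 0, 0)) (item (st S i)) ls (item (st S j))"
    "Rh \<notin> set ls \<longrightarrow> hdir (st S j) = hdir (st S i) \<and>
       xc (st S j) - xc (st S i) = hdir (st S i) * cos \<theta> * (tm S j - tm S i)"
    "Bt \<notin> set ls \<longrightarrow> vdir (st S j) = vdir (st S i) \<and>
       yc (st S j) - yc (st S i) = vdir (st S i) * sin \<theta> * (tm S j - tm S i)"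
    using path_item[OF S r ij] by blast
  have "adm quad (item (st S i))" using adm_item inv_st[OF S] r by blast
  then have "set ls \<subseteq> {Bt} \<or> set ls \<subseteq> {Rh}"
    using unique_visit[OF ren even_n _ ls(1)] eq by (simp add: item_def)
  then show ?thesis using ls(2,3) by blast
qed

end

context wind_tree
begin

section \<open>Points of a visited box\<close>

lemma closed_box:
  assumes S: "inv S" and s: "0 \<le> s" "s \<le> dt S" and p: "(x, y) = pos S + s *\<^sub>R vel S"
  shows "edge a (col S) \<le> x" "x \<le> edge a (col S + 1)" "edge b (row S) \<le> y" "y \<le> edge b (row S + 1)"
proof -
  obtain k l e d x0 y0 where BS: "S = BS k l e d x0 y0" by (cases S)
  have i: "e = 1 \<or> e = -1" "d = 1 \<or> d = -1" "in_span a k e x0" "in_span b l d y0"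
    using S unit_cases unfolding inv_def BS by auto
  have "s \<le> tH S" "s \<le> tV S" using s unfolding dt_def by auto
  then have "s * cos \<theta> \<le> e * (ext a k e - x0)" "s * sin \<theta> \<le> d * (ext b l d - y0)"
    using cos sin unfolding tH_def tV_def BS by (simp_all add: field_simps)
  moreover have "0 \<le> s * cos \<theta>" "0 \<le> s * sin \<theta>" using s cos sin by auto
  moreover have "x = x0 + e * (s * cos \<theta>)" "y = y0 + d * (s * sin \<theta>)"
    using p unfolding pos_def vel_def BS by (auto simp: algebra_simps)
  ultimately show "edge a (col S) \<le> x" "x \<le> edge a (col S + 1)" "edge b (row S) \<le> y" "y \<le> edge b (row S + 1)"
    using i unfolding in_span_def ent_def ext_def BS by auto
qed

lemma open_box:
  assumes S: "inv S" and s: "0 < s" "s < dt S" and p: "(x, y) = pos S + s *\<^sub>R vel S"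
  shows "edge a (col S) < x" "x < edge a (col S + 1)" "edge b (row S) < y" "y < edge b (row S + 1)"
proof -
  obtain k l e d x0 y0 where BS: "S = BS k l e d x0 y0" by (cases S)
  have i: "e = 1 \<or> e = -1" "d = 1 \<or> d = -1" "in_span a k e x0" "in_span b l d y0"
    using S unit_cases unfolding inv_def BS by auto
  have "s < tH S" "s < tV S" using s unfolding dt_def by auto
  then have "s * cos \<theta> < e * (ext a k e - x0)" "s * sin \<theta> < d * (ext b l d - y0)"
    using cos sin unfolding tH_def tV_def BS by (simp_all add: field_simps)
  moreover have "0 < s * cos \<theta>" "0 < s * sin \<theta>" using s cos sin by auto
  moreover have "x = x0 + e * (s * cos \<theta>)" "y = y0 + d * (s * sin \<theta>)"
    using p unfolding pos_def vel_def BS by (auto simp: algebra_simps)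
  ultimately show "edge a (col S) < x" "x < edge a (col S + 1)" "edge b (row S) < y" "y < edge b (row S + 1)"
    using i unfolding in_span_def ent_def ext_def BS by auto
qed

lemma edge_box_closed:
  assumes "edge c k < x" "x < edge c (k + 1)" "edge c j \<le> x" "x \<le> edge c (j + 1)" "0 < c" "c < 1"
  shows "j = k"
proof -
  have "edge c k < edge c (j + 1)" "edge c j < edge c (k + 1)" using assms by linarith+
  then show ?thesis using edge_less_iff assms by simp
qed

text \<open>An event point is interior to a single grid side, so it lies in just two closed boxes.
  At a reflection one of these is an obstacle, excluded by the parity assumption.\<close>

lemma box_at_event:
  assumes S: "inv S" and "regular S" and p: "(x, y) = pos (nxt S)" and kl: "even k \<or> even l"
    and box: "edge a k \<le> x" "x \<le> edge a (k + 1)" "edge b l \<le> y" "y \<le> edge b (l + 1)"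
  shows "k = col S \<and> l = row S \<or> k = col (nxt S) \<and> l = row (nxt S)"
proof -
  obtain k0 l0 e d x0 y0 where BS: "S = BS k0 l0 e d x0 y0" by (cases S)
  have i: "even k0 \<or> even l0" "\<bar>e\<bar> = 1" "\<bar>d\<bar> = 1" "in_span a k0 e x0" "in_span b l0 d y0"
    using S unfolding inv_def BS by auto
  have ed: "e = 1 \<or> e = -1" "d = 1 \<or> d = -1" using i unit_cases by auto
  have t: "0 < tH S" "0 < tV S" using dt_pos[OF S] unfolding dt_def by auto
  show ?thesis
  proof (cases "tH S < tV S")
    case True
    have "sin \<theta> * tH S < d * (ext b l0 d - y0)"
      using True sin unfolding tV_def BS by (simp add: field_simps)
    moreover have "0 < sin \<theta> * tH S" using t sin by simp
    ultimately have y: "edge b l0 < y0 + d * (sin \<theta> * tH S)" "y0 + d * (sin \<theta> * tH S) < edge b (l0 + 1)"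
      using strictly_in_span i by blast+
    have xy: "x = ext a k0 e" "y = y0 + d * (sin \<theta> * tH S)"
      using True p unfolding nxt_def pos_def BS by (auto simp: Let_def mult.assoc)
    have l: "l = l0" using edge_box_closed[OF y[folded xy(2)] box(3,4) b] .
    have "k = k0 \<or> k = k0 + e"
      using box(1,2) ed(1) edge_le_iff[OF a] unfolding xy ext_def by auto
    then show ?thesis using l True kl i(1) ed unfolding nxt_def BS by (auto simp: Let_def)
  next
    case False
    then have "tV S < tH S" using assms(2) unfolding regular_def by simp
    then have "cos \<theta> * tV S < e * (ext a k0 e - x0)"
      using cos unfolding tH_def BS by (simp add: field_simps)
    moreover have "0 < cos \<theta> * tV S" using t cos by simp
    ultimately have x: "edge a k0 < x0 + e * (cos \<theta> * tV S)" "x0 + e * (cos \<theta> * tV S) < edge a (k0 + 1)"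
      using strictly_in_span i by blast+
    have xy: "x = x0 + e * (cos \<theta> * tV S)" "y = ext b l0 d"
      using False p unfolding nxt_def pos_def BS by (auto simp: Let_def mult.assoc)
    have k: "k = k0" using edge_box_closed[OF x[folded xy(1)] box(1,2) a] .
    have "l = l0 \<or> l = l0 + d"
      using box(3,4) ed(2) edge_le_iff[OF b] unfolding xy ext_def by auto
    then show ?thesis using k False kl i(1) ed unfolding nxt_def BS by (auto simp: Let_def)
  qed
qed

end

context renormalizable_wind_tree
begin

text \<open>One coordinate moves at constant speed from the first visit through the second, so the
  points differ in it. As the sides of a box are at most 1, the elapsed time is at most
  \<open>1 / cos \<theta>\<close> or \<open>1 / sin \<theta>\<close>; the sum covers both
  cases.\<close>

lemma revisit:
  assumes S: "inv S" and r: "\<And>k. regular (st S k)" and ij: "i \<le> j"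
    and eq: "col (st S i) = col (st S j)" "row (st S i) = row (st S j)"
    and t: "tm S i \<le> t" "t \<le> tm S (Suc i)" and t': "tm S j \<le> t'" "t' \<le> tm S (Suc j)" and "t < t'"
    and p: "p = pos (st S i) + (t - tm S i) *\<^sub>R vel (st S i)"
    and p': "p' = pos (st S j) + (t' - tm S j) *\<^sub>R vel (st S j)"
  shows "p \<noteq> p'" "t' - t \<le> 1 / cos \<theta> + 1 / sin \<theta>"
proof -
  let ?A = "st S i" and ?B = "st S j"
  have inv: "inv ?A" "inv ?B" using inv_st[OF S] r by blast+
  have u: "\<bar>hdir ?A\<bar> = 1" "\<bar>vdir ?A\<bar> = 1" using inv(1) unfolding inv_def by auto
  obtain x y x' y' where P: "p = (x, y)" "p' = (x', y')" by (cases p; cases p')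
  have cA: "edge a (col ?A) \<le> x" "x \<le> edge a (col ?A + 1)" "edge b (row ?A) \<le> y" "y \<le> edge b (row ?A + 1)"
    using closed_box[OF inv(1), of "t - tm S i" x y] t p P by (auto simp: tm_Suc)
  have cB: "edge a (col ?A) \<le> x'" "x' \<le> edge a (col ?A + 1)" "edge b (row ?A) \<le> y'" "y' \<le> edge b (row ?A + 1)"
    using closed_box[OF inv(2), of "t' - tm S j" x' y'] t' p' P eq by (auto simp: tm_Suc)
  have lens: "len a (col ?A) \<le> 1" "len b (row ?A) \<le> 1" using a b by (auto simp: len_eq)
  have x: "x = xc ?A + (t - tm S i) * (hdir ?A * cos \<theta>)" "y = yc ?A + (t - tm S i) * (vdir ?A * sin \<theta>)"
    "x' = xc ?B + (t' - tm S j) * (hdir ?B * cos \<theta>)" "y' = yc ?B + (t' - tm S j) * (vdir ?B * sin \<theta>)"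
    using p p' P unfolding pos_def vel_def by auto
  have inv_pos: "0 < 1 / cos \<theta>" "0 < 1 / sin \<theta>" using cos sin by auto
  from same_box[OF S r ij eq]
  have "p \<noteq> p' \<and> t' - t \<le> 1 / cos \<theta> + 1 / sin \<theta>"
  proof (elim disjE conjE)
    assume h: "hdir ?B = hdir ?A" "xc ?B - xc ?A = hdir ?A * cos \<theta> * (tm S j - tm S i)"
    have "x' - x = hdir ?A * cos \<theta> * (t' - t)" using h(2) unfolding x h(1) by (simp add: algebra_simps)
    then have "\<bar>x' - x\<bar> = cos \<theta> * (t' - t)" using u cos \<open>t < t'\<close> by (simp add: abs_mult flip: of_int_abs)
    moreover have "\<bar>x' - x\<bar> \<le> 1" using cA cB lens unfolding len_def by linarith
    moreover have "0 < cos \<theta> * (t' - t)" using cos \<open>t < t'\<close> by simp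
    ultimately have n: "x \<noteq> x'" "t' - t \<le> 1 / cos \<theta>" using cos by (auto simp: field_simps)
    then have "t' - t \<le> 1 / cos \<theta> + 1 / sin \<theta>" using inv_pos by linarith
    then show ?thesis using P n by auto
  next
    assume h: "vdir ?B = vdir ?A" "yc ?B - yc ?A = vdir ?A * sin \<theta> * (tm S j - tm S i)"
    have "y' - y = vdir ?A * sin \<theta> * (t' - t)" using h(2) unfolding x h(1) by (simp add: algebra_simps)
    then have "\<bar>y' - y\<bar> = sin \<theta> * (t' - t)" using u sin \<open>t < t'\<close> by (simp add: abs_mult flip: of_int_abs)
    moreover have "\<bar>y' - y\<bar> \<le> 1" using cA cB lens unfolding len_def by linarith
    moreover have "0 < sin \<theta> * (t' - t)" using sin \<open>t < t'\<close> by simp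
    ultimately have n: "y \<noteq> y'" "t' - t \<le> 1 / sin \<theta>" using sin by (auto simp: field_simps)
    then have "t' - t \<le> 1 / cos \<theta> + 1 / sin \<theta>" using inv_pos by linarith
    then show ?thesis using P n by auto
  qed
  then show "p \<noteq> p'" "t' - t \<le> 1 / cos \<theta> + 1 / sin \<theta>" by auto
qed

text \<open>Between events the later point is interior to its box, so the earlier visit was to the
  same box. At an event the earlier visit may be to either adjacent box, and the later time counts
  as the end of one visit or the start of the next.\<close>

lemma no_self_intersection:
  assumes p: "p \<in> table a b - corners a b" and S: "initial p S" and r: "\<And>k. regular (st S k)"
  shows "self_avoiding a b \<theta> p"
  unfolding self_avoiding_def
proof (intro allI impI notI, elim conjE)
  fix t t' :: real assume t: "0 \<le> t" "t < t'" and eq: "flow a b \<theta> t p = flow a b \<theta> t' p"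
  have inv: "inv S" using S unfolding initial_def by simp
  have invs: "inv (st S n)" for n using inv_st[OF inv] r by blast
  obtain i where i: "tm S i \<le> t" "t < tm S (Suc i)" using tm_interval[OF inv r t(1)] by blast
  obtain j where j: "tm S j \<le> t'" "t' < tm S (Suc j)" using tm_interval[OF inv r, of t'] t by auto
  have mono: "tm S m \<le> tm S n" if "m \<le> n" for m n using tm_mono[OF inv r that order_refl] .
  have ij: "i \<le> j"
  proof (rule ccontr)
    assume "\<not> ?thesis"
    then have "tm S (Suc j) \<le> tm S i" by (intro mono) simp
    then show False using i j t by linarith
  qed
  have fi: "flow a b \<theta> t p = pos (st S i) + (t - tm S i) *\<^sub>R vel (st S i)"
    using flow_formula(2)[OF p S r] i by simp
  have fj: "flow a b \<theta> t' p = pos (st S j) + (t' - tm S j) *\<^sub>R vel (st S j)"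
    using flow_formula(2)[OF p S r] j by simp
  obtain x y where xy: "flow a b \<theta> t p = (x, y)" by (cases "flow a b \<theta> t p")
  have box: "edge a (col (st S i)) \<le> x" "x \<le> edge a (col (st S i) + 1)"
     "edge b (row (st S i)) \<le> y" "y \<le> edge b (row (st S i) + 1)"
    using closed_box[OF invs, of "t - tm S i" i x y] i fi xy by (auto simp: tm_Suc)
  have same: False if "col (st S i) = col (st S j)" "row (st S i) = row (st S j)"
    using revisit(1)[OF inv r ij that _ _ _ _ t(2) fi fj] i j eq by simp
  show False
  proof (cases "tm S j < t'")
    case True
    have ob: "edge a (col (st S j)) < x" "x < edge a (col (st S j) + 1)"
       "edge b (row (st S j)) < y" "y < edge b (row (st S j) + 1)"
      using open_box[OF invs, of "t' - tm S j" j x y] True j fj xy eq by (auto simp: tm_Suc)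
    show False using same edge_box_closed[OF ob(1,2) box(1,2) a] edge_box_closed[OF ob(3,4) box(3,4) b] by simp
  next
    case False
    then have t': "t' = tm S j" using j by simp
    then have "i \<noteq> j" using i t by auto
    then obtain m where m: "j = Suc m" "i \<le> m" using ij by (cases j) auto
    have pn: "(x, y) = pos (nxt (st S m))" using fj t' xy eq m by (simp add: st_Suc)
    have ev: "even (col (st S i)) \<or> even (row (st S i))" using invs[of i] unfolding inv_def by simp
    from box_at_event[OF invs r pn ev box] show False
    proof (elim disjE conjE)
      assume c: "col (st S i) = col (st S m)" "row (st S i) = row (st S m)"
      have "flow a b \<theta> t' p = pos (st S m) + (t' - tm S m) *\<^sub>R vel (st S m)"
        using flow_formula(2)[OF p S r, of m t'] t' m mono[of m "Suc m"] by simp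
      then show False
        using revisit(1)[OF inv r m(2) c _ _ _ _ t(2) fi] i t' m mono[of m "Suc m"] eq by simp
    qed (use same m in \<open>simp add: st_Suc\<close>)
  qed
qed

section \<open>Divergence\<close>

lemma edge_bounds: "of_int k / 2 - 1 \<le> edge c k" "edge c k \<le> of_int k / 2 + 1" if "0 < c" "c < 1"
proof -
  have "real_of_int k = 2 * of_int (k div 2) + of_int (k mod 2)"
    by (metis mult.commute of_int_add of_int_mult of_int_numeral div_mult_mod_eq)
  moreover have "k mod 2 = 0 \<or> k mod 2 = 1" by auto
  ultimately show "of_int k / 2 - 1 \<le> edge c k" "edge c k \<le> of_int k / 2 + 1"
    using that unfolding edge_def by auto
qed

text \<open>The bound of \<open>revisit\<close> limits the span from the first to the last presence
  in a box, not only the length of one stay. Hence the times spent in box \<open>c\<close> are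
  bounded by some \<open>B c\<close>.\<close>

lemma escape:
  assumes p: "p \<in> table a b - corners a b" and S: "initial p S" and r: "\<And>k. regular (st S k)"
  shows "Liminf at_top (\<lambda>t. ereal (dist p (flow a b \<theta> t p))) = \<infinity>"
proof -
  have inv: "inv S" using S unfolding initial_def by simp
  have invs: "inv (st S n)" for n using inv_st[OF inv] r by blast
  have mono: "tm S m \<le> tm S n" if "m \<le> n" for m n using tm_mono[OF inv r that order_refl] .
  let ?L = "1 / cos \<theta> + 1 / sin \<theta>"
  let ?at = "\<lambda>c t. \<exists>i. tm S i \<le> t \<and> t < tm S (Suc i) \<and> c = (col (st S i), row (st S i))"
  have L: "0 < ?L" using cos sin by (simp add: add_pos_pos)
  have visit: "t' - t \<le> ?L" if at: "?at c t" "?at c t'" for c t t'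
  proof (cases "t < t'")
    case False
    then show ?thesis using L by simp
  next
    case True
    obtain i j where i: "tm S i \<le> t" "t < tm S (Suc i)" "c = (col (st S i), row (st S i))"
      and j: "tm S j \<le> t'" "t' < tm S (Suc j)" "c = (col (st S j), row (st S j))" using at by blast
    have ij: "i \<le> j"
    proof (rule ccontr)
      assume "\<not> ?thesis"
      then have "tm S (Suc j) \<le> tm S i" by (intro mono) simp
      then show False using i j True by linarith
    qed
    show ?thesis using revisit(2)[OF inv r ij _ _ _ _ _ _ True refl refl] i j by simp
  qed
  have bound: "\<exists>B. \<forall>t. ?at c t \<longrightarrow> t \<le> B" for c
  proof (cases "\<exists>t. ?at c t")
    case True
    then obtain t0 where "?at c t0" by blast
    then have "t \<le> t0 + ?L" if "?at c t" for t using visit[OF _ that] by fastforce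
    then show ?thesis by blast
  qed blast
  then obtain B where B: "\<And>c t. ?at c t \<Longrightarrow> t \<le> B c" by metis
  have "\<forall>\<^sub>F t in at_top. R \<le> dist p (flow a b \<theta> t p)" for R
  proof -
    obtain x0 y0 where P: "p = (x0, y0)" by (cases p)
    \<comment> \<open>Points of column \<open>k\<close> have abscissas within 2 of
      \<open>k / 2\<close>, and likewise for rows; so points closer to \<open>p\<close> than
      \<open>R\<close> lie in boxes with indices at most \<open>N\<close> in absolute value.\<close>
    define N where "N = \<lceil>2 * (\<bar>x0\<bar> + \<bar>y0\<bar> + \<bar>R\<bar> + 3)\<rceil>"
    define C where "C = {-N..N} \<times> {-N..N}"
    define T where "T = Max (insert 0 (B ` C))"
    have fin: "finite C" unfolding C_def by simp
    have "R \<le> dist p (flow a b \<theta> t p)" if t: "T < t" for t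
    proof (rule ccontr)
      assume near: "\<not> ?thesis"
      have "0 \<le> T" unfolding T_def using fin by simp
      then have "0 \<le> t" using t by simp
      then obtain i where i: "tm S i \<le> t" "t < tm S (Suc i)" using tm_interval[OF inv r] by blast
      let ?S = "st S i"
      obtain x y where xy: "flow a b \<theta> t p = (x, y)" by (cases "flow a b \<theta> t p")
      have "(x, y) = pos ?S + (t - tm S i) *\<^sub>R vel ?S"
        using flow_formula(2)[OF p S r] i xy by simp
      then have box: "edge a (col ?S) \<le> x" "x \<le> edge a (col ?S + 1)"
         "edge b (row ?S) \<le> y" "y \<le> edge b (row ?S + 1)"
        using closed_box[OF invs, of "t - tm S i" i x y] i by (auto simp: tm_Suc)
      have "dist x0 x \<le> dist p (flow a b \<theta> t p)" "dist y0 y \<le> dist p (flow a b \<theta> t p)"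
        using dist_fst_le[of "(x0, y0)" "(x, y)"] dist_snd_le[of "(x0, y0)" "(x, y)"] xy P by auto
      then have xy_near: "\<bar>x\<bar> \<le> \<bar>x0\<bar> + \<bar>R\<bar>" "\<bar>y\<bar> \<le> \<bar>y0\<bar> + \<bar>R\<bar>"
        using near unfolding dist_real_def by linarith+
      have N: "2 * (\<bar>x0\<bar> + \<bar>y0\<bar> + \<bar>R\<bar> + 3) \<le> of_int N" unfolding N_def by linarith
      have "of_int (col ?S) / 2 - 1 \<le> x" "x \<le> of_int (col ?S) / 2 + 2"
        using edge_bounds(1)[OF a, of "col ?S"] edge_bounds(2)[OF a, of "col ?S + 1"] box(1,2)
        by (auto simp: add_divide_distrib)
      then have col: "\<bar>real_of_int (col ?S)\<bar> \<le> 2 * \<bar>x\<bar> + 4" by linarith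
      have "of_int (row ?S) / 2 - 1 \<le> y" "y \<le> of_int (row ?S) / 2 + 2"
        using edge_bounds(1)[OF b, of "row ?S"] edge_bounds(2)[OF b, of "row ?S + 1"] box(3,4)
        by (auto simp: add_divide_distrib)
      then have row: "\<bar>real_of_int (row ?S)\<bar> \<le> 2 * \<bar>y\<bar> + 4" by linarith
      have bound: "c \<le> N'" if "c \<le> 2 * z + 4" "z \<le> z0 + R'" "2 * (z0 + w + R' + 3) \<le> N'" "0 \<le> w"
        for c z z0 w R' N' :: real
        using that by simp
      have N': "2 * (\<bar>y0\<bar> + \<bar>x0\<bar> + \<bar>R\<bar> + 3) \<le> of_int N"
        using N by (simp only: add.commute[of "\<bar>y0\<bar>" "\<bar>x0\<bar>"])
      have "\<bar>real_of_int (col ?S)\<bar> \<le> of_int N" "\<bar>real_of_int (row ?S)\<bar> \<le> of_int N"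
        using bound[OF col xy_near(1) N abs_ge_zero] bound[OF row xy_near(2) N' abs_ge_zero] by blast+
      then have "(col ?S, row ?S) \<in> C" unfolding C_def by auto
      then have "B (col ?S, row ?S) \<le> T" unfolding T_def using fin by simp
      moreover have "t \<le> B (col ?S, row ?S)" using B i by blast
      ultimately show False using t by simp
    qed
    then show ?thesis unfolding eventually_at_top_dense by blast
  qed
  then have "filterlim (\<lambda>t. dist p (flow a b \<theta> t p)) at_top at_top" unfolding filterlim_at_top by blast
  then have "((\<lambda>t. ereal (dist p (flow a b \<theta> t p))) \<longlongrightarrow> \<infinity>) at_top"
    by (simp add: tendsto_PInfty_eq_at_top)
  then show ?thesis by (intro lim_imp_Liminf) auto
qed

end

section \<open>Almost every trajectory is infinite\<close>

context wind_tree
begin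

text \<open>The lag changes by such a combination at every event, so a trajectory that hits a corner starts
  with one of countably many lags.\<close>

fun combo :: "int \<times> int \<times> int \<times> int \<Rightarrow> real" where
  "combo (i, j, m, n) = i * ((1 - b) * cos \<theta>) + j * (b * cos \<theta>) + m * ((1 - a) * sin \<theta>) + n * (a * sin \<theta>)"

lemma combo_add: "\<exists>q. combo q = combo q1 + combo q2"
proof -
  obtain i j m n i' j' m' n' where "q1 = (i, j, m, n)" "q2 = (i', j', m', n')" by (cases q1; cases q2)
  then have "combo (i + i', j + j', m + m', n + n') = combo q1 + combo q2" by (simp add: algebra_simps)
  then show ?thesis by blast
qed

lemma combo_len: "\<exists>q. combo q = sin \<theta> * len a k" "\<exists>q. combo q = - (sin \<theta> * len a k)"
  "\<exists>q. combo q = cos \<theta> * len b k" "\<exists>q. combo q = - (cos \<theta> * len b k)"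
proof -
  show "\<exists>q. combo q = sin \<theta> * len a k"
    by (rule exI[of _ "if even k then (0, 0, 1, 0) else (0, 0, 0, 1)"]) (simp add: len_eq)
  show "\<exists>q. combo q = - (sin \<theta> * len a k)"
    by (rule exI[of _ "if even k then (0, 0, - 1, 0) else (0, 0, 0, - 1)"]) (simp add: len_eq)
  show "\<exists>q. combo q = cos \<theta> * len b k"
    by (rule exI[of _ "if even k then (1, 0, 0, 0) else (0, 1, 0, 0)"]) (simp add: len_eq)
  show "\<exists>q. combo q = - (cos \<theta> * len b k)"
    by (rule exI[of _ "if even k then (- 1, 0, 0, 0) else (0, - 1, 0, 0)"]) (simp add: len_eq)
qed

lemma lag_nxt:
  assumes S: "inv S" and r: "regular S"
  shows "\<exists>q. lag (nxt S) = lag S + combo q"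
proof -
  have k: "even (col S) \<or> even (row S)" using S unfolding inv_def by simp
  have co: "co (item S') = lag S'" for S' by (simp add: item_def)
  have co_enter: "co (enter P Q l c s) = c" for P Q l c s by (cases s) (simp add: Let_def)
  from move_item[OF S r]
  have "lag (nxt S) = lag S - sin \<theta> * len a (col S) \<or> lag (nxt S) = lag S + cos \<theta> * len b (row S)"
  proof (cases rule: move_cases)
    case h
    then show ?thesis using arg_cong[OF h(2), of co]
      unfolding co co_enter target_item width_kind[OF k] by simp
  next
    case v
    then show ?thesis using arg_cong[OF v(2), of co]
      unfolding co co_enter target_item height_kind[OF k] by simp
  qed
  moreover obtain q1 q2 where "combo q1 = - (sin \<theta> * len a (col S))" "combo q2 = cos \<theta> * len b (row S)"
    using combo_len by metis
  ultimately have "lag (nxt S) = lag S + combo q1 \<or> lag (nxt S) = lag S + combo q2" by simp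
  then show ?thesis by blast
qed

lemma lag_st:
  assumes S: "inv S" and r: "\<And>k. k < n \<Longrightarrow> regular (st S k)"
  shows "\<exists>q. lag (st S n) = lag S + combo q"
  using r
proof (induction n)
  case 0
  show ?case by (rule exI[of _ "(0, 0, 0, 0)"]) simp
next
  case (Suc n)
  obtain q1 where 1: "lag (st S n) = lag S + combo q1" using Suc by (metis less_SucI)
  have "inv (st S n)" using inv_st[OF S] Suc.prems by simp
  then obtain q2 where "lag (nxt (st S n)) = lag (st S n) + combo q2"
    using lag_nxt Suc.prems by blast
  moreover obtain q where "combo q = combo q1 + combo q2" using combo_add by blast
  ultimately have "lag (st S (Suc n)) = lag S + combo q" using 1 by (simp add: st_Suc)
  then show ?case by blast
qed

lemma singular_lag:
  assumes S: "inv S" and sing: "\<not> regular S"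
  shows "lag S = sin \<theta> * len a (col S) - cos \<theta> * len b (row S)"
proof -
  obtain k l e d x y where BS: "S = BS k l e d x y" by (cases S)
  have i: "\<bar>e\<bar> = 1" "\<bar>d\<bar> = 1" using S unfolding inv_def BS by auto
  have u: "e * (x - ent a k e) = len a k - cos \<theta> * tH S"
    using cos_tH[of S] ext_ent[OF i(1), of a k] unfolding BS by (simp add: algebra_simps)
  have w: "d * (y - ent b l d) = len b l - sin \<theta> * tV S"
    using sin_tV[of S] ext_ent[OF i(2), of b l] unfolding BS by (simp add: algebra_simps)
  have "lag S = sin \<theta> * (len a k - cos \<theta> * tH S) - cos \<theta> * (len b l - sin \<theta> * tV S)"
    unfolding lag_def BS bstate.sel u[unfolded BS] w[unfolded BS] ..
  then show ?thesis using sing unfolding regular_def BS by (simp add: algebra_simps)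
qed

text \<open>A line for fixed indices: the condition on \<open>e\<close> keeps its normal vector
  nonzero.\<close>

definition exceptional :: "int \<Rightarrow> int \<Rightarrow> int \<Rightarrow> int \<Rightarrow> int \<times> int \<times> int \<times> int \<Rightarrow> (real \<times> real) set" where
  "exceptional k l e d q = {(x, y). \<bar>e\<bar> = 1 \<and>
     sin \<theta> * (e * (x - ent a k e)) - cos \<theta> * (d * (y - ent b l d)) = combo q}"

lemma exceptional_negligible: "negligible (exceptional k l e d q)"
proof (cases "\<bar>e\<bar> = 1")
  case True
  then have "(sin \<theta> * e, - (cos \<theta> * d)) \<noteq> 0" using sin by (auto simp: zero_prod_def)
  then have "negligible {z. (sin \<theta> * e, - (cos \<theta> * d)) \<bullet> z =
      combo q + sin \<theta> * e * ent a k e - cos \<theta> * d * ent b l d}"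
    by (intro negligible_hyperplane) simp
  moreover have "exceptional k l e d q \<subseteq> {z. (sin \<theta> * e, - (cos \<theta> * d)) \<bullet> z =
      combo q + sin \<theta> * e * ent a k e - cos \<theta> * d * ent b l d}"
    unfolding exceptional_def by (auto simp: algebra_simps)
  ultimately show ?thesis by (rule negligible_subset)
qed (simp add: exceptional_def)

text \<open>At the first corner the lag is itself a combination, so the initial lag is a difference
  of two combinations.\<close>

lemma singular_exceptional:
  assumes S: "initial p S" and sing: "\<not> regular (st S n)"
  shows "\<exists>k l e d q. p \<in> exceptional k l e d q"
proof -
  have inv: "inv S" using S unfolding initial_def by simp
  define m where "m = (LEAST n. \<not> regular (st S n))"
  have m: "\<not> regular (st S m)" unfolding m_def by (rule LeastI) fact
  have r: "regular (st S k)" if "k < m" for k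
    using not_less_Least[of k "\<lambda>n. \<not> regular (st S n)"] that unfolding m_def by blast
  obtain q1 where 1: "lag (st S m) = lag S + combo q1" using lag_st[OF inv r] by blast
  have 2: "lag (st S m) = sin \<theta> * len a (col (st S m)) - cos \<theta> * len b (row (st S m))"
    using singular_lag inv_st[OF inv r] m by blast
  obtain q2 q3 where 3: "combo q2 = sin \<theta> * len a (col (st S m))"
    "combo q3 = - (cos \<theta> * len b (row (st S m)))" using combo_len by metis
  obtain q1' where 4: "combo q1' = - combo q1"
  proof -
    obtain i j k l where "q1 = (i, j, k, l)" by (cases q1)
    then have "combo (- i, - j, - k, - l) = - combo q1" by simp
    then show thesis by (rule that)
  qed
  obtain q4 where 5: "combo q4 = combo q2 + combo q3" using combo_add by blast
  obtain q where 6: "combo q = combo q4 + combo q1'" using combo_add by blast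
  have "lag S = combo q" using 1 2 3 4 5 6 by simp
  moreover have "pos S = p" "\<bar>hdir S\<bar> = 1" using S unfolding initial_def inv_def by auto
  ultimately have "p \<in> exceptional (col S) (row S) (hdir S) (vdir S) q"
    unfolding exceptional_def lag_def pos_def by auto
  then show ?thesis by blast
qed

lemma almost_all_regular:
  "AE p in lebesgue. p \<in> table a b \<longrightarrow>
     p \<in> table a b - corners a b \<and> (\<exists>S. initial p S \<and> (\<forall>k. regular (st S k)))"
proof -
  let ?E = "\<Union>(range (\<lambda>(k, l, e, d, q). exceptional k l e d q))"
  have E: "negligible ?E"
    by (rule negligible_countable_Union) (auto intro: exceptional_negligible)
  have "corners a b \<subseteq> (\<lambda>(k, l). (edge a k, edge b l)) ` UNIV"
  proof
    fix z
    assume "z \<in> corners a b"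
    then obtain k l where "z = (edge a k, edge b l)"
      using corners_edge[OF a(1) b(1)] by (cases z) auto
    then have "z = (\<lambda>(k, l). (edge a k, edge b l)) (k, l)" by simp
    then show "z \<in> (\<lambda>(k, l). (edge a k, edge b l)) ` UNIV" by blast
  qed
  then have "countable (corners a b)" by (rule countable_subset) simp
  then have "negligible (\<Union>((\<lambda>x. {x}) ` corners a b))"
    by (intro negligible_countable_Union) auto
  then have C: "negligible (corners a b)" by simp
  have null: "?E \<union> corners a b \<in> null_sets lebesgue"
    using negligible_Un[OF E C] by (simp add: negligible_iff_null_sets)
  show ?thesis
  proof (rule AE_I'[OF null], intro subsetI, rule ccontr)
    fix p
    assume p: "p \<in> {p \<in> space lebesgue. \<not> (p \<in> table a b \<longrightarrow>
       p \<in> table a b - corners a b \<and> (\<exists>S. initial p S \<and> (\<forall>k. regular (st S k))))}"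
      and n: "p \<notin> ?E \<union> corners a b"
    then have pt: "p \<in> table a b - corners a b" by blast
    then obtain S where S: "initial p S" using initial_exists by blast
    then obtain k where "\<not> regular (st S k)" using p pt by blast
    from singular_exceptional[OF S this] show False using n by fastforce
  qed
qed

end

context renormalizable_wind_tree
begin

lemma infinite_self_avoiding:
  assumes inf: "infinite_trajectory a b \<theta> p"
  shows "self_avoiding a b \<theta> p"
proof -
  obtain \<gamma> v where "billiard_motion a b \<theta> p 0 \<gamma> v"
    using inf unfolding infinite_trajectory_def position_at_def by blast
  then have p: "p \<in> table a b - corners a b" unfolding billiard_motion_def by auto
  then obtain S where S: "initial p S" using initial_exists by blast
  show ?thesis using no_self_intersection[OF p S] infinite_regular(2)[OF inf S] by blast
qed

lemma divergent: "divergent_flow a b \<theta>"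
  unfolding divergent_flow_def
  using almost_all_regular
proof eventually_elim
  case (elim p)
  then show ?case using flow_formula(1) escape by blast
qed

end

theorem theorem2:
  fixes a b \<theta> :: real and Z :: quadruple and m n :: "nat \<Rightarrow> int"
  assumes "0 < a" "a < 1" "0 < b" "b < 1" "0 \<le> \<theta>" "\<theta> < pi / 2"
    and "Z = ((1 - b) * cos \<theta>, b * cos \<theta>, (1 - a) * sin \<theta>, a * sin \<theta>)"
    and "F_renormalizable Z"
    and "\<And>k. F_convergent Z k = (m k, n k)"
    and "\<And>k. even (n k)"
  shows "(\<forall>p. infinite_trajectory a b \<theta> p \<longrightarrow> self_avoiding a b \<theta> p)
       \<and> divergent_flow a b \<theta>"
proof -
  \<comment> \<open>Positivity of the initial quadruple excludes \<theta> = 0, so both components of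
    the velocity are nonzero.\<close>
  have "positive ((F ^^ 0) Z)" using assms(8) unfolding F_renormalizable_def by blast
  then have "0 < b * cos \<theta>" "0 < a * sin \<theta>" unfolding assms(7) by simp_all
  then have "0 < cos \<theta>" "0 < sin \<theta>" using assms(1,3) by (simp_all add: zero_less_mult_iff)
  then interpret wind_tree a b \<theta> using assms(1-4) by unfold_locales
  have Z: "Z = quad" unfolding quad_def assms(7) ..
  have "even (n_conv ((F ^^ k) quad))" for k
    using assms(9)[of k] assms(10)[of k] unfolding F_convergent_def Z by simp
  then interpret renormalizable_wind_tree a b \<theta>
    using assms(8) unfolding Z by unfold_locales auto
  show ?thesis using infinite_self_avoiding divergent by blast
qed

end
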